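(* Let $d \ge 5$ and let $f \in L^1(\mathbb{R}^d) \cap L^2(\mathbb{R}^d)$. Then the periodizations satisfy $g_\rho \in L^2([0,1]^d)$ for almost every $\rho \in SO(d)$, and $$\int_{SO(d)} \|g_\rho\|_{L^2([0,1]^d)}^2 \, d\rho \le C\,(\|f\|_2 + \|f\|_1)^2,$$ where $C$ depends only on $d$.
   Context: For $f \in L^1(\mathbb{R}^d)$ and a rotation $\rho \in SO(d)$, the periodization of $f$ with respect to the rotated integer lattice is the $\mathbb{Z}^d$-periodic function $$g_\rho(x) = \sum_{\nu \in \mathbb{Z}^d} f(\rho(x-\nu)), \qquad x \in \mathbb{R}^d,$$ regarded as a function on $[0,1]^d$. The series converges absolutely for a.e. $x$, and $g_\rho \in L^1([0,1]^d)$. Here $d\rho$ denotes the normalized Haar (probability) measure on $SO(d)$. *)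

theory Defs
  imports "HOL-Probability.Probability"
begin

definition SO_group :: "(real^'n^'n) set" where
  "SO_group = {\<rho>. rotation_matrix \<rho>}"

text \<open>Normalized Haar (probability) measure on SO(d): a probability measure on the
Borel sets of SO(d) that is invariant under left multiplication. (It exists and is unique.)\<close>
definition is_haar_SO :: "(real^'n^'n) measure \<Rightarrow> bool" where
  "is_haar_SO M \<longleftrightarrow>
     sets M = sets (restrict_space borel SO_group) \<and>
     prob_space M \<and>
     (\<forall>\<rho>\<in>SO_group. distr M M (\<lambda>\<sigma>. \<rho> ** \<sigma>) = M)"

definition int_lattice :: "(real^'n) set" where
  "int_lattice = {\<nu>. \<forall>i. \<nu> $ i \<in> \<int>}"

definition unit_cube :: "(real^'n) set" where
  "unit_cube = {x. \<forall>i. 0 \<le> x $ i \<and> x $ i \<le> 1}"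

text \<open>Periodization of f with respect to the rotated lattice: the (absolutely convergent,
a.e.) sum over the lattice; infsum is the unconditional = absolute sum.\<close>
definition periodization :: "(real^'n \<Rightarrow> complex) \<Rightarrow> real^'n^'n \<Rightarrow> real^'n \<Rightarrow> complex" where
  "periodization f \<rho> x = (\<Sum>\<^sub>\<infinity>\<nu>\<in>int_lattice. f (\<rho> *v (x - \<nu>)))"

end

theory Submission
  imports Defs
begin

text \<open>Replace |f| by a lower semicontinuous majorant g of comparable norms, and put
  A(z) = \<integral> g(y) g(y - z) dy. Unfolding the cube gives
  \<integral> |g_\<rho>|^2 \<le> 2^d \<Sum>_\<kappa> A(\<rho> \<kappa>), and averaging over \<rho> makes each term depend on
  |\<kappa>|^2 = n only. For d \<ge> 5 the number of lattice points with |\<kappa>|^2 = n is O(n^(d/2 - 1)) (circle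
  method: Weyl differencing bounds the quadratic exponential sum by the number of points of a planar
  unimodular lattice in a box), which is the order of the volume of the annulus
  n \<le> |z|^2 < n + \<delta> divided by \<delta>. Since A is lower semicontinuous, the sum is therefore at most
  A(0) plus a multiple of \<integral>\<integral> g(x) g(y) D(|x - y|^2) dx dy, where D is a nonnegative approximation
  to the Dirac comb on the integers. For a Fejer kernel D the constant term contributes \<open>(\<integral> g)^2\<close>,
  while for k \<noteq> 0 convolution with exp(2 \<pi> i k |x|^2) has norm (2 |k|)^(-d/2) on L^2, which is
  summable in k.\<close>

text \<open>The main obstacle is that the lattice samples the rotational average of A only on the
  spheres |z|^2 = n, a null set, whereas integral estimates control almost every value. Lower
  semicontinuity supplies the one-sided comparison that is needed: the value at a lattice point is
  at most the supremum, over shrinking annuli, of the infimum on the annulus, and an infimum times a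
  volume is at most an integral. This is why f is first replaced by a majorant, which has to be
  comparable to |f| in norm but not close to it.

  The count of representations by d squares must carry no logarithm or divisor factor. Five factors
  of the exponential sum are used for that, through its fifth moment; the other d - 5 are bounded
  trivially.

  Since everything is nonnegative, sharp quantities are repeatedly exchanged for majorants: the
  window around an integer for a multiple of the Fejer kernel, the tiling by cubes for the overlap
  bound 2^d, the one fraction a/q close to a point for the sum over all fractions.\<close>

section \<open>Lattice points on spheres\<close>

text \<open>A piecewise linear weight: its second differences are summable with total mass of order 1/N,
  which avoids the logarithm that a sharp cutoff would cost in Weyl differencing.\<close>
definition tri :: "nat \<Rightarrow> int \<Rightarrow> real" where
  "tri N m = max 0 (2 - \<bar>real_of_int m\<bar> / real N)"

lemma tri_nonneg: "0 \<le> tri N m" by (simp add: tri_def)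

lemma tri_le: "tri N m \<le> 2" by (simp add: tri_def)

lemma tri_ge: "\<bar>m\<bar> \<le> int N \<Longrightarrow> 1 \<le> tri N m"
  by (cases "N = 0") (auto simp: tri_def le_max_iff_disj field_simps)

lemma tri_eq_0: "N > 0 \<Longrightarrow> \<bar>m\<bar> \<ge> 2 * int N \<Longrightarrow> tri N m = 0"
  by (auto simp: tri_def field_simps)

lemma tri_diff: "\<bar>tri N (m + 1) - tri N m\<bar> \<le> 1 / real N"
proof -
  have "\<bar>\<bar>real_of_int (m+1)\<bar> / real N - \<bar>real_of_int m\<bar> / real N\<bar> \<le> 1 / real N"
    by (simp flip: diff_divide_distrib) (rule divide_right_mono, auto)
  then show ?thesis unfolding tri_def by linarith
qed

lemma tri_diff2_eq:
  assumes "N > 0" "m \<noteq> 0" "\<bar>m\<bar> \<noteq> 2 * int N"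
  shows "tri N (m + 1) - 2 * tri N m + tri N (m - 1) = 0"
proof -
  consider "\<bar>m\<bar> < 2 * int N" | "\<bar>m\<bar> > 2 * int N" using assms by linarith
  then show ?thesis
  proof cases
    case 1
    have *: "tri N k = 2 - \<bar>real_of_int k\<bar> / real N" if "\<bar>k\<bar> \<le> 2 * int N" for k
      using that assms by (auto simp: tri_def field_simps)
    have "tri N (m + 1) = 2 - \<bar>real_of_int (m + 1)\<bar> / real N" "tri N (m - 1) = 2 - \<bar>real_of_int (m - 1)\<bar> / real N"
      "tri N m = 2 - \<bar>real_of_int m\<bar> / real N"
      by (intro *; use 1 in linarith)+
    moreover have "\<bar>real_of_int (m + 1)\<bar> - 2 * \<bar>real_of_int m\<bar> + \<bar>real_of_int (m - 1)\<bar> = 0"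
      using assms by auto
    then have "(\<bar>real_of_int (m + 1)\<bar> - 2 * \<bar>real_of_int m\<bar> + \<bar>real_of_int (m - 1)\<bar>) / real N = 0"
      by simp
    ultimately show ?thesis by (simp add: diff_divide_distrib add_divide_distrib)
  next
    case 2
    then show ?thesis using assms by (simp add: tri_eq_0)
  qed
qed

text \<open>The second difference of a piecewise linear function lives at its kinks, here 0 and plus
  or minus 2N, and each kink contributes at most 2/N. The shift \<open>h\<close> only moves the
  kinks, so the bound is uniform in \<open>h\<close>.\<close>

lemma sum_tri_diff2:
  assumes "N > 0"
  shows "(\<Sum>m\<in>{-4*int N-1..4*int N+1}. \<bar>tri N (m + 1 + h) - 2 * tri N (m + h) + tri N (m - 1 + h)\<bar>) \<le> 6 / real N"
proof -
  let ?S = "{-h, 2 * int N - h, -2 * int N - h}"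
  let ?D = "\<lambda>m. \<bar>tri N (m + 1 + h) - 2 * tri N (m + h) + tri N (m - 1 + h)\<bar>"
  have D: "?D m \<le> 2 / real N" for m
    using tri_diff[of N "m + h"] tri_diff[of N "m - 1 + h"] by (simp add: algebra_simps)
  have "sum ?D {-4*int N-1..4*int N+1} = sum ?D ({-4*int N-1..4*int N+1} \<inter> ?S)"
  proof (rule sum.mono_neutral_right)
    show "\<forall>m\<in>{-4*int N-1..4*int N+1} - ({-4*int N-1..4*int N+1} \<inter> ?S). ?D m = 0"
    proof
      fix m assume "m \<in> {-4*int N-1..4*int N+1} - ({-4*int N-1..4*int N+1} \<inter> ?S)"
      then have "m + h \<noteq> 0" "\<bar>m + h\<bar> \<noteq> 2 * int N" by auto
      from tri_diff2_eq[OF assms this] show "?D m = 0" by (simp add: algebra_simps)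
    qed
  qed auto
  also have "\<dots> \<le> real (card ({-4*int N-1..4*int N+1} \<inter> ?S)) * (2 / real N)"
    by (rule sum_bounded_above) (rule D)
  also have "card ({-4*int N-1..4*int N+1} \<inter> ?S) \<le> card ?S" by (rule card_mono) auto
  also have "card ?S \<le> 3" by (simp add: card_insert_if)
  finally show ?thesis using assms by (simp add: field_simps mult_right_mono)
qed

text \<open>Discrete Leibniz rule: the second difference of a product consists of second differences
  times values (mass O(1/N), values at most 2) and of two products of first differences, each of
  size 1/N^2 on a window of O(N) points.\<close>

lemma sum_diff2_tri_product:
  assumes "N > 0"
  shows "(\<Sum>m\<in>{-4*int N-1..4*int N+1}. \<bar>tri N (m + 1) * tri N (m + 1 + h) - 2 * (tri N m * tri N (m + h))
     + tri N (m - 1) * tri N (m - 1 + h)\<bar>) \<le> 60 / real N"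
proof -
  let ?I = "{-4*int N-1..4*int N+1}"
  let ?f = "tri N" and ?g = "\<lambda>m. tri N (m + h)"
  have "\<bar>?f (m+1) * ?g (m+1) - 2 * (?f m * ?g m) + ?f (m-1) * ?g (m-1)\<bar>
    \<le> 2 * \<bar>?f (m+1) - 2 * ?f m + ?f (m-1)\<bar> + 2 * \<bar>?g (m+1) - 2 * ?g m + ?g (m-1)\<bar> + 2 * (1 / real N * (1 / real N))" for m
  proof -
    have "?f (m+1) * ?g (m+1) - 2 * (?f m * ?g m) + ?f (m-1) * ?g (m-1)
      = (?f (m+1) - 2 * ?f m + ?f (m-1)) * ?g m + (?g (m+1) - 2 * ?g m + ?g (m-1)) * ?f m
       + (?f (m+1) - ?f m) * (?g (m+1) - ?g m) + (?f m - ?f (m-1)) * (?g m - ?g (m-1))"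
      by (simp add: algebra_simps)
    moreover have "\<bar>(?f (m+1) - 2 * ?f m + ?f (m-1)) * ?g m\<bar> \<le> \<bar>?f (m+1) - 2 * ?f m + ?f (m-1)\<bar> * 2"
      unfolding abs_mult by (intro mult_left_mono) (auto simp: tri_nonneg tri_le)
    moreover have "\<bar>(?g (m+1) - 2 * ?g m + ?g (m-1)) * ?f m\<bar> \<le> \<bar>?g (m+1) - 2 * ?g m + ?g (m-1)\<bar> * 2"
      unfolding abs_mult by (intro mult_left_mono) (auto simp: tri_nonneg tri_le)
    moreover have "\<bar>(?f (m+1) - ?f m) * (?g (m+1) - ?g m)\<bar> \<le> 1 / real N * (1 / real N)"
      unfolding abs_mult using tri_diff[of N m] tri_diff[of N "m+h"]
      by (intro mult_mono) (auto simp: algebra_simps)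
    moreover have "\<bar>(?f m - ?f (m-1)) * (?g m - ?g (m-1))\<bar> \<le> 1 / real N * (1 / real N)"
      unfolding abs_mult using tri_diff[of N "m-1"] tri_diff[of N "m-1+h"]
      by (intro mult_mono) (auto simp: algebra_simps)
    ultimately show ?thesis by linarith
  qed
  then have "(\<Sum>m\<in>?I. \<bar>?f (m+1) * ?g (m+1) - 2 * (?f m * ?g m) + ?f (m-1) * ?g (m-1)\<bar>)
    \<le> (\<Sum>m\<in>?I. 2 * \<bar>?f (m+1) - 2 * ?f m + ?f (m-1)\<bar> + 2 * \<bar>?g (m+1) - 2 * ?g m + ?g (m-1)\<bar> + 2 * (1 / real N * (1 / real N)))"
    by (intro sum_mono)
  also have "\<dots> = 2 * (\<Sum>m\<in>?I. \<bar>?f (m+1) - 2 * ?f m + ?f (m-1)\<bar>) + 2 * (\<Sum>m\<in>?I. \<bar>?g (m+1) - 2 * ?g m + ?g (m-1)\<bar>)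
     + real (8 * N + 3) * (2 * (1 / real N * (1 / real N)))"
    by (simp add: sum.distrib sum_distrib_left)
  also have "\<dots> \<le> 2 * (6 / real N) + 2 * (6 / real N) + real (11 * N) * (2 * (1 / real N * (1 / real N)))"
    using sum_tri_diff2[OF assms, of 0] sum_tri_diff2[OF assms, of h] assms
    by (intro add_mono mult_left_mono mult_right_mono) auto
  also have "\<dots> \<le> 60 / real N" using assms by (simp add: field_simps)
  finally show ?thesis .
qed

text \<open>Taylor expansion with cubic error: on this interval x^2 is at most 2.56, so x^3/6 is
  less than x/2.\<close>

lemma sin_lower: "0 \<le> x \<Longrightarrow> x \<le> pi / 2 \<Longrightarrow> x / 2 \<le> sin x"
proof -
  assume x: "0 \<le> x" "x \<le> pi / 2"
  have "\<bar>sin x - (\<Sum>m<3. sin_coeff m * x ^ m)\<bar> \<le> inverse (fact 3) * \<bar>x\<bar> ^ 3"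
    by (rule Maclaurin_sin_bound)
  moreover have "(\<Sum>m<3. sin_coeff m * x ^ m) = x"
    by (simp add: sin_coeff_def eval_nat_numeral lessThan_Suc)
  ultimately have "\<bar>sin x - x\<bar> \<le> x ^ 3 / 6" using x by (simp add: fact_numeral)
  then have "sin x \<ge> x - x ^ 3 / 6" by linarith
  moreover have "x * x \<le> 1.6 * 1.6" using x pi_less_4 pi_approx by (intro mult_mono) auto
  then have "x ^ 3 \<le> 2.56 * x" using x mult_right_mono[of "x * x" "2.56" x] by (simp add: power3_eq_cube)
  ultimately show ?thesis using x by simp
qed

text \<open>On the frequency t a second difference acts as multiplication by -4 sin^2(pi t); this is
  the lower bound for that multiplier by which the twice differenced sum is divided.\<close>

lemma norm_cis_diff2:
  assumes "\<bar>t\<bar> \<le> 1/2"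
  shows "t\<^sup>2 \<le> cmod (cis (2*pi*t) - 2 + cis (- (2*pi*t)))"
proof -
  have "cis (2*pi*t) - 2 + cis (- (2*pi*t)) = complex_of_real (2 * cos (2*pi*t) - 2)"
    by (simp add: complex_eq_iff)
  then have "cmod (cis (2*pi*t) - 2 + cis (- (2*pi*t))) = \<bar>2 * cos (2*pi*t) - 2\<bar>"
    by (simp only: norm_of_real)
  also have "\<dots> = 4 * (sin (pi * \<bar>t\<bar>))\<^sup>2"
    using cos_double_sin[of "pi * \<bar>t\<bar>"] by (cases "t \<ge> 0") (auto simp: algebra_simps)
  finally have *: "cmod (cis (2*pi*t) - 2 + cis (- (2*pi*t))) = 4 * (sin (pi * \<bar>t\<bar>))\<^sup>2" .
  have "pi * \<bar>t\<bar> / 2 \<le> sin (pi * \<bar>t\<bar>)"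
    using assms by (intro sin_lower) auto
  moreover have "\<bar>t\<bar> \<le> pi * \<bar>t\<bar> / 2" using mult_right_mono[OF pi_ge_two abs_ge_zero[of t]] by simp
  ultimately have "\<bar>t\<bar>\<^sup>2 \<le> (sin (pi * \<bar>t\<bar>))\<^sup>2" by (intro power_mono) auto
  moreover have "(sin (pi * \<bar>t\<bar>))\<^sup>2 \<ge> 0" by simp
  ultimately show ?thesis unfolding * power2_abs by linarith
qed

lemma cis_mult_int: "cis (2 * pi * real_of_int m * (real_of_int k + t)) = cis (2 * pi * real_of_int m * t)"
proof -
  have "cis (2 * pi * real_of_int m * (real_of_int k + t)) = cis (2 * pi * real_of_int (m * k)) * cis (2 * pi * real_of_int m * t)"
    by (simp add: cis_mult algebra_simps)
  also have "cis (2 * pi * real_of_int (m * k)) = 1" by (rule cis_multiple_2pi) simp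
  finally show ?thesis by simp
qed

section \<open>Weyl differencing of the quadratic exponential sum\<close>

text \<open>The linear exponential sum that remains after differencing with shift \<open>h\<close>;
  it is evaluated at \<open>b\<close> = 2hx.\<close>

definition corr_sum :: "nat \<Rightarrow> int \<Rightarrow> real \<Rightarrow> complex" where
  "corr_sum N h b = (\<Sum>m\<in>{-2*int N..2*int N}. of_real (tri N m * tri N (m + h)) * cis (2 * pi * real_of_int m * b))"

text \<open>Two summations by parts give 60/(N t^2), which beats the trivial bound once |t| exceeds
  1/N. The resulting kernel N/(1 + (Nt)^2) is summable over frequencies spaced by 1/N.\<close>

lemma corr_sum_bound:
  assumes N: "N > 0" and t: "\<bar>t\<bar> \<le> 1/2"
  shows "cmod (corr_sum N h (of_int k + t)) \<le> 100 * real N / (1 + (real N * t)\<^sup>2)"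
proof -
  let ?F = "\<lambda>m. tri N m * tri N (m + h)"
  let ?c = "\<lambda>m. cis (2 * pi * real_of_int m * t)"
  let ?I = "{-4*int N-1..4*int N+1}"
  define V where "V = (\<Sum>m\<in>{-2*int N..2*int N}. of_real (?F m) * ?c m)"
  have V: "corr_sum N h (of_int k + t) = V" by (simp add: corr_sum_def V_def cis_mult_int)
  have F0: "?F m = 0" if "\<bar>m\<bar> \<ge> 2 * int N" for m using tri_eq_0[OF N that] by simp
  have Vext: "V = (\<Sum>m\<in>A. of_real (?F m) * ?c m)" if "finite A" "{-2*int N..2*int N} \<subseteq> A" for A
    unfolding V_def
  proof (rule sum.mono_neutral_left[OF that], safe)
    fix m assume "m \<notin> {-2*int N..2*int N}"
    then have "?F m = 0" by (intro F0) auto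
    then show "of_real (?F m) * ?c m = 0" by (simp only: of_real_0 mult_zero_left)
  qed
  \<comment> \<open>A shift of the weight multiplies the sum by a unit phase. The window
    \<open>?I\<close> is larger than the support by more than the shift, so no boundary terms
    appear.\<close>
  have sh: "(\<Sum>m\<in>?I. of_real (?F (m + s)) * ?c m) = cis (- (2 * pi * s * t)) * V" if "s \<in> {-1, 1}" for s :: int
  proof -
    have "(\<Sum>m\<in>?I. of_real (?F (m + s)) * ?c m) = (\<Sum>m\<in>(\<lambda>m. m + s) ` ?I. of_real (?F m) * ?c (m - s))"
      by (subst sum.reindex) (auto simp: inj_on_def)
    also have "\<dots> = (\<Sum>m\<in>(\<lambda>m. m + s) ` ?I. cis (- (2 * pi * s * t)) * (of_real (?F m) * ?c m))"
    proof (intro sum.cong refl)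
      fix m :: int
      have "?c (m - s) = cis (- (2 * pi * s * t)) * ?c m" by (simp add: cis_mult algebra_simps)
      then show "of_real (?F m) * ?c (m - s) = cis (- (2 * pi * s * t)) * (of_real (?F m) * ?c m)" by simp
    qed
    also have "\<dots> = cis (- (2 * pi * s * t)) * V"
      using that N by (subst Vext[of "(\<lambda>m. m + s) ` ?I"]) (auto simp: sum_distrib_left)
    finally show ?thesis .
  qed
  have "(\<Sum>m\<in>?I. of_real (?F (m+1) - 2 * ?F m + ?F (m-1)) * ?c m) =
     (\<Sum>m\<in>?I. of_real (?F (m+1)) * ?c m) - 2 * (\<Sum>m\<in>?I. of_real (?F m) * ?c m) + (\<Sum>m\<in>?I. of_real (?F (m-1)) * ?c m)"
    by (simp add: sum_distrib_left sum.distrib sum_subtractf algebra_simps)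
  also have "\<dots> = (cis (2*pi*t) - 2 + cis (- (2*pi*t))) * V"
    using sh[of 1] sh[of "-1"] Vext[of ?I] by (simp add: algebra_simps)
  finally have eq: "(\<Sum>m\<in>?I. of_real (?F (m+1) - 2 * ?F m + ?F (m-1)) * ?c m) = (cis (2*pi*t) - 2 + cis (- (2*pi*t))) * V" .
  have "t\<^sup>2 * cmod V \<le> cmod (cis (2*pi*t) - 2 + cis (- (2*pi*t))) * cmod V"
    by (intro mult_right_mono norm_cis_diff2 t) auto
  also have "\<dots> = cmod (\<Sum>m\<in>?I. of_real (?F (m+1) - 2 * ?F m + ?F (m-1)) * ?c m)"
    unfolding eq by (simp add: norm_mult)
  also have "\<dots> \<le> (\<Sum>m\<in>?I. \<bar>?F (m+1) - 2 * ?F m + ?F (m-1)\<bar>)"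
    by (intro order_trans[OF norm_sum] sum_mono) (simp only: norm_mult norm_cis norm_of_real mult_1_right)
  also have "\<dots> \<le> 60 / real N" using sum_diff2_tri_product[OF N, of h] by simp
  finally have 1: "(real N * t)\<^sup>2 * cmod V \<le> 60 * real N"
    using N by (simp add: field_simps power2_eq_square)
  have "cmod V \<le> (\<Sum>m\<in>{-2*int N..2*int N}. 4)"
    unfolding V_def
  proof (intro order_trans[OF norm_sum] sum_mono)
    fix m
    have "tri N m * tri N (m + h) \<le> 2 * 2" by (intro mult_mono) (auto simp: tri_le tri_nonneg)
    moreover have "0 \<le> tri N m * tri N (m + h)" by (simp add: tri_nonneg)
    ultimately show "cmod (of_real (?F m) * ?c m) \<le> 4" by (simp add: norm_mult abs_mult tri_nonneg)
  qed
  also have "\<dots> \<le> 40 * real N" using N by simp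
  finally have 2: "cmod V \<le> 40 * real N" .
  \<comment> \<open>Adding the trivial bound 40N and the differenced bound 60N treats all t at
    once.\<close>
  have "cmod V * (1 + (real N * t)\<^sup>2) \<le> 100 * real N" using 1 2 by (simp add: algebra_simps)
  moreover have "1 + (real N * t)\<^sup>2 > 0" by (rule add_pos_nonneg) auto
  ultimately show ?thesis unfolding V by (simp add: pos_le_divide_eq)
qed

definition weyl_sum :: "nat \<Rightarrow> real \<Rightarrow> complex" where
  "weyl_sum N x = (\<Sum>m\<in>{-2*int N..2*int N}. of_real (tri N m) * cis (2 * pi * (real_of_int m)\<^sup>2 * x))"

lemma weyl_sum_norm_le:
  assumes "N > 0" shows "cmod (weyl_sum N x) \<le> 10 * real N"
proof -
  have "cmod (weyl_sum N x) \<le> (\<Sum>m\<in>{-2*int N..2*int N}. 2)"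
    unfolding weyl_sum_def
    by (intro order_trans[OF norm_sum] sum_mono) (simp add: norm_mult tri_le tri_nonneg)
  also have "\<dots> \<le> 10 * real N" using assms by simp
  finally show ?thesis .
qed

text \<open>Because (m + h)^2 - m^2 = h^2 + 2hm, the phase becomes linear in m after squaring, and
  the factor depending on h^2 alone has modulus one.\<close>

lemma weyl_sum_square:
  assumes N: "N > 0"
  shows "(cmod (weyl_sum N x))\<^sup>2 \<le> (\<Sum>h\<in>{-4*int N..4*int N}. cmod (corr_sum N h (2 * real_of_int h * x)))"
proof -
  let ?I = "{-2*int N..2*int N}" and ?J = "{-4*int N..4*int N}"
  let ?G = "\<lambda>m. of_real (tri N m) * cis (2 * pi * (real_of_int m)\<^sup>2 * x)"
  have G0: "?G m = 0" if "m \<notin> ?I" for m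
    using that N by (subst tri_eq_0) auto
  \<comment> \<open>The full sum may be recentred at any m' of the support, since differences of
    support points lie in \<open>?J\<close> and the weight vanishes outside \<open>?I\<close>. This
    makes the range of h independent of m'.\<close>
  have sh: "(\<Sum>m\<in>?I. ?G m) = (\<Sum>h\<in>?J. ?G (m' + h))" if "m' \<in> ?I" for m'
  proof -
    have "(\<Sum>h\<in>?J. ?G (m' + h)) = (\<Sum>m\<in>(\<lambda>h. m' + h) ` ?J. ?G m)"
      by (subst sum.reindex) (auto simp: inj_on_def)
    also have "\<dots> = (\<Sum>m\<in>?I. ?G m)"
    proof (rule sum.mono_neutral_right)
      show "?I \<subseteq> (\<lambda>h. m' + h) ` ?J"
        using that by (auto simp: image_add_atLeastAtMost)
      show "\<forall>i\<in>(\<lambda>h. m' + h) ` ?J - ?I. ?G i = 0" using G0 by blast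
    qed auto
    finally show ?thesis by simp
  qed
  have "of_real ((cmod (weyl_sum N x))\<^sup>2) = (\<Sum>m\<in>?I. ?G m) * (\<Sum>m'\<in>?I. cnj (?G m'))"
    by (simp only: weyl_sum_def complex_norm_square cnj_sum)
  also have "\<dots> = (\<Sum>m'\<in>?I. \<Sum>h\<in>?J. ?G (m' + h) * cnj (?G m'))"
    by (simp only: sum_distrib_left) (intro sum.cong refl, simp only: sh sum_distrib_right)
  also have "\<dots> = (\<Sum>h\<in>?J. \<Sum>m'\<in>?I. ?G (m' + h) * cnj (?G m'))" by (rule sum.swap)
  also have "\<dots> = (\<Sum>h\<in>?J. cis (2 * pi * (real_of_int h)\<^sup>2 * x) * corr_sum N h (2 * real_of_int h * x))"
    unfolding corr_sum_def sum_distrib_left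
  proof (intro sum.cong refl)
    fix h m' :: int
    let ?a = "cis (2 * pi * (real_of_int (m' + h))\<^sup>2 * x)" and ?b = "cis (2 * pi * (real_of_int m')\<^sup>2 * x)"
    have "?a * cnj ?b = cis (2 * pi * (real_of_int h)\<^sup>2 * x) * cis (2 * pi * real_of_int m' * (2 * real_of_int h * x))"
      by (simp add: cis_cnj cis_mult) (simp add: algebra_simps power2_eq_square)
    then have "of_real (tri N m' * tri N (m' + h)) * (?a * cnj ?b) =
      cis (2 * pi * (real_of_int h)\<^sup>2 * x) * (of_real (tri N m' * tri N (m' + h)) * cis (2 * pi * real_of_int m' * (2 * real_of_int h * x)))"
      by (simp only: mult_ac)
    then show "?G (m' + h) * cnj (?G m') =
      cis (2 * pi * (real_of_int h)\<^sup>2 * x) * (of_real (tri N m' * tri N (m' + h)) * cis (2 * pi * real_of_int m' * (2 * real_of_int h * x)))"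
      by (simp add: mult_ac)
  qed
  finally have eq: "of_real ((cmod (weyl_sum N x))\<^sup>2) = (\<Sum>h\<in>?J. cis (2 * pi * (real_of_int h)\<^sup>2 * x) * corr_sum N h (2 * real_of_int h * x))" .
  have "(cmod (weyl_sum N x))\<^sup>2 = cmod (of_real ((cmod (weyl_sum N x))\<^sup>2))"
    by (simp only: norm_of_real abs_of_nonneg zero_le_power2)
  also have "\<dots> \<le> (\<Sum>h\<in>?J. cmod (corr_sum N h (2 * real_of_int h * x)))"
    unfolding eq by (intro order_trans[OF norm_sum] sum_mono) (simp add: norm_mult)
  finally show ?thesis .
qed

text \<open>Telescoping: 1/(1 + (K+1)^2) is at most 1/(K + 1/2) - 1/(K + 3/2). The subtracted term
  makes the induction close, with equality at K = 0.\<close>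

lemma sum_inverse_square_plus_one:
  "(\<Sum>j\<in>{-int K..int K}. 1 / (1 + (real_of_int j)\<^sup>2)) \<le> 5 - 2 / (real K + 1/2)"
proof (induction K)
  case (Suc K)
  have "{-int (Suc K)..int (Suc K)} = insert (int (Suc K)) (insert (- int (Suc K)) {-int K..int K})" by auto
  then have "(\<Sum>j\<in>{-int (Suc K)..int (Suc K)}. 1 / (1 + (real_of_int j)\<^sup>2)) =
    2 / (1 + (real K + 1)\<^sup>2) + (\<Sum>j\<in>{-int K..int K}. 1 / (1 + (real_of_int j)\<^sup>2))"
    by (simp add: algebra_simps power2_eq_square)
  also have "2 / (1 + (real K + 1)\<^sup>2) \<le> 2 / ((real K + 1/2) * (real K + 3/2))"
    by (intro divide_left_mono) (auto simp: power2_eq_square algebra_simps add_pos_nonneg)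
  also have "2 / ((real K + 1/2) * (real K + 3/2)) = 2 / (real K + 1/2) - 2 / (real (Suc K) + 1/2)"
    by (simp add: divide_simps)
  finally show ?case using Suc by simp
qed simp

lemma sum_inverse_square_plus_one_le: "(\<Sum>j\<in>{-int K..int K}. 1 / (1 + (real_of_int j)\<^sup>2)) \<le> 5"
  by (rule order_trans[OF sum_inverse_square_plus_one]) simp

section \<open>Points of a planar unimodular lattice in a box\<close>

text \<open>Points of the unimodular lattice generated by (1, y) and (0, -1) that lie in a box of bounded
  area, recorded by their integer coordinates.\<close>
definition near :: "nat \<Rightarrow> real \<Rightarrow> (int \<times> int) set" where
  "near N y = {(u, k). \<bar>u\<bar> \<le> 8 * int N \<and> \<bar>of_int u * y - of_int k\<bar> \<le> 1 / real N}"

lemma finite_near: "finite (near N y)"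
proof (rule finite_subset)
  let ?K = "\<lceil>8 * real N * \<bar>y\<bar> + 1 / real N\<rceil>"
  show "near N y \<subseteq> {-8 * int N..8 * int N} \<times> {-?K..?K}"
  proof (safe, unfold near_def, safe)
    fix u k :: int assume u: "\<bar>u\<bar> \<le> 8 * int N" and k: "\<bar>of_int u * y - of_int k\<bar> \<le> 1 / real N"
    have "\<bar>of_int u * y\<bar> \<le> (8 * real N) * \<bar>y\<bar>" unfolding abs_mult using u
      by (intro mult_right_mono) auto
    then have "\<bar>real_of_int k\<bar> \<le> 8 * real N * \<bar>y\<bar> + 1 / real N" using k by linarith
    then have "\<bar>k\<bar> \<le> ?K" by linarith
    then show "k \<in> {-?K..?K}" by auto
  qed auto
qed auto

text \<open>The shifts h are grouped by the cell of width 1/N that contains the signed distance from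
  2hx to the nearest integer. The kernel bound is summable over the cells, and each cell has at most
  \<open>card (near N (2 * x))\<close> members.\<close>

lemma weyl_sum_square_le_near:
  assumes N: "N > 0"
  shows "(cmod (weyl_sum N x))\<^sup>2 \<le> 1500 * real N * real (card (near N (2 * x)))"
proof -
  let ?J = "{-4*int N..4*int N}"
  define k where "k h = round (2 * real_of_int h * x)" for h
  define t where "t h = 2 * real_of_int h * x - of_int (k h)" for h
  define j where "j h = \<lfloor>real N * t h\<rfloor>" for h
  have t: "\<bar>t h\<bar> \<le> 1/2" for h
    using of_int_round_abs_le[of "2 * real_of_int h * x"] by (simp add: t_def k_def abs_minus_commute)
  have jr: "j h \<in> {-int N..int N}" for h
  proof -
    have "\<bar>real N * t h\<bar> \<le> real N * 1" unfolding abs_mult using t[of h] by (intro mult_mono) auto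
    then show ?thesis unfolding j_def by (auto simp: le_floor_iff floor_le_iff)
  qed
  \<comment> \<open>Rounding Nt down to the cell index j gives 1 + j^2 at most 3 (1 + (Nt)^2), which
    turns 100 into 300.\<close>
  have step: "cmod (corr_sum N h (2 * real_of_int h * x)) \<le> 300 * real N * (1 / (1 + (real_of_int (j h))\<^sup>2))" for h
  proof -
    have "\<bar>real_of_int (j h)\<bar> \<le> \<bar>real N * t h\<bar> + 1" unfolding j_def by linarith
    then have "\<bar>real_of_int (j h)\<bar>\<^sup>2 \<le> (\<bar>real N * t h\<bar> + 1)\<^sup>2" by (intro power_mono) auto
    also have "\<dots> \<le> 2 * (real N * t h)\<^sup>2 + 2"
      using zero_le_power2[of "\<bar>real N * t h\<bar> - 1"] by (simp add: power2_eq_square algebra_simps)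
    finally have *: "1 + (real_of_int (j h))\<^sup>2 \<le> 3 * (1 + (real N * t h)\<^sup>2)" by (simp del: power_mult_distrib)
      (smt (verit) zero_le_power2)
    have "cmod (corr_sum N h (2 * real_of_int h * x)) \<le> 100 * real N / (1 + (real N * t h)\<^sup>2)"
      using corr_sum_bound[OF N t[of h], of h "k h"] by (simp add: t_def)
    also have "\<dots> = 300 * real N / (3 * (1 + (real N * t h)\<^sup>2))" by (simp add: divide_simps)
    also have "\<dots> \<le> 300 * real N / (1 + (real_of_int (j h))\<^sup>2)"
      by (intro divide_left_mono *) (auto intro!: mult_pos_pos add_pos_nonneg)
    finally show ?thesis by simp
  qed
  \<comment> \<open>Subtracting one fixed member injects a cell into \<open>near\<close>. Shifts of
    size up to 4N differ by at most 8N, which is the origin of the 8 in the definition of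
    \<open>near\<close>.\<close>
  have cnt: "card {h \<in> ?J. j h = i} \<le> card (near N (2 * x))" for i
  proof (cases "{h \<in> ?J. j h = i} = {}")
    case False
    then obtain h0 where h0: "h0 \<in> ?J" "j h0 = i" by blast
    show ?thesis
    proof (rule card_inj_on_le[where f = "\<lambda>h. (h - h0, k h - k h0)"])
      show "inj_on (\<lambda>h. (h - h0, k h - k h0)) {h \<in> ?J. j h = i}" by (auto simp: inj_on_def)
      show "(\<lambda>h. (h - h0, k h - k h0)) ` {h \<in> ?J. j h = i} \<subseteq> near N (2 * x)"
      proof safe
        fix h assume h: "h \<in> ?J" "i = j h"
        then have "\<lfloor>real N * t h\<rfloor> = \<lfloor>real N * t h0\<rfloor>" using h0 by (simp add: j_def)
        then have "\<bar>real N * t h - real N * t h0\<bar> \<le> 1" by linarith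
        then have "real N * \<bar>t h - t h0\<bar> \<le> 1" using N by (simp add: abs_mult flip: right_diff_distrib)
        then have "\<bar>t h - t h0\<bar> \<le> 1 / real N" using N by (simp add: field_simps)
        moreover have "of_int (h - h0) * (2 * x) - of_int (k h - k h0) = t h - t h0"
          by (simp add: t_def algebra_simps)
        moreover have "\<bar>h - h0\<bar> \<le> 8 * int N" using h h0 by auto
        ultimately show "(h - h0, k h - k h0) \<in> near N (2 * x)" by (simp only: near_def mem_Collect_eq split)
      qed
    qed (rule finite_near)
  qed (metis card.empty le0)
  have "(cmod (weyl_sum N x))\<^sup>2 \<le> (\<Sum>h\<in>?J. 300 * real N * (1 / (1 + (real_of_int (j h))\<^sup>2)))"
    by (rule order_trans[OF weyl_sum_square[OF N]]) (intro sum_mono step)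
  also have "\<dots> = 300 * real N * (\<Sum>h\<in>?J. 1 / (1 + (real_of_int (j h))\<^sup>2))"
    by (simp add: sum_distrib_left)
  also have "(\<Sum>h\<in>?J. 1 / (1 + (real_of_int (j h))\<^sup>2)) =
     (\<Sum>i\<in>{-int N..int N}. \<Sum>h\<in>{h\<in>?J. j h = i}. 1 / (1 + (real_of_int (j h))\<^sup>2))"
    by (rule sum.group[symmetric]) (use jr in auto)
  also have "\<dots> = (\<Sum>i\<in>{-int N..int N}. real (card {h\<in>?J. j h = i}) * (1 / (1 + (real_of_int i)\<^sup>2)))"
    by (intro sum.cong refl) simp
  also have "\<dots> \<le> (\<Sum>i\<in>{-int N..int N}. real (card (near N (2 * x))) * (1 / (1 + (real_of_int i)\<^sup>2)))"
    using cnt by (intro sum_mono mult_right_mono) auto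
  also have "\<dots> = real (card (near N (2 * x))) * (\<Sum>i\<in>{-int N..int N}. 1 / (1 + (real_of_int i)\<^sup>2))"
    by (simp add: sum_distrib_left)
  also have "\<dots> \<le> real (card (near N (2 * x))) * 5"
    by (intro mult_left_mono sum_inverse_square_plus_one_le) simp
  finally show ?thesis by (simp add: mult_left_mono)
qed

text \<open>More than one point means a nonzero one. Its first coordinate cannot vanish, because 1/N
  < 1 leaves no nonzero integer for the second; dividing by the gcd and normalizing the sign then
  gives a reduced fraction close to y.\<close>

lemma near_obtain_primitive:
  assumes N: "N \<ge> 2" and c: "card (near N y) > 1"
  obtains q a :: int where "1 \<le> q" "q \<le> 8 * int N" "\<bar>of_int q * y - of_int a\<bar> \<le> 1 / real N" "coprime q a"
proof -
  have "\<not> near N y \<subseteq> {(0,0)}" using c card_mono[of "{(0::int,0::int)}" "near N y"] by auto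
  then obtain u k where uk: "(u, k) \<in> near N y" "(u, k) \<noteq> (0, 0)" by auto
  have u0: "u \<noteq> 0"
  proof
    assume "u = 0"
    then have "\<bar>real_of_int k\<bar> \<le> 1 / real N" using uk by (simp add: near_def)
    also have "\<dots> < 1" using N by simp
    finally have "k = 0" by linarith
    then show False using \<open>u = 0\<close> uk by simp
  qed
  define g where "g = gcd u k"
  define s where "s = sgn u"
  define q where "q = s * (u div g)"
  define a where "a = s * (k div g)"
  have g: "g > 0" using u0 by (simp add: g_def)
  have s: "s = 1 \<or> s = -1" using u0 by (auto simp: s_def sgn_if)
  have u: "u = g * (u div g)" and k: "k = g * (k div g)" by (simp_all add: g_def)
  have cop: "coprime (u div g) (k div g)" using u0 by (simp add: g_def div_gcd_coprime)
  have qs: "q * g = \<bar>u\<bar>" unfolding q_def s_def using u by (metis abs_sgn mult.assoc mult.commute)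
  then have q0: "q > 0" using g u0 by (metis zero_less_abs_iff zero_less_mult_pos2)
  have "q \<le> q * g" using g q0 by simp
  then have q1: "q \<le> 8 * int N" using qs uk by (simp add: near_def)
  have "of_int g * (of_int q * y - of_int a) = of_int s * (of_int (g * (u div g)) * y - of_int (g * (k div g)))"
    by (simp add: q_def a_def algebra_simps)
  also have "\<dots> = of_int s * (of_int u * y - of_int k)" by (simp flip: u k)
  finally have "of_int g * \<bar>of_int q * y - of_int a\<bar> = \<bar>of_int u * y - of_int k\<bar>"
  proof -
    assume "of_int g * (of_int q * y - of_int a) = of_int s * (of_int u * y - of_int k)"
    then have "\<bar>of_int g * (of_int q * y - of_int a)\<bar> = \<bar>of_int s * (of_int u * y - of_int k)\<bar>" by (rule arg_cong)
    then show ?thesis using g s by (auto simp: abs_mult)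
  qed
  also have "\<dots> \<le> 1 / real N" using uk by (simp add: near_def)
  finally have "of_int g * \<bar>of_int q * y - of_int a\<bar> \<le> 1 / real N" .
  moreover have "1 * \<bar>of_int q * y - of_int a\<bar> \<le> of_int g * \<bar>of_int q * y - of_int a\<bar>"
    using g by (intro mult_right_mono) auto
  ultimately have "\<bar>of_int q * y - of_int a\<bar> \<le> 1 / real N" by (metis mult_1 order_trans)
  moreover have "coprime q a" using s cop by (auto simp: q_def a_def)
  moreover have "1 \<le> q" using q0 by simp
  ultimately show ?thesis using q1 that by blast
qed

text \<open>All points of the box lie on at most 33 lines parallel to a primitive vector (q, a).\<close>
lemma card_near_le:
  assumes N: "N > 0" and q: "1 \<le> q" "q \<le> 8 * int N" and a: "\<bar>of_int q * y - of_int a\<bar> \<le> 1 / real N"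
    and cop: "coprime q a"
    and X: "\<And>j::int. of_int (\<bar>j\<bar> * q) \<le> 16 * real N \<Longrightarrow> of_int \<bar>j\<bar> * \<bar>of_int q * y - of_int a\<bar> \<le> 2 / real N \<Longrightarrow> of_int \<bar>j\<bar> \<le> X"
  shows "real (card (near N y)) \<le> 33 * (2 * X + 1)"
proof -
  define L where "L D = {v \<in> near N y. q * snd v - fst v * a = D}" for D
  have X0: "0 \<le> X" using X[of 0] by simp
  \<comment> \<open>The determinant qk - ua equals q(k - uy) + u(qy - a). Each term is at most 8N
    times 1/N, so the determinant is one of the 33 integers from -16 to 16.\<close>
  have sub: "near N y \<subseteq> (\<Union>D\<in>{-16..16}. L D)"
  proof
    fix v assume v: "v \<in> near N y"
    obtain u k where uk: "v = (u, k)" by (cases v)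
    define A where "A = of_int q * (of_int k - of_int u * y)"
    define B where "B = of_int u * (of_int q * y - of_int a)"
    have uk': "\<bar>u\<bar> \<le> 8 * int N" "\<bar>of_int u * y - of_int k\<bar> \<le> 1 / real N" using v uk by (auto simp: near_def)
    have "\<bar>A\<bar> \<le> (8 * real N) * (1 / real N)"
      unfolding A_def abs_mult using q uk' by (intro mult_mono) (auto simp: abs_minus_commute)
    moreover have "\<bar>B\<bar> \<le> (8 * real N) * (1 / real N)"
      unfolding B_def abs_mult using a uk' by (intro mult_mono) auto
    moreover have "real_of_int (q * k - u * a) = A + B" by (simp add: A_def B_def algebra_simps)
    ultimately have "\<bar>real_of_int (q * k - u * a)\<bar> \<le> 16" using N by simp
    then have "\<bar>q * k - u * a\<bar> \<le> 16" by linarith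
    then have "q * k - u * a \<in> {-16..16}" by (simp add: abs_le_iff)
    then show "v \<in> (\<Union>D\<in>{-16..16}. L D)" using v uk by (auto simp: L_def)
  qed
  have card_L: "real (card (L D)) \<le> 2 * X + 1" for D
  proof (cases "L D = {}")
    case False
    then obtain u0 k0 where v0: "(u0, k0) \<in> L D" by auto
    have "card (L D) \<le> card {-\<lfloor>X\<rfloor>..\<lfloor>X\<rfloor>}"
    proof (rule card_inj_on_le[where f = "\<lambda>v. (fst v - u0) div q"])
      \<comment> \<open>Two points with the same determinant differ by an integer multiple of (q,
        a), by coprimality.\<close>
      have *: "q * ((u - u0) div q) = u - u0 \<and> a * ((u - u0) div q) = k - k0" if "(u, k) \<in> L D" for u k
      proof -
        have e: "q * (k - k0) = (u - u0) * a" using that v0 by (auto simp: L_def algebra_simps)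
        then have "q dvd (u - u0) * a" by (metis dvd_triv_left)
        then have d: "q dvd u - u0" using cop by (simp add: coprime_dvd_mult_left_iff)
        then have 1: "q * ((u - u0) div q) = u - u0" by simp
        have "q * (a * ((u - u0) div q)) = q * (k - k0)" using 1 e by (metis mult.commute mult.left_commute)
        then show ?thesis using 1 q by simp
      qed
      show "inj_on (\<lambda>v. (fst v - u0) div q) (L D)"
      proof (rule inj_onI)
        fix v w assume v: "v \<in> L D" and w: "w \<in> L D" and e: "(fst v - u0) div q = (fst w - u0) div q"
        have "fst v - u0 = fst w - u0 \<and> snd v - k0 = snd w - k0"
          using *[of "fst v" "snd v"] *[of "fst w" "snd w"] v w unfolding e prod.collapse by metis
        then show "v = w" by (simp add: prod_eq_iff)
      qed
      show "(\<lambda>v. (fst v - u0) div q) ` L D \<subseteq> {-\<lfloor>X\<rfloor>..\<lfloor>X\<rfloor>}"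
      proof safe
        fix u k assume v: "(u, k) \<in> L D"
        define j where "j = (u - u0) div q"
        have j: "q * j = u - u0" "a * j = k - k0" using *[OF v] by (auto simp: j_def)
        have near: "\<bar>u\<bar> \<le> 8 * int N" "\<bar>u0\<bar> \<le> 8 * int N" "\<bar>of_int u * y - of_int k\<bar> \<le> 1 / real N" "\<bar>of_int u0 * y - of_int k0\<bar> \<le> 1 / real N"
          using v v0 by (auto simp: L_def near_def)
        have "\<bar>j\<bar> * q = \<bar>u - u0\<bar>" using q by (simp add: abs_mult mult.commute flip: j)
        also have "\<dots> \<le> 16 * int N" using near by linarith
        finally have 1: "of_int (\<bar>j\<bar> * q) \<le> 16 * real N" by linarith
        have "of_int j * (of_int q * y - of_int a) = of_int (q * j) * y - of_int (a * j)" by (simp add: algebra_simps)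
        also have "\<dots> = (of_int u * y - of_int k) - (of_int u0 * y - of_int k0)" unfolding j by (simp add: algebra_simps)
        finally have "\<bar>of_int j * (of_int q * y - of_int a)\<bar> \<le> 2 / real N" using near by (simp add: field_simps)
        then have "of_int \<bar>j\<bar> * \<bar>of_int q * y - of_int a\<bar> \<le> 2 / real N" by (simp add: abs_mult)
        then have "of_int \<bar>j\<bar> \<le> X" by (rule X[OF 1])
        then have "\<bar>j\<bar> \<le> \<lfloor>X\<rfloor>" by (simp add: le_floor_iff)
        then show "(fst (u, k) - u0) div q \<in> {-\<lfloor>X\<rfloor>..\<lfloor>X\<rfloor>}" by (auto simp: j_def)
      qed
    qed auto
    also have "\<dots> = nat (2 * \<lfloor>X\<rfloor> + 1)" by simp
    finally show ?thesis using X0 by linarith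
  qed (use X0 in simp)
  have "card (near N y) \<le> card (\<Union>D\<in>{-16..16}. L D)"
    using sub by (intro card_mono) (auto simp: L_def intro: finite_subset[OF _ finite_near[of N y]])
  also have "\<dots> \<le> (\<Sum>D\<in>{-16..16::int}. card (L D))" by (rule card_UN_le) auto
  finally have "real (card (near N y)) \<le> (\<Sum>D\<in>{-16..16::int}. real (card (L D)))" by (simp flip: of_nat_sum)
  also have "\<dots> \<le> (\<Sum>D\<in>{-16..16::int}. 2 * X + 1)" by (intro sum_mono card_L)
  finally show ?thesis by simp
qed

text \<open>A multiple j of (q, a) is limited by the length of the box, |j| at most 16N/q, and by
  its height, |j| at most 2/(N |qy - a|). The two choices of X give the two bounds; together they
  say that the count is O((N/q) / (1 + N^2 |y - a/q|)).\<close>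

lemma card_near_bounds:
  assumes N: "N > 0" and q: "1 \<le> q" "q \<le> 8 * int N" and a: "\<bar>of_int q * y - of_int a\<bar> \<le> 1 / real N"
    and cop: "coprime q a"
  shows "real (card (near N y)) \<le> 1600 * (real N / of_int q)"
    and "real (card (near N y)) * ((real N)\<^sup>2 * \<bar>y - of_int a / of_int q\<bar>) \<le> 1600 * (real N / of_int q)"
proof -
  let ?M = "real (card (near N y))"
  have "?M \<le> 33 * (2 * (16 * real N / of_int q) + 1)"
    by (rule card_near_le[OF assms]) (use q in \<open>simp add: field_simps\<close>)
  moreover have "1 \<le> 8 * (real N / of_int q)" using q by (simp add: field_simps)
  ultimately show "?M \<le> 1600 * (real N / of_int q)" by simp
  define b where "b = \<bar>of_int q * y - of_int a\<bar>"
  have b: "b \<ge> 0" "b \<le> 1 / real N" using a by (simp_all add: b_def)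
  have bq: "\<bar>y - of_int a / of_int q\<bar> = b / of_int q"
  proof -
    have "y - of_int a / of_int q = (of_int q * y - of_int a) / of_int q" using q by (simp add: field_simps)
    then show ?thesis using q by (simp add: b_def abs_divide)
  qed
  have "?M * (real N * b) \<le> 1600"
  proof (cases "b = 0")
    case False
    then have b0: "b > 0" using b by simp
    have "?M \<le> 33 * (2 * (2 / (real N * b)) + 1)"
    proof (rule card_near_le[OF assms])
      fix j :: int assume "of_int \<bar>j\<bar> * \<bar>of_int q * y - of_int a\<bar> \<le> 2 / real N"
      then have "of_int \<bar>j\<bar> * b \<le> 2 / real N" by (simp only: b_def)
      then show "of_int \<bar>j\<bar> \<le> 2 / (real N * b)" using b0 N by (simp add: field_simps)
    qed
    then have "?M * (real N * b) \<le> 33 * (2 * (2 / (real N * b)) + 1) * (real N * b)"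
      using b N by (intro mult_right_mono) auto
    also have "\<dots> = 33 * (4 + real N * b)" using b0 N by (simp add: field_simps)
    also have "\<dots> \<le> 1600" using b N by (simp add: field_simps)
    finally show ?thesis .
  qed simp
  then have "?M * (real N * b) * (real N / of_int q) \<le> 1600 * (real N / of_int q)"
    using q by (intro mult_right_mono) auto
  then show "?M * ((real N)\<^sup>2 * \<bar>y - of_int a / of_int q\<bar>) \<le> 1600 * (real N / of_int q)"
    unfolding bq by (simp add: power2_eq_square mult_ac)
qed

section \<open>Major arc majorant and the fifth moment\<close>

text \<open>The 5/2 power of the profile (N/q) / (1 + N^2 |alpha - a/q|), with the decay weakened to
  the second power: this is still integrable and has an arctangent as primitive.\<close>

definition arc_weight :: "nat \<Rightarrow> int \<Rightarrow> int \<Rightarrow> real \<Rightarrow> real" where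
  "arc_weight N q a \<alpha> = (real N / of_int q)\<^sup>2 * sqrt (real N / of_int q) / (1 + ((real N)\<^sup>2 * (\<alpha> - of_int a / of_int q))\<^sup>2)"

lemma arc_weight_nonneg: "0 \<le> q \<Longrightarrow> 0 \<le> arc_weight N q a \<alpha>"
  unfolding arc_weight_def by (intro divide_nonneg_nonneg mult_nonneg_nonneg) auto

text \<open>The exponent 5/2 comes from |S|^5 = (|S|^2)^(5/2). The good fraction a/q depends on y,
  so its term is enlarged to the sum over all pairs, coprime or not, which can be integrated term by
  term. The summand 1 covers those y for which \<open>near\<close> has at most one point.\<close>

lemma card_near_power_le:
  assumes N: "N \<ge> 2" and y: "0 \<le> y" "y \<le> 2"
  shows "(real (card (near N y)))\<^sup>2 * sqrt (real (card (near N y)))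
    \<le> 1 + 204800000 * (\<Sum>q\<in>{1..8*int N}. \<Sum>a\<in>{-1..2*q+1}. arc_weight N q a y)"
proof (cases "card (near N y) > 1")
  case False
  then consider "card (near N y) = 0" | "card (near N y) = 1" by linarith
  then have "(real (card (near N y)))\<^sup>2 * sqrt (real (card (near N y))) \<le> 1" by cases auto
  moreover have "0 \<le> (\<Sum>q\<in>{1..8*int N}. \<Sum>a\<in>{-1..2*q+1}. arc_weight N q a y)"
    by (intro sum_nonneg arc_weight_nonneg) auto
  ultimately show ?thesis by simp
next
  case True
  obtain q a where q: "1 \<le> q" "q \<le> 8 * int N" and a: "\<bar>of_int q * y - of_int a\<bar> \<le> 1 / real N" and cop: "coprime q a"
    using near_obtain_primitive[OF N True] by metis
  define M where "M = real (card (near N y))"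
  define r where "r = real N / of_int q"
  define s where "s = (real N)\<^sup>2 * (y - of_int a / of_int q)"
  have N0: "N > 0" using N by simp
  have M0: "0 \<le> M" and r0: "0 \<le> r" using q by (auto simp: M_def r_def)
  have M1: "M \<le> 1600 * r" and M2: "M * \<bar>s\<bar> \<le> 1600 * r"
    using card_near_bounds[OF N0 q a cop] by (auto simp: M_def r_def s_def abs_mult)
  have "M\<^sup>2 \<le> (1600 * r)\<^sup>2" "(M * \<bar>s\<bar>)\<^sup>2 \<le> (1600 * r)\<^sup>2" using power_mono[OF M1 M0, of 2] power_mono[OF M2, of 2] M0 by auto
  \<comment> \<open>Here 5120000 is twice 1600^2; multiplied by 40, the square root of 1600, it
    yields the constant of the statement.\<close>
  then have "M\<^sup>2 * (1 + s\<^sup>2) \<le> 5120000 * r\<^sup>2" by (simp add: power_mult_distrib algebra_simps)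
  moreover have s1: "1 + s\<^sup>2 > 0" by (rule add_pos_nonneg) auto
  ultimately have "M\<^sup>2 \<le> 5120000 * r\<^sup>2 / (1 + s\<^sup>2)" by (simp add: pos_le_divide_eq)
  moreover have "sqrt M \<le> 40 * sqrt r"
  proof -
    have "sqrt M \<le> sqrt (1600 * r)" using M1 by simp
    also have "\<dots> = sqrt (40\<^sup>2) * sqrt r" unfolding real_sqrt_mult by simp
    finally show ?thesis by simp
  qed
  ultimately have "M\<^sup>2 * sqrt M \<le> 5120000 * r\<^sup>2 / (1 + s\<^sup>2) * (40 * sqrt r)"
    using M0 s1 by (intro mult_mono) auto
  also have "\<dots> = 204800000 * arc_weight N q a y" by (simp add: arc_weight_def r_def s_def)
  also have "arc_weight N q a y \<le> (\<Sum>a\<in>{-1..2*q+1}. arc_weight N q a y)"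
  proof (rule member_le_sum)
    have "\<bar>of_int q * y - of_int a\<bar> \<le> 1" using a N by (auto intro: order_trans)
    moreover have "0 \<le> of_int q * y" "of_int q * y \<le> of_int q * 2" using q y by (auto intro!: mult_left_mono)
    ultimately have "-1 \<le> real_of_int a" "real_of_int a \<le> 2 * of_int q + 1" by linarith+
    then show "a \<in> {-1..2*q+1}" by (simp; linarith)
  qed (use q arc_weight_nonneg in auto)
  also have "\<dots> \<le> (\<Sum>q\<in>{1..8*int N}. \<Sum>a\<in>{-1..2*q+1}. arc_weight N q a y)"
    using q by (intro member_le_sum[of q _ "\<lambda>q. \<Sum>a\<in>{-1..2*q+1}. arc_weight N q a y"] sum_nonneg arc_weight_nonneg) auto
  finally show ?thesis by (simp add: M_def)
qed

lemma arc_weight_has_integral: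
  assumes N: "N > 0" and q: "q > 0"
  obtains I where "((\<lambda>x. arc_weight N q a (2 * x)) has_integral I) {0..1}" 
    "I \<le> 2 * ((real N / of_int q)\<^sup>2 * sqrt (real N / of_int q)) / (real N)\<^sup>2"
proof -
  let ?c = "(real N / of_int q)\<^sup>2 * sqrt (real N / of_int q)"
  define F where "F x = ?c / (2 * (real N)\<^sup>2) * arctan ((real N)\<^sup>2 * (2 * x - of_int a / of_int q))" for x
  have c: "?c \<ge> 0" using q by simp
  have "((\<lambda>x. arc_weight N q a (2 * x)) has_integral (F 1 - F 0)) {0..1}"
  proof (rule fundamental_theorem_of_calculus)
    fix x :: real
    let ?y = "(real N)\<^sup>2 * (2 * x - of_int a / of_int q)"
    have "(F has_real_derivative (?c / (2 * (real N)\<^sup>2) * (inverse (1 + ?y\<^sup>2) * ((real N)\<^sup>2 * 2)))) (at x within {0..1})"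
      unfolding F_def by (intro DERIV_cmult DERIV_chain2[OF DERIV_arctan]) (auto intro!: derivative_eq_intros)
    also have "?c / (2 * (real N)\<^sup>2) * (inverse (1 + ?y\<^sup>2) * ((real N)\<^sup>2 * 2)) = arc_weight N q a (2 * x)"
    proof -
      have "c / (2 * n) * (i * (n * 2)) = c * i" if "n > 0" for c n i :: real using that by simp
      then have "?c / (2 * (real N)\<^sup>2) * (inverse (1 + ?y\<^sup>2) * ((real N)\<^sup>2 * 2)) = ?c * inverse (1 + ?y\<^sup>2)"
        using N by (metis of_nat_0_less_iff zero_less_power)
      then show ?thesis unfolding arc_weight_def by (simp only: divide_inverse[of ?c "1 + ?y\<^sup>2"])
    qed
    finally show "(F has_vector_derivative arc_weight N q a (2 * x)) (at x within {0..1})"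
      by (simp add: has_real_derivative_iff_has_vector_derivative)
  qed simp
  moreover have "F 1 - F 0 \<le> 2 * ?c / (real N)\<^sup>2"
  proof -
    let ?A = "arctan ((real N)\<^sup>2 * (2 * 1 - of_int a / of_int q)) - arctan ((real N)\<^sup>2 * (2 * 0 - of_int a / of_int q))"
    have "?A \<le> 4" using arctan_ubound arctan_lbound pi_less_4 by (smt (verit) field_sum_of_halves)
    have "F 1 - F 0 = ?c / (2 * (real N)\<^sup>2) * ?A" by (simp only: F_def right_diff_distrib)
    also have "\<dots> \<le> ?c / (2 * (real N)\<^sup>2) * 4"
      using c \<open>?A \<le> 4\<close> by (intro mult_left_mono) auto
    also have "\<dots> = 2 * ?c / (real N)\<^sup>2" by simp
    finally show ?thesis .
  qed
  ultimately show ?thesis using that by blast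
qed

lemma sum_power_minus_three_halves:
  "\<exists>C>0. \<forall>K::nat. (\<Sum>q\<in>{1..int K}. 1 / (of_int q * sqrt (of_int q))) \<le> C"
proof -
  have s: "summable (\<lambda>n. real n powr (-3/2))" by (simp add: summable_real_powr_iff)
  have "(\<Sum>q\<in>{1..int K}. 1 / (of_int q * sqrt (of_int q))) \<le> (\<Sum>n. real n powr (-3/2))" for K
  proof -
    have "(\<Sum>q\<in>{1..int K}. 1 / (of_int q * sqrt (of_int q))) = (\<Sum>q\<in>int ` {1..K}. 1 / (of_int q * sqrt (of_int q)))"
      by (simp add: image_int_atLeastAtMost)
    also have "\<dots> = (\<Sum>n\<in>{1..K}. 1 / (real n * sqrt (real n)))" by (subst sum.reindex) auto
    also have "\<dots> = (\<Sum>n\<in>{1..K}. real n powr (-3/2))"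
    proof (intro sum.cong refl)
      fix n assume "n \<in> {1..K}"
      then have n: "real n > 0" by simp
      have "real n powr (3/2) = real n powr (1 + 1/2)" by simp
      also have "\<dots> = real n * sqrt (real n)" using n by (simp only: powr_add powr_one powr_half_sqrt)
      finally show "1 / (real n * sqrt (real n)) = real n powr (-3/2)"
        by (simp add: powr_minus_divide)
    qed
    also have "\<dots> \<le> (\<Sum>n. real n powr (-3/2))" by (rule sum_le_suminf[OF s]) auto
    finally show ?thesis .
  qed
  moreover have "0 \<le> (\<Sum>n. real n powr (-3/2))" by (rule suminf_nonneg[OF s]) simp
  ultimately show ?thesis by (intro exI[of _ "(\<Sum>n. real n powr (-3/2)) + 1"]) (auto intro: add_increasing2 order_trans[OF _ less_imp_le])
qed

lemma continuous_weyl_sum: "continuous_on A (weyl_sum N)"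
  unfolding weyl_sum_def by (intro continuous_intros)

text \<open>Summing over the fractions a/q leaves the convergent sum of q powr (-3/2); with four squares
  it would be the harmonic series.\<close>
lemma weyl_sum_fifth_moment:
  "\<exists>C>0. \<forall>N\<ge>2. integral {0..1} (\<lambda>x. cmod (weyl_sum N x) ^ 5) \<le> C * real N ^ 3"
proof -
  obtain C1 where C1: "C1 > 0" "\<And>K::nat. (\<Sum>q\<in>{1..int K}. 1 / (of_int q * sqrt (of_int q))) \<le> C1"
    using sum_power_minus_three_halves by blast
  define D where "D = 1500\<^sup>2 * sqrt 1500"
  have D: "D > 0" by (simp add: D_def)
  have "integral {0..1} (\<lambda>x. cmod (weyl_sum N x) ^ 5) \<le> D * (1 + 204800000 * (10 * C1)) * real N ^ 3" if N: "N \<ge> 2" for N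
  proof -
    let ?w = "\<lambda>x. \<Sum>q\<in>{1..8*int N}. \<Sum>a\<in>{-1..2*q+1}. arc_weight N q a (2 * x)"
    let ?K = "(real N)\<^sup>2 * sqrt (real N)"
    have N0: "N > 0" using N by simp
    have pt: "cmod (weyl_sum N x) ^ 5 \<le> D * ?K * (1 + 204800000 * ?w x)" if x: "x \<in> {0..1}" for x
    proof -
      define S where "S = cmod (weyl_sum N x)"
      define M where "M = real (card (near N (2 * x)))"
      have S: "S\<^sup>2 \<le> 1500 * real N * M" using weyl_sum_square_le_near[OF N0, of x] by (simp add: S_def M_def)
      have "S = sqrt (S\<^sup>2)" by (simp add: S_def)
      also have "\<dots> \<le> sqrt (1500 * real N * M)" using S by (simp only: real_sqrt_le_iff)
      finally have S1: "S \<le> sqrt (1500 * real N * M)" .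
      have "S ^ 5 = S\<^sup>2 * S\<^sup>2 * S" by (simp add: eval_nat_numeral)
      also have "\<dots> \<le> (1500 * real N * M) * (1500 * real N * M) * sqrt (1500 * real N * M)"
        using S S1 by (intro mult_mono) (auto simp: S_def M_def)
      also have "\<dots> = D * ?K * (M\<^sup>2 * sqrt M)"
        by (simp add: D_def real_sqrt_mult power2_eq_square mult_ac)
      also have "\<dots> \<le> D * ?K * (1 + 204800000 * ?w x)"
        unfolding M_def using x N D by (intro mult_left_mono card_near_power_le) auto
      finally show ?thesis by (simp add: S_def)
    qed
    have "\<exists>I. ((\<lambda>x. arc_weight N q a (2 * x)) has_integral I) {0..1} \<and> 
       I \<le> 2 * ((real N / of_int q)\<^sup>2 * sqrt (real N / of_int q)) / (real N)\<^sup>2" if "q \<in> {1..8 * int N}" for q a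
      using arc_weight_has_integral[OF N0, of q a] that by (auto; blast)
    then obtain I where I: "\<And>q a. q \<in> {1..8 * int N} \<Longrightarrow> ((\<lambda>x. arc_weight N q a (2 * x)) has_integral I q a) {0..1}"
      "\<And>q a. q \<in> {1..8 * int N} \<Longrightarrow> I q a \<le> 2 * ((real N / of_int q)\<^sup>2 * sqrt (real N / of_int q)) / (real N)\<^sup>2"
      by metis
    let ?J = "\<Sum>q\<in>{1..8*int N}. \<Sum>a\<in>{-1..2*q+1}. I q a"
    have w: "((\<lambda>x. D * ?K * (1 + 204800000 * ?w x)) has_integral (D * ?K * (1 + 204800000 * ?J))) {0..1}"
      using has_integral_const_real[of "1::real" 0 1]
      by (intro has_integral_mult_right has_integral_add has_integral_sum I) auto
    have "integral {0..1} (\<lambda>x. cmod (weyl_sum N x) ^ 5) \<le> D * ?K * (1 + 204800000 * ?J)"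
    proof (rule has_integral_le[OF integrable_integral w pt])
      show "(\<lambda>x. cmod (weyl_sum N x) ^ 5) integrable_on {0..1}"
        by (intro integrable_continuous_real continuous_intros continuous_weyl_sum)
    qed auto
    also have "?J \<le> 10 * C1 * sqrt (real N)"
    proof -
      have "?J \<le> (\<Sum>q\<in>{1..8*int N}. 10 * sqrt (real N) * (1 / (of_int q * sqrt (of_int q))))"
      proof (rule sum_mono)
        fix q assume q: "q \<in> {1..8*int N}"
        have "(\<Sum>a\<in>{-1..2*q+1}. I q a) \<le> of_nat (card {-1..2*q+1}) * (2 * ((real N / of_int q)\<^sup>2 * sqrt (real N / of_int q)) / (real N)\<^sup>2)"
          by (rule sum_bounded_above) (rule I(2)[OF q])
        \<comment> \<open>There are 2q + 3 numerators, at most 5q, which turns the decay q^(-5/2) of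
          a single arc into q^(-3/2).\<close>
        also have "\<dots> \<le> (5 * of_int q) * (2 * ((real N / of_int q)\<^sup>2 * sqrt (real N / of_int q)) / (real N)\<^sup>2)"
          using q by (intro mult_right_mono) auto
        also have "\<dots> = 10 * sqrt (real N) * (1 / (of_int q * sqrt (of_int q)))"
          using q N0 by (simp add: real_sqrt_divide field_simps power2_eq_square)
        finally show "(\<Sum>a\<in>{-1..2*q+1}. I q a) \<le> 10 * sqrt (real N) * (1 / (of_int q * sqrt (of_int q)))" .
      qed
      also have "\<dots> = 10 * sqrt (real N) * (\<Sum>q\<in>{1..int (8 * N)}. 1 / (of_int q * sqrt (of_int q)))"
        by (simp add: sum_distrib_left)
      also have "\<dots> \<le> 10 * sqrt (real N) * C1" by (intro mult_left_mono C1) auto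
      finally show ?thesis by (simp add: mult_ac)
    qed
    \<comment> \<open>Off the major arcs the contribution is only N^(5/2); it is absorbed by
      replacing 1 with sqrt N.\<close>
    also have "D * ?K * (1 + 204800000 * (10 * C1 * sqrt (real N))) \<le> D * ?K * (sqrt (real N) + 204800000 * (10 * C1 * sqrt (real N)))"
      using D N C1(1) by (intro mult_left_mono add_mono) auto
    also have "\<dots> = D * (1 + 204800000 * (10 * C1)) * ((real N)\<^sup>2 * (sqrt (real N) * sqrt (real N)))"
    proof -
      have "D * (n * r) * (r + 204800000 * (10 * C1 * r)) = D * (1 + 204800000 * (10 * C1)) * (n * (r * r))" for n r :: real
        by (simp add: algebra_simps)
      then show ?thesis .
    qed
    also have "(real N)\<^sup>2 * (sqrt (real N) * sqrt (real N)) = real N ^ 3" by (simp add: power2_eq_square power3_eq_cube)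
    finally show ?thesis using D by (simp add: mult_left_mono)
  qed
  moreover have "D * (1 + 204800000 * (10 * C1)) > 0" using D C1 by (intro mult_pos_pos) auto
  ultimately show ?thesis by blast
qed

section \<open>From moments to representation numbers\<close>

lemma integral_cis_int:
  "((\<lambda>x. cis (2 * pi * real_of_int k * x)) has_integral (if k = 0 then 1 else 0)) {0..1}"
proof (cases "k = 0")
  case True
  then show ?thesis using has_integral_const_real[of "1::complex" 0 1] by simp
next
  case False
  define F where "F x = cis (2 * pi * real_of_int k * x) / (\<i> * of_real (2 * pi * real_of_int k))" for x
  have "((\<lambda>x. cis (2 * pi * real_of_int k * x)) has_integral (F 1 - F 0)) {0..1}"
  proof (rule fundamental_theorem_of_calculus)
    fix x :: real
    show "(F has_vector_derivative cis (2 * pi * real_of_int k * x)) (at x within {0..1})"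
      unfolding F_def cis_conv_exp using False
      by (auto intro!: derivative_eq_intros has_vector_derivative_real_field simp: field_simps)
  qed simp
  moreover have "F 1 = F 0" using cis_multiple_2pi[of "real_of_int k"] by (simp add: F_def mult_ac)
  ultimately show ?thesis using False by simp
qed

lemma prod_cis: "finite A \<Longrightarrow> (\<Prod>i\<in>A. cis (f i)) = cis (\<Sum>i\<in>A. f i)"
  by (induction A rule: finite_induct) (auto simp: cis_mult)

text \<open>Orthogonality extracts the representations of n from the d-th power of the exponential
  sum. Since n is at most N^2, all coordinates of a representation are at most N in size, where
  \<open>tri\<close> is at least 1, so the weighted count dominates the true one.\<close>

lemma card_le_moment:
  assumes N: "N > 0" and n: "n \<le> N\<^sup>2"
  shows "real (card {u :: 'n::finite \<Rightarrow> int. (\<Sum>i\<in>UNIV. (u i)\<^sup>2) = int n})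
    \<le> integral {0..1} (\<lambda>x. cmod (weyl_sum N x) ^ CARD('n))" (is "real (card ?K) \<le> _")
proof -
  let ?I = "{-2*int N..2*int N}"
  let ?P = "PiE UNIV (\<lambda>_. ?I) :: ('n \<Rightarrow> int) set"
  let ?w = "\<lambda>u :: 'n \<Rightarrow> int. \<Prod>i\<in>UNIV. tri N (u i)"
  have fin: "finite ?P" by (intro finite_PiE) auto
  have bd: "\<bar>u i\<bar> \<le> int N" if "u \<in> ?K" for u i
  proof -
    have "(u i)\<^sup>2 \<le> (\<Sum>i\<in>UNIV. (u i)\<^sup>2)" by (rule member_le_sum) auto
    also have "\<dots> \<le> (int N)\<^sup>2" using that n by (simp flip: of_nat_power)
    finally show ?thesis by (simp add: abs_le_square_iff[symmetric])
  qed
  have KP: "?K \<subseteq> ?P"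
  proof (rule subsetI)
    fix u assume "u \<in> ?K"
    then have "-2 * int N \<le> u i \<and> u i \<le> 2 * int N" for i using bd[of u i] by linarith
    then show "u \<in> ?P" by auto
  qed
  have eq: "weyl_sum N x ^ CARD('n) * cis (2 * pi * real_of_int (- int n) * x)
     = (\<Sum>u\<in>?P. of_real (?w u) * cis (2 * pi * real_of_int ((\<Sum>i\<in>UNIV. (u i)\<^sup>2) - int n) * x))" for x
  proof -
    have "weyl_sum N x ^ CARD('n) = (\<Prod>i\<in>(UNIV::'n set). \<Sum>m\<in>?I. of_real (tri N m) * cis (2 * pi * (real_of_int m)\<^sup>2 * x))"
      by (simp add: weyl_sum_def)
    also have "\<dots> = (\<Sum>u\<in>?P. \<Prod>i\<in>UNIV. of_real (tri N (u i)) * cis (2 * pi * (real_of_int (u i))\<^sup>2 * x))"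
      by (rule prod_sum_PiE) auto
    finally show ?thesis
      by (simp add: prod.distrib prod_cis sum_distrib_right mult.assoc cis_mult)
         (simp add: algebra_simps sum_distrib_left)
  qed
  have int: "((\<lambda>x. weyl_sum N x ^ CARD('n) * cis (2 * pi * real_of_int (- int n) * x)) has_integral
    (\<Sum>u\<in>?P. of_real (?w u) * (if (\<Sum>i\<in>UNIV. (u i)\<^sup>2) - int n = 0 then 1 else 0))) {0..1}"
    unfolding eq by (intro has_integral_sum has_integral_mult_right integral_cis_int fin)
  have "real (card ?K) = (\<Sum>u\<in>?K. 1)" by simp
  also have "\<dots> \<le> (\<Sum>u\<in>?K. ?w u)"
    by (intro sum_mono prod_ge_1 tri_ge bd)
  also have "\<dots> = (\<Sum>u\<in>?P. ?w u * (if (\<Sum>i\<in>UNIV. (u i)\<^sup>2) - int n = 0 then 1 else 0))"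
    by (rule sum.mono_neutral_cong_left[OF fin KP]) auto
  also have "\<dots> = Re (\<Sum>u\<in>?P. of_real (?w u) * (if (\<Sum>i\<in>UNIV. (u i)\<^sup>2) - int n = 0 then 1 else 0))"
    by (simp add: if_distrib cong: if_cong flip: of_real_prod)
  also have "\<dots> = Re (integral {0..1} (\<lambda>x. weyl_sum N x ^ CARD('n) * cis (2 * pi * real_of_int (- int n) * x)))"
    by (simp only: integral_unique[OF int])
  also have "\<dots> \<le> cmod (integral {0..1} (\<lambda>x. weyl_sum N x ^ CARD('n) * cis (2 * pi * real_of_int (- int n) * x)))"
    by (rule complex_Re_le_cmod)
  also have "\<dots> \<le> integral {0..1} (\<lambda>x. cmod (weyl_sum N x) ^ CARD('n))"
  proof (rule integral_norm_bound_integral)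
    show "(\<lambda>x. cmod (weyl_sum N x) ^ CARD('n)) integrable_on {0..1}"
      by (intro integrable_continuous_real continuous_intros continuous_weyl_sum)
  qed (use int in \<open>auto simp: norm_mult norm_power integrable_on_def\<close>)
  finally show ?thesis .
qed

text \<open>With N of order sqrt n, d - 5 factors are bounded by 10N and the fifth moment by a
  multiple of N^3, in total N^(d - 2).\<close>

lemma card_sum_squares_le:
  assumes "CARD('n::finite) \<ge> 5"
  shows "\<exists>C>0. \<forall>n\<ge>1. real (card {u :: 'n \<Rightarrow> int. (\<Sum>i\<in>UNIV. (u i)\<^sup>2) = int n}) \<le> C * sqrt (real n) ^ (CARD('n) - 2)"
proof -
  let ?d = "CARD('n)"
  obtain C where C: "C > 0" "\<And>N. N \<ge> 2 \<Longrightarrow> integral {0..1} (\<lambda>x. cmod (weyl_sum N x) ^ 5) \<le> C * real N ^ 3"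
    using weyl_sum_fifth_moment by blast
  have "real (card {u :: 'n \<Rightarrow> int. (\<Sum>i\<in>UNIV. (u i)\<^sup>2) = int n}) \<le> 10 ^ (?d - 5) * C * 3 ^ (?d - 2) * sqrt (real n) ^ (?d - 2)" if n: "n \<ge> 1" for n
  proof -
    \<comment> \<open>The added 1 guarantees \<open>N \<ge> 2\<close> also for n = 1, as the moment
      bound requires.\<close>
    define N where "N = nat \<lceil>sqrt (real n)\<rceil> + 1"
    have s1: "1 \<le> sqrt (real n)" using n by simp
    have N: "N \<ge> 2" using s1 unfolding N_def by linarith
    have sN: "sqrt (real n) \<le> real N" unfolding N_def by linarith
    have "real n = sqrt (real n) ^ 2" by simp
    also have "\<dots> \<le> real N ^ 2" using sN by (intro power_mono) auto
    finally have nN: "n \<le> N\<^sup>2" by (simp flip: of_nat_power)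
    have N3: "real N \<le> 3 * sqrt (real n)" using s1 unfolding N_def by linarith
    have "real (card {u :: 'n \<Rightarrow> int. (\<Sum>i\<in>UNIV. (u i)\<^sup>2) = int n}) \<le> integral {0..1} (\<lambda>x. cmod (weyl_sum N x) ^ ?d)"
      using N by (intro card_le_moment nN) auto
    also have "\<dots> \<le> integral {0..1} (\<lambda>x. (10 * real N) ^ (?d - 5) * cmod (weyl_sum N x) ^ 5)"
    proof (rule integral_le)
      fix x
      have "cmod (weyl_sum N x) ^ ?d = cmod (weyl_sum N x) ^ (?d - 5) * cmod (weyl_sum N x) ^ 5"
        using assms by (simp flip: power_add)
      also have "\<dots> \<le> (10 * real N) ^ (?d - 5) * cmod (weyl_sum N x) ^ 5"
        using N by (intro mult_right_mono power_mono weyl_sum_norm_le) auto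
      finally show "cmod (weyl_sum N x) ^ ?d \<le> (10 * real N) ^ (?d - 5) * cmod (weyl_sum N x) ^ 5" .
    qed (intro integrable_continuous_real continuous_intros continuous_weyl_sum)+
    also have "\<dots> = (10 * real N) ^ (?d - 5) * integral {0..1} (\<lambda>x. cmod (weyl_sum N x) ^ 5)" by simp
    also have "\<dots> \<le> (10 * real N) ^ (?d - 5) * (C * real N ^ 3)"
      by (intro mult_left_mono C N) auto
    also have "\<dots> = 10 ^ (?d - 5) * C * real N ^ (?d - 5 + 3)" by (simp add: power_mult_distrib power_add)
    also have "?d - 5 + 3 = ?d - 2" using assms by simp
    also have "10 ^ (?d - 5) * C * real N ^ (?d - 2) \<le> 10 ^ (?d - 5) * C * (3 * sqrt (real n)) ^ (?d - 2)"
      using C N3 by (intro mult_left_mono power_mono) auto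
    finally show ?thesis by (simp add: power_mult_distrib mult_ac)
  qed
  moreover have "10 ^ (?d - 5) * C * 3 ^ (?d - 2) > 0" using C by simp
  ultimately show ?thesis by blast
qed

section \<open>Quadratic phases in the square norm\<close>

lemma integral_lborel_prod:
  fixes f :: "'a::euclidean_space \<Rightarrow> real \<Rightarrow> complex"
  assumes "\<And>b. b \<in> Basis \<Longrightarrow> integrable lborel (f b)"
  shows "(\<integral>x. (\<Prod>b\<in>Basis. f b (x \<bullet> b)) \<partial>lborel) = (\<Prod>b\<in>Basis. \<integral>t. f b t \<partial>lborel)"
proof -
  interpret product_sigma_finite "\<lambda>_::'a. lborel :: real measure" ..
  have [measurable]: "f b \<in> borel_measurable borel" if "b \<in> Basis" for b
    using borel_measurable_integrable[OF assms[OF that]] by simp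
  have "(\<integral>x. (\<Prod>b\<in>Basis. f b (x \<bullet> b)) \<partial>lborel) = 
     (\<integral>x. (\<Prod>b\<in>Basis. f b ((\<Sum>i\<in>Basis. x i *\<^sub>R i) \<bullet> b)) \<partial>Pi\<^sub>M (Basis :: 'a set) (\<lambda>_. lborel :: real measure))"
    by (subst lborel_eq) (simp add: integral_distr)
  also have "\<dots> = (\<integral>x. (\<Prod>b\<in>Basis. f b (x b)) \<partial>Pi\<^sub>M (Basis :: 'a set) (\<lambda>_. lborel :: real measure))"
    by (intro Bochner_Integration.integral_cong prod.cong refl) simp
  also have "\<dots> = (\<Prod>b\<in>Basis. \<integral>t. f b t \<partial>lborel)"
    by (rule product_integral_prod) (auto intro: assms)
  finally show ?thesis .
qed

lemma borel_measurable_cis [measurable]: "cis \<in> borel_measurable borel"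
  by (intro borel_measurable_continuous_onI continuous_intros)

definition gauss :: "real \<Rightarrow> 'a::euclidean_space \<Rightarrow> real" where
  "gauss R y = exp (- (norm y / R)\<^sup>2 / 2)"

lemma gauss_pos: "gauss R y > 0" by (simp add: gauss_def)

lemma gauss_le_1: "gauss R y \<le> 1" by (simp add: gauss_def)

lemma borel_measurable_gauss [measurable]: "gauss R \<in> borel_measurable borel"
  unfolding gauss_def by measurable

lemma gauss_prod: "gauss R y = (\<Prod>b\<in>Basis. gauss R (y \<bullet> b))"
proof -
  have "(norm y)\<^sup>2 = (\<Sum>b\<in>Basis. (y \<bullet> b)\<^sup>2)"
    by (simp only: euclidean_inner[of y y] power2_norm_eq_inner) (simp add: power2_eq_square)
  then have "- (norm y / R)\<^sup>2 / 2 = (\<Sum>b\<in>Basis. - (norm (y \<bullet> b) / R)\<^sup>2 / 2)"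
    by (simp add: power_divide sum_negf flip: sum_divide_distrib)
  then show ?thesis by (simp add: gauss_def exp_sum)
qed

lemma cis_inner_prod: "cis (x \<bullet> y) = (\<Prod>b\<in>Basis. cis ((x \<bullet> b) * (y \<bullet> b)))"
  by (subst euclidean_inner) (simp add: prod_cis)

lemma gauss_real_eq: "R > 0 \<Longrightarrow> gauss R (x::real) = sqrt (2 * pi) * R * normal_density 0 R x"
  by (simp add: gauss_def normal_density_def power_divide real_sqrt_mult)

lemma integrable_gauss_real: "R > 0 \<Longrightarrow> integrable lborel (gauss R :: real \<Rightarrow> real)"
  using integrable_normal_density[of R 0]
  by (subst Bochner_Integration.integrable_cong[OF refl gauss_real_eq]) auto

text \<open>After rescaling this is the characteristic function of the standard normal distribution;
  products over coordinates then give all dimensions.\<close>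

lemma integral_gauss_real_cis:
  assumes R: "R > 0"
  shows "(\<integral>x. of_real (gauss R x) * cis (t * x) \<partial>lborel) = of_real (sqrt (2 * pi) * R * gauss 1 (R * t))"
proof -
  have "(\<integral>x. of_real (gauss R x) * cis (t * x) \<partial>lborel) = R *\<^sub>R (\<integral>x. of_real (gauss R (R * x)) * cis (t * (R * x)) \<partial>lborel)"
    using lborel_integral_real_affine[of R "\<lambda>x. of_real (gauss R x) * cis (t * x)" 0] R by simp
  also have "(\<integral>x. of_real (gauss R (R * x)) * cis (t * (R * x)) \<partial>lborel) = 
     (\<integral>x. of_real (sqrt (2 * pi)) * (std_normal_density x *\<^sub>R cis ((R * t) * x)) \<partial>lborel)"
    using R by (intro Bochner_Integration.integral_cong refl)
      (simp add: gauss_def std_normal_density_def scaleR_conv_of_real abs_mult mult_ac)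
  also have "\<dots> = of_real (sqrt (2 * pi)) * (\<integral>x. std_normal_density x *\<^sub>R cis ((R * t) * x) \<partial>lborel)"
    by (rule integral_mult_right_zero)
  also have "(\<integral>x. std_normal_density x *\<^sub>R cis ((R * t) * x) \<partial>lborel) = char std_normal_distribution (R * t)"
    unfolding char_def by (subst integral_density) (auto simp: cis_conv_exp)
  also have "\<dots> = of_real (gauss 1 (R * t))" by (simp add: char_std_normal_distribution gauss_def)
  finally show ?thesis by (simp add: scaleR_conv_of_real)
qed

lemma integral_gauss_cis:
  fixes \<xi> :: "'a::euclidean_space"
  assumes R: "R > 0"
  shows "(\<integral>y. of_real (gauss R y) * cis (\<xi> \<bullet> y) \<partial>lborel) = of_real ((sqrt (2 * pi) * R) ^ DIM('a) * gauss 1 (R *\<^sub>R \<xi>))"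
proof -
  have "(\<integral>y. of_real (gauss R y) * cis (\<xi> \<bullet> y) \<partial>lborel) =
    (\<integral>y. (\<Prod>b\<in>Basis. of_real (gauss R (y \<bullet> b)) * cis ((\<xi> \<bullet> b) * (y \<bullet> b))) \<partial>lborel)"
    by (simp add: gauss_prod[of R "_ :: 'a"] cis_inner_prod prod.distrib)
  also have "\<dots> = (\<Prod>b\<in>Basis. \<integral>t. of_real (gauss R t) * cis ((\<xi> \<bullet> b) * t) \<partial>lborel)"
  proof (rule integral_lborel_prod)
    fix b :: 'a
    show "integrable lborel (\<lambda>t. complex_of_real (gauss R t) * cis ((\<xi> \<bullet> b) * t))"
      by (rule Bochner_Integration.integrable_bound[OF integrable_gauss_real[OF R]]) (auto simp: norm_mult)
  qed
  also have "\<dots> = (\<Prod>b\<in>(Basis::'a set). of_real (sqrt (2 * pi) * R * gauss 1 (R * (\<xi> \<bullet> b))))"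
    by (simp only: integral_gauss_real_cis[OF R])
  also have "\<dots> = of_real ((sqrt (2 * pi) * R) ^ DIM('a) * (\<Prod>b\<in>(Basis::'a set). gauss 1 (R * (\<xi> \<bullet> b))))"
    by (simp add: prod.distrib)
  also have "(\<Prod>b\<in>(Basis::'a set). gauss 1 (R * (\<xi> \<bullet> b))) = gauss 1 (R *\<^sub>R \<xi>)"
    by (simp add: gauss_prod[of 1 "R *\<^sub>R \<xi>"])
  finally show ?thesis .
qed

lemma nn_integral_gauss:
  assumes R: "R > 0"
  shows "(\<integral>\<^sup>+y. ennreal (gauss R (y :: 'a::euclidean_space)) \<partial>lborel) = ennreal ((sqrt (2 * pi) * R) ^ DIM('a))"
proof -
  have 1: "(\<integral>\<^sup>+t. ennreal (gauss R (t::real)) \<partial>lborel) = ennreal (sqrt (2 * pi) * R)"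
  proof -
    have "(\<integral>t. gauss R (t::real) \<partial>lborel) = sqrt (2 * pi) * R"
    proof -
      have "complex_of_real (\<integral>t. gauss R (t::real) \<partial>lborel) = of_real (sqrt (2 * pi) * R)"
        using integral_gauss_real_cis[OF R, of 0] by (simp add: gauss_def[of 1])
      then show ?thesis by (simp only: of_real_eq_iff)
    qed
    then show ?thesis
      using integrable_gauss_real[OF R] by (subst nn_integral_eq_integral) (auto simp: gauss_pos less_imp_le)
  qed
  have "(\<integral>\<^sup>+y. ennreal (gauss R (y :: 'a)) \<partial>lborel) = (\<integral>\<^sup>+y. (\<Prod>b\<in>Basis. ennreal (gauss R (y \<bullet> b))) \<partial>(lborel :: 'a measure))"
    by (simp add: gauss_prod[of R "_ :: 'a"] prod_ennreal gauss_pos less_imp_le)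
  also have "\<dots> = (\<Prod>b\<in>(Basis::'a set). \<integral>\<^sup>+t. ennreal (gauss R (t::real)) \<partial>lborel)"
    by (rule nn_integral_lborel_prod) auto
  also have "\<dots> = ennreal ((sqrt (2 * pi) * R) ^ DIM('a))"
    using R by (simp add: 1 ennreal_power)
  finally show ?thesis .
qed

lemma integrable_gauss: "R > 0 \<Longrightarrow> integrable lborel (gauss R :: 'a::euclidean_space \<Rightarrow> real)"
  by (rule integrableI_nonneg) (auto simp: nn_integral_gauss gauss_pos less_imp_le)

lemma gauss_scale: "c \<noteq> 0 \<Longrightarrow> gauss R (c *\<^sub>R y) = gauss (R / \<bar>c\<bar>) y"
  by (simp add: gauss_def field_simps)

section \<open>A Plancherel inequality for integrable functions\<close>

text \<open>Unnormalized, in angular frequency and with a positive sign in the exponent; hence the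
  factor (2 pi)^d in the Plancherel bounds below.\<close>

definition fourier :: "('a::euclidean_space \<Rightarrow> complex) \<Rightarrow> 'a \<Rightarrow> complex" where
  "fourier u \<xi> = (\<integral>x. u x * cis (\<xi> \<bullet> x) \<partial>lborel)"

lemma borel_measurable_fourier [measurable]:
  assumes [measurable]: "u \<in> borel_measurable borel"
  shows "fourier u \<in> borel_measurable borel"
  unfolding fourier_def by measurable

lemma integrable_mult_cis:
  fixes u :: "'a::euclidean_space \<Rightarrow> complex"
  assumes "integrable lborel u" "g \<in> borel_measurable borel"
  shows "integrable lborel (\<lambda>x. u x * cis (g x))"
  by (rule Bochner_Integration.integrable_bound[OF assms(1)])
    (use borel_measurable_integrable[OF assms(1)] assms(2) in \<open>auto simp: norm_mult\<close>)

lemma norm_fourier_le: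
  assumes "integrable lborel u"
  shows "cmod (fourier u \<xi>) \<le> (\<integral>x. cmod (u x) \<partial>lborel)"
  unfolding fourier_def
  by (rule order_trans[OF integral_norm_bound]) (simp add: norm_mult)

lemma integrable_pair_mult:
  fixes f :: "'a \<Rightarrow> complex" and g :: "'b \<Rightarrow> complex"
  assumes "sigma_finite_measure M" "sigma_finite_measure N" "integrable M f" "integrable N g"
  shows "integrable (M \<Otimes>\<^sub>M N) (\<lambda>(x, y). f x * g y)"
proof -
  interpret M: sigma_finite_measure M by fact
  interpret N: sigma_finite_measure N by fact
  have [measurable]: "f \<in> borel_measurable M" "g \<in> borel_measurable N" using assms by auto
  have "(\<integral>\<^sup>+z. norm (case z of (x, y) \<Rightarrow> f x * g y) \<partial>(M \<Otimes>\<^sub>M N)) = (\<integral>\<^sup>+x. \<integral>\<^sup>+y. ennreal (cmod (f x)) * ennreal (cmod (g y)) \<partial>N \<partial>M)"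
    by (subst N.nn_integral_fst[symmetric]) (auto simp: norm_mult ennreal_mult split_beta)
  also have "\<dots> = (\<integral>\<^sup>+x. ennreal (cmod (f x)) \<partial>M) * (\<integral>\<^sup>+y. ennreal (cmod (g y)) \<partial>N)"
    by (simp add: nn_integral_cmult nn_integral_multc)
  also have "\<dots> < \<infinity>" using assms by (auto simp: integrable_iff_bounded ennreal_mult_less_top)
  finally show ?thesis by (intro integrableI_bounded) auto
qed

lemma nn_integral_lborel_translate:
  fixes f :: "'a::euclidean_space \<Rightarrow> ennreal"
  assumes [measurable]: "f \<in> borel_measurable borel"
  shows "(\<integral>\<^sup>+x. f (a + x) \<partial>lborel) = (\<integral>\<^sup>+x. f x \<partial>lborel)"
proof -
  have "(\<integral>\<^sup>+x. f x \<partial>lborel) = (\<integral>\<^sup>+x. f x \<partial>distr lborel borel ((+) a))" by (simp add: lborel_distr_plus)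
  also have "\<dots> = (\<integral>\<^sup>+x. f (a + x) \<partial>lborel)" by (rule nn_integral_distr) auto
  finally show ?thesis by simp
qed

lemma nn_integral_lborel_uminus:
  fixes f :: "'a::euclidean_space \<Rightarrow> ennreal"
  assumes [measurable]: "f \<in> borel_measurable borel"
  shows "(\<integral>\<^sup>+x. f (- x) \<partial>lborel) = (\<integral>\<^sup>+x. f x \<partial>lborel)"
proof -
  have "(lborel :: 'a measure) = distr lborel borel uminus"
    using lborel_affine[of "-1" "0::'a"] by (simp add: density_1)
  then have "(\<integral>\<^sup>+x. f x \<partial>lborel) = (\<integral>\<^sup>+x. f x \<partial>distr lborel borel uminus)" by simp
  also have "\<dots> = (\<integral>\<^sup>+x. f (- x) \<partial>lborel)" by (rule nn_integral_distr) auto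
  finally show ?thesis by simp
qed

lemma ennreal_mult_le_squares: "ennreal a * ennreal b \<le> ennreal (a\<^sup>2 / 2) + ennreal (b\<^sup>2 / 2)" if "0 \<le> a" "0 \<le> b"
proof -
  have "a * b \<le> a\<^sup>2 / 2 + b\<^sup>2 / 2" using zero_le_power2[of "a - b"] by (simp add: power2_diff)
  then show ?thesis using that by (simp flip: ennreal_mult ennreal_plus)
qed

text \<open>Schur test: the inequality ab <= (a^2 + b^2)/2 splits the form into halves, and in each
  half the kernel is integrated over the variable that the square does not contain.\<close>

lemma nn_integral_schur:
  fixes g :: "'a::euclidean_space \<Rightarrow> real" and k :: "'a \<Rightarrow> ennreal"
  assumes [measurable]: "g \<in> borel_measurable borel" "k \<in> borel_measurable borel" and g: "\<And>x. 0 \<le> g x"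
  shows "(\<integral>\<^sup>+x. \<integral>\<^sup>+y. ennreal (g x) * ennreal (g y) * k (x - y) \<partial>lborel \<partial>lborel)
    \<le> (\<integral>\<^sup>+x. ennreal ((g x)\<^sup>2) \<partial>lborel) * (\<integral>\<^sup>+z. k z \<partial>lborel)"
proof -
  have k1: "(\<integral>\<^sup>+y. k (x - y) \<partial>lborel) = (\<integral>\<^sup>+z. k z \<partial>lborel)" for x
    using nn_integral_lborel_uminus[of "\<lambda>y. k (x + y)"] nn_integral_lborel_translate[of k x] by simp
  have k2: "(\<integral>\<^sup>+x. k (x - y) \<partial>lborel) = (\<integral>\<^sup>+z. k z \<partial>lborel)" for y
    using nn_integral_lborel_translate[of k "- y"] by simp
  have "(\<integral>\<^sup>+x. \<integral>\<^sup>+y. ennreal (g x) * ennreal (g y) * k (x - y) \<partial>lborel \<partial>lborel)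
    \<le> (\<integral>\<^sup>+x. \<integral>\<^sup>+y. (ennreal ((g x)\<^sup>2 / 2) + ennreal ((g y)\<^sup>2 / 2)) * k (x - y) \<partial>lborel \<partial>lborel)"
    by (intro nn_integral_mono mult_right_mono ennreal_mult_le_squares g) auto
  also have "\<dots> = (\<integral>\<^sup>+x. \<integral>\<^sup>+y. ennreal ((g x)\<^sup>2 / 2) * k (x - y) \<partial>lborel \<partial>lborel) + (\<integral>\<^sup>+x. \<integral>\<^sup>+y. ennreal ((g y)\<^sup>2 / 2) * k (x - y) \<partial>lborel \<partial>lborel)"
    by (simp add: distrib_right nn_integral_add)
  also have "(\<integral>\<^sup>+x. \<integral>\<^sup>+y. ennreal ((g y)\<^sup>2 / 2) * k (x - y) \<partial>lborel \<partial>lborel) = (\<integral>\<^sup>+y. \<integral>\<^sup>+x. ennreal ((g y)\<^sup>2 / 2) * k (x - y) \<partial>lborel \<partial>lborel)"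
    by (rule lborel_pair.Fubini') measurable
  also have "(\<integral>\<^sup>+x. \<integral>\<^sup>+y. ennreal ((g x)\<^sup>2 / 2) * k (x - y) \<partial>lborel \<partial>lborel) + (\<integral>\<^sup>+y. \<integral>\<^sup>+x. ennreal ((g y)\<^sup>2 / 2) * k (x - y) \<partial>lborel \<partial>lborel)
     = (\<integral>\<^sup>+x. ennreal ((g x)\<^sup>2 / 2) + ennreal ((g x)\<^sup>2 / 2) \<partial>lborel) * (\<integral>\<^sup>+z. k z \<partial>lborel)"
    by (simp add: nn_integral_cmult nn_integral_multc k1 k2 nn_integral_add distrib_right)
  also have "(\<integral>\<^sup>+x. ennreal ((g x)\<^sup>2 / 2) + ennreal ((g x)\<^sup>2 / 2) \<partial>lborel) = (\<integral>\<^sup>+x. ennreal ((g x)\<^sup>2) \<partial>lborel)"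
    by (intro nn_integral_cong) (simp flip: ennreal_plus)
  finally show ?thesis .
qed

text \<open>The Gaussian weight makes the frequency integral absolutely convergent, so Fubini
  applies after |fourier u|^2 is written as a double integral over (x, y). The frequency integral
  then becomes a Gaussian kernel in x - y, and the Schur test needs only its mass.\<close>

lemma plancherel_gauss:
  fixes u :: "'a::euclidean_space \<Rightarrow> complex"
  assumes u: "integrable lborel u" and R: "R > 0" and c: "c \<noteq> 0"
  shows "(\<integral>\<^sup>+\<xi>. ennreal (gauss R \<xi> * (cmod (fourier u (c *\<^sub>R \<xi>)))\<^sup>2) \<partial>lborel)
    \<le> ennreal ((2 * pi / \<bar>c\<bar>) ^ DIM('a)) * (\<integral>\<^sup>+x. ennreal ((cmod (u x))\<^sup>2) \<partial>lborel)"
proof -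
  have [measurable]: "u \<in> borel_measurable borel" using u by auto
  let ?P = "lborel \<Otimes>\<^sub>M lborel :: ('a \<times> 'a) measure"
  interpret Q: pair_sigma_finite "lborel :: 'a measure" ?P ..
  define w where "w p = u (fst p) * cnj (u (snd p))" for p :: "'a \<times> 'a"
  define h where "h R z = (sqrt (2 * pi) * R) ^ DIM('a) * gauss 1 ((R * c) *\<^sub>R z)" for R and z :: 'a
  have w_int: "integrable ?P w"
  proof -
    have "w = (\<lambda>(x, y). u x * cnj (u y))" by (auto simp: w_def)
    then show ?thesis using u
      by (simp only:) (intro integrable_pair_mult lborel.sigma_finite_measure_axioms, auto)
  qed
  have [measurable]: "w \<in> borel_measurable ?P" using w_int by auto
  have sq: "of_real ((cmod (fourier u \<xi>))\<^sup>2) = (\<integral>p. w p * cis (\<xi> \<bullet> (fst p - snd p)) \<partial>?P)" for \<xi>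
  proof -
    have i: "integrable lborel (\<lambda>x. u x * cis (\<xi> \<bullet> x))" by (rule integrable_mult_cis[OF u]) measurable
    have "of_real ((cmod (fourier u \<xi>))\<^sup>2) = fourier u \<xi> * cnj (fourier u \<xi>)" by (rule complex_norm_square)
    also have "\<dots> = (\<integral>x. \<integral>y. (u x * cis (\<xi> \<bullet> x)) * cnj (u y * cis (\<xi> \<bullet> y)) \<partial>lborel \<partial>lborel)"
      unfolding fourier_def by (simp del: complex_cnj_mult)
    also have "\<dots> = (\<integral>p. (case p of (x, y) \<Rightarrow> (u x * cis (\<xi> \<bullet> x)) * cnj (u y * cis (\<xi> \<bullet> y))) \<partial>?P)"
      using lborel_pair.integral_fst'[OF integrable_pair_mult[OF lborel.sigma_finite_measure_axioms lborel.sigma_finite_measure_axioms i complex_integrable_cnj[THEN iffD2, OF i]]]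
      by (simp only: case_prod_conv)
    also have "\<dots> = (\<integral>p. w p * cis (\<xi> \<bullet> (fst p - snd p)) \<partial>?P)"
    proof (intro Bochner_Integration.integral_cong refl)
      fix p :: "'a \<times> 'a"
      obtain x y where p: "p = (x, y)" by (cases p)
      have "cis (\<xi> \<bullet> (x - y)) = cis (\<xi> \<bullet> x) * cnj (cis (\<xi> \<bullet> y))" by (simp add: cis_cnj cis_mult inner_diff_right)
      then show "(case p of (x, y) \<Rightarrow> (u x * cis (\<xi> \<bullet> x)) * cnj (u y * cis (\<xi> \<bullet> y))) = w p * cis (\<xi> \<bullet> (fst p - snd p))"
        by (simp add: w_def p mult_ac)
    qed
    finally show ?thesis .
  qed
  define F where "F \<xi> p = of_real (gauss R \<xi>) * (w p * cis (c *\<^sub>R \<xi> \<bullet> (fst p - snd p)))" for \<xi> :: 'a and p :: "'a \<times> 'a"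
  have F_int: "integrable (lborel \<Otimes>\<^sub>M ?P) (case_prod F)"
  proof (rule Bochner_Integration.integrable_bound)
    show "integrable (lborel \<Otimes>\<^sub>M ?P) (\<lambda>(\<xi>, p). of_real (gauss R \<xi>) * w p)"
      using integrable_gauss[OF R] by (intro integrable_pair_mult w_int lborel.sigma_finite_measure_axioms lborel_pair.sigma_finite_measure_axioms) auto
    show "case_prod F \<in> borel_measurable (lborel \<Otimes>\<^sub>M ?P)" unfolding F_def by measurable
  qed (auto simp: F_def norm_mult)
  have bound_int: "integrable lborel (\<lambda>\<xi>. gauss R \<xi> * (cmod (fourier u (c *\<^sub>R \<xi>)))\<^sup>2)"
  proof (rule Bochner_Integration.integrable_bound)
    show "integrable lborel (\<lambda>\<xi>::'a. gauss R \<xi> * (\<integral>x. cmod (u x) \<partial>lborel)\<^sup>2)" by (intro integrable_mult_left integrable_gauss R)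
    show "AE \<xi>::'a in lborel. norm (gauss R \<xi> * (cmod (fourier u (c *\<^sub>R \<xi>)))\<^sup>2) \<le> norm (gauss R \<xi> * (\<integral>x. cmod (u x) \<partial>lborel)\<^sup>2)"
      using norm_fourier_le[OF u] by (auto simp: abs_mult intro!: mult_left_mono power_mono)
  qed measurable
  have "of_real (\<integral>\<xi>. gauss R \<xi> * (cmod (fourier u (c *\<^sub>R \<xi>)))\<^sup>2 \<partial>lborel) = (\<integral>\<xi>. \<integral>p. F \<xi> p \<partial>?P \<partial>lborel)"
    unfolding F_def by (simp only: integral_complex_of_real[symmetric] of_real_mult sq integral_mult_right_zero)
  also have "\<dots> = (\<integral>p. \<integral>\<xi>. F \<xi> p \<partial>lborel \<partial>?P)" by (rule Q.Fubini_integral[OF F_int, symmetric])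
  also have "\<dots> = (\<integral>p. w p * of_real (h R (fst p - snd p)) \<partial>?P)"
  proof (intro Bochner_Integration.integral_cong refl)
    fix p
    have "(\<integral>\<xi>. F \<xi> p \<partial>lborel) = (\<integral>\<xi>. w p * (of_real (gauss R \<xi>) * cis ((c *\<^sub>R (fst p - snd p)) \<bullet> \<xi>)) \<partial>lborel)"
      unfolding F_def by (intro Bochner_Integration.integral_cong refl) (simp add: mult_ac inner_commute)
    also have "\<dots> = w p * of_real (h R (fst p - snd p))"
      using integral_gauss_cis[OF R, of "c *\<^sub>R (fst p - snd p)"] by (simp add: h_def)
    finally show "(\<integral>\<xi>. F \<xi> p \<partial>lborel) = w p * of_real (h R (fst p - snd p))" .
  qed
  finally have eq: "of_real (\<integral>\<xi>. gauss R \<xi> * (cmod (fourier u (c *\<^sub>R \<xi>)))\<^sup>2 \<partial>lborel) = (\<integral>p. w p * of_real (h R (fst p - snd p)) \<partial>?P)" .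
  have h0: "h R z \<ge> 0" for z using R by (simp add: h_def gauss_pos less_imp_le)
  have [measurable]: "h R \<in> borel_measurable borel" unfolding h_def by measurable
  have h_int: "integrable ?P (\<lambda>p. w p * of_real (h R (fst p - snd p)))"
  proof (rule Bochner_Integration.integrable_bound)
    let ?K = "(sqrt (2 * pi) * R) ^ DIM('a)"
    show "integrable ?P (\<lambda>p. w p * of_real ?K)" by (intro integrable_mult_left w_int)
    have "h R z \<le> ?K" for z
      unfolding h_def using R by (intro mult_left_le gauss_le_1) auto
    then have "norm (w p * of_real (h R (fst p - snd p))) \<le> norm (w p * of_real ?K)" for p
      unfolding norm_mult norm_of_real using h0 R by (intro mult_left_mono) auto
    then show "AE p in ?P. norm (w p * of_real (h R (fst p - snd p))) \<le> norm (w p * of_real ?K)" by simp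
  qed measurable
  have "(\<integral>\<^sup>+\<xi>. ennreal (gauss R \<xi> * (cmod (fourier u (c *\<^sub>R \<xi>)))\<^sup>2) \<partial>lborel) = ennreal (\<integral>\<xi>. gauss R \<xi> * (cmod (fourier u (c *\<^sub>R \<xi>)))\<^sup>2 \<partial>lborel)"
    by (rule nn_integral_eq_integral[OF bound_int]) (simp add: gauss_pos less_imp_le)
  also have "(\<integral>\<xi>. gauss R \<xi> * (cmod (fourier u (c *\<^sub>R \<xi>)))\<^sup>2 \<partial>lborel) = cmod (of_real (\<integral>\<xi>. gauss R \<xi> * (cmod (fourier u (c *\<^sub>R \<xi>)))\<^sup>2 \<partial>lborel))"
    unfolding norm_of_real by (rule abs_of_nonneg[symmetric]) (auto intro!: Bochner_Integration.integral_nonneg simp: gauss_pos less_imp_le)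
  also have "\<dots> = cmod (\<integral>p. w p * of_real (h R (fst p - snd p)) \<partial>?P)" unfolding eq ..
  also have "ennreal (cmod (\<integral>p. w p * of_real (h R (fst p - snd p)) \<partial>?P)) \<le> (\<integral>\<^sup>+p. ennreal (cmod (w p * of_real (h R (fst p - snd p)))) \<partial>?P)"
    by (rule integral_norm_bound_ennreal[OF h_int])
  also have "\<dots> = (\<integral>\<^sup>+x. \<integral>\<^sup>+y. ennreal (cmod (u x)) * ennreal (cmod (u y)) * ennreal (h R (x - y)) \<partial>lborel \<partial>lborel)"
    by (subst lborel.nn_integral_fst[symmetric]) (auto simp: w_def norm_mult h0 ennreal_mult)
  also have "\<dots> \<le> (\<integral>\<^sup>+x. ennreal ((cmod (u x))\<^sup>2) \<partial>lborel) * (\<integral>\<^sup>+z. ennreal (h R z) \<partial>lborel)"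
    by (rule nn_integral_schur) auto
  \<comment> \<open>The height of the kernel grows like R^d and its width shrinks like 1/R in each
    direction, so its mass, and with it the bound, does not depend on R.\<close>
  also have "(\<integral>\<^sup>+z. ennreal (h R z) \<partial>lborel) = ennreal ((2 * pi / \<bar>c\<bar>) ^ DIM('a))"
  proof -
    have Rc: "1 / \<bar>R * c\<bar> > 0" using R c by simp
    have "(\<integral>\<^sup>+z. ennreal (h R z) \<partial>lborel) = ennreal ((sqrt (2 * pi) * R) ^ DIM('a)) * (\<integral>\<^sup>+z. ennreal (gauss (1 / \<bar>R * c\<bar>) (z :: 'a)) \<partial>lborel)"
      using R c unfolding h_def by (simp add: gauss_scale ennreal_mult gauss_pos less_imp_le nn_integral_cmult)
    also have "\<dots> = ennreal ((sqrt (2 * pi) * R) ^ DIM('a) * (sqrt (2 * pi) * (1 / \<bar>R * c\<bar>)) ^ DIM('a))"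
      using R by (simp only: nn_integral_gauss[OF Rc]) (simp flip: ennreal_mult)
    also have "(sqrt (2 * pi) * R) ^ DIM('a) * (sqrt (2 * pi) * (1 / \<bar>R * c\<bar>)) ^ DIM('a) = (2 * pi / \<bar>c\<bar>) ^ DIM('a)"
      using R by (simp add: abs_mult flip: power_mult_distrib)
    finally show ?thesis .
  qed
  finally show ?thesis by (simp add: mult.commute)
qed

text \<open>The Gaussian weight is removed by letting R tend to infinity in Fatou's lemma; the bound
  is uniform in R. For u outside L^2 the right side is infinite.\<close>

lemma plancherel_le:
  fixes u :: "'a::euclidean_space \<Rightarrow> complex"
  assumes u: "integrable lborel u" and c: "c \<noteq> 0"
  shows "(\<integral>\<^sup>+\<xi>. ennreal ((cmod (fourier u (c *\<^sub>R \<xi>)))\<^sup>2) \<partial>lborel)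
    \<le> ennreal ((2 * pi / \<bar>c\<bar>) ^ DIM('a)) * (\<integral>\<^sup>+x. ennreal ((cmod (u x))\<^sup>2) \<partial>lborel)"
proof -
  have [measurable]: "u \<in> borel_measurable borel" using u by auto
  have lim: "(\<lambda>n. ennreal (gauss (real (Suc n)) \<xi> * (cmod (fourier u (c *\<^sub>R \<xi>)))\<^sup>2)) \<longlonglongrightarrow> ennreal ((cmod (fourier u (c *\<^sub>R \<xi>)))\<^sup>2)" for \<xi> :: 'a
  proof -
    have "(\<lambda>n. norm \<xi> / real (Suc n)) \<longlonglongrightarrow> 0"
      by (rule LIMSEQ_Suc) (rule lim_const_over_n)
    then have "(\<lambda>n. exp (- (norm \<xi> / real (Suc n))\<^sup>2 / 2)) \<longlonglongrightarrow> exp (- 0\<^sup>2 / 2)"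
      by (intro tendsto_intros) auto
    then have "(\<lambda>n. gauss (real (Suc n)) \<xi> * (cmod (fourier u (c *\<^sub>R \<xi>)))\<^sup>2) \<longlonglongrightarrow> 1 * (cmod (fourier u (c *\<^sub>R \<xi>)))\<^sup>2"
      unfolding gauss_def by (intro tendsto_mult_right) simp
    then show ?thesis by (intro tendsto_ennrealI) simp
  qed
  have "(\<integral>\<^sup>+\<xi>. ennreal ((cmod (fourier u (c *\<^sub>R \<xi>)))\<^sup>2) \<partial>lborel) = (\<integral>\<^sup>+\<xi>. liminf (\<lambda>n. ennreal (gauss (real (Suc n)) \<xi> * (cmod (fourier u (c *\<^sub>R \<xi>)))\<^sup>2)) \<partial>lborel)"
    by (intro nn_integral_cong) (use lim_imp_Liminf[OF _ lim] in auto)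
  also have "\<dots> \<le> liminf (\<lambda>n. \<integral>\<^sup>+\<xi>. ennreal (gauss (real (Suc n)) \<xi> * (cmod (fourier u (c *\<^sub>R \<xi>)))\<^sup>2) \<partial>lborel)"
    by (rule nn_integral_liminf) measurable
  also have "\<dots> \<le> liminf (\<lambda>n. ennreal ((2 * pi / \<bar>c\<bar>) ^ DIM('a)) * (\<integral>\<^sup>+x. ennreal ((cmod (u x))\<^sup>2) \<partial>lborel))"
    by (intro Liminf_mono always_eventually allI plancherel_gauss u c) simp
  finally show ?thesis by (simp add: Liminf_const)
qed

section \<open>Fourier coefficients of squared distances\<close>

text \<open>Fourier coefficients of the distribution of the squared distance of two points drawn from the
  density g. Expanding the square turns them into a scaled Fourier transform paired with g.\<close>
definition quad_form :: "('a::euclidean_space \<Rightarrow> real) \<Rightarrow> int \<Rightarrow> complex" where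
  "quad_form g k = (\<integral>y. \<integral>x. of_real (g x * g y) * cis (2 * pi * of_int k * (norm (x - y))\<^sup>2) \<partial>lborel \<partial>lborel)"

lemma quad_form_inner:
  fixes g :: "'a::euclidean_space \<Rightarrow> real" and k :: int
  defines "e \<equiv> \<lambda>x::'a. cis (2 * pi * of_int k * (norm x)\<^sup>2)"
  shows "(\<integral>x. of_real (g x * g y) * cis (2 * pi * of_int k * (norm (x - y))\<^sup>2) \<partial>lborel)
    = of_real (g y) * e y * fourier (\<lambda>x. of_real (g x) * e x) ((- 4 * pi * of_int k) *\<^sub>R y)"
proof -
  have "cis (2 * pi * of_int k * (norm (x - y))\<^sup>2) = e x * e y * cis (((- 4 * pi * of_int k) *\<^sub>R y) \<bullet> x)" for x y :: 'a
  proof -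
    have "(norm (x - y))\<^sup>2 = (norm x)\<^sup>2 + (norm y)\<^sup>2 - 2 * (x \<bullet> y)"
      by (simp add: power2_norm_eq_inner inner_diff_left inner_diff_right inner_commute)
    then show ?thesis by (simp add: e_def cis_mult inner_commute) (simp add: algebra_simps)
  qed
  then have "(\<integral>x. of_real (g x * g y) * cis (2 * pi * of_int k * (norm (x - y))\<^sup>2) \<partial>lborel)
    = (\<integral>x. (of_real (g y) * e y) * ((of_real (g x) * e x) * cis (((- 4 * pi * of_int k) *\<^sub>R y) \<bullet> x)) \<partial>lborel)"
    by (intro Bochner_Integration.integral_cong refl) (simp only:, simp add: mult_ac)
  then show ?thesis by (simp only: fourier_def integral_mult_right_zero)
qed

text \<open>The quadratic phases have modulus one and leave the norms of g unchanged. What remains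
  is the pairing of g with a Fourier transform dilated by 4 pi k, whose L^2 norm is smaller than
  that of g by (2|k|)^(d/2).\<close>

lemma norm_quad_form_le:
  fixes g :: "'a::euclidean_space \<Rightarrow> real"
  assumes g: "integrable lborel g" "\<And>x. 0 \<le> g x" and g2: "integrable lborel (\<lambda>x. (g x)\<^sup>2)"
    and d: "DIM('a) \<ge> 4" and k: "k \<noteq> 0"
  shows "cmod (quad_form g k) \<le> (\<integral>x. (g x)\<^sup>2 \<partial>lborel) / (of_int k)\<^sup>2"
proof -
  let ?B = "\<integral>x. (g x)\<^sup>2 \<partial>lborel"
  define e where "e x = cis (2 * pi * of_int k * (norm x)\<^sup>2)" for x :: 'a
  define u where "u x = of_real (g x) * e x" for x :: 'a
  define c where "c = - 4 * pi * real_of_int k"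
  define l where "l = 1 / (real_of_int k)\<^sup>2"
  have [measurable]: "g \<in> borel_measurable borel" using g by auto
  have [measurable]: "e \<in> borel_measurable borel" unfolding e_def by measurable
  have [measurable]: "u \<in> borel_measurable borel" unfolding u_def by measurable
  have u: "integrable lborel u" unfolding u_def e_def using g by (intro integrable_mult_cis) auto
  have nu: "cmod (u x) = g x" for x using g(2)[of x] by (simp add: u_def e_def norm_mult)
  have c: "c \<noteq> 0" using k by (simp add: c_def)
  have k1: "1 \<le> \<bar>real_of_int k\<bar>" using k by linarith
  have l: "l > 0" using k by (simp add: l_def)
  have B: "(\<integral>\<^sup>+x. ennreal ((g x)\<^sup>2) \<partial>lborel) = ennreal ?B" by (rule nn_integral_eq_integral[OF g2]) simp
  have B0: "?B \<ge> 0" by simp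
  have F: "(\<integral>\<^sup>+y. ennreal ((cmod (fourier u (c *\<^sub>R y)))\<^sup>2) \<partial>lborel) \<le> ennreal (l\<^sup>2 * ?B)"
  proof -
    have "(2 * pi / \<bar>c\<bar>) ^ DIM('a) = (1 / (2 * \<bar>real_of_int k\<bar>)) ^ DIM('a)" by (simp add: c_def abs_mult)
    also have "\<dots> \<le> (1 / \<bar>real_of_int k\<bar>) ^ DIM('a)" using k1 by (intro power_mono frac_le) auto
    \<comment> \<open>The dimension enters here: exponent 4 for the squared norm means decay 1/k^2
      for the pairing, which is summable.\<close>
    also have "\<dots> \<le> (1 / \<bar>real_of_int k\<bar>) ^ 4" using k1 d by (intro power_decreasing) auto
    also have "\<dots> = l\<^sup>2" by (simp add: l_def power_divide flip: power_mult)
    finally have "(2 * pi / \<bar>c\<bar>) ^ DIM('a) \<le> l\<^sup>2" .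
    then have "ennreal ((2 * pi / \<bar>c\<bar>) ^ DIM('a)) * ennreal ?B \<le> ennreal (l\<^sup>2) * ennreal ?B"
      by (intro mult_right_mono ennreal_leI) auto
    then show ?thesis using plancherel_le[OF u c] B0 by (simp add: nu B ennreal_mult)
  qed
  have I: "quad_form g k = (\<integral>y. of_real (g y) * e y * fourier u (c *\<^sub>R y) \<partial>lborel)"
    unfolding quad_form_def quad_form_inner by (simp only: e_def u_def[abs_def] c_def)
  have "ennreal (cmod (quad_form g k)) \<le> (\<integral>\<^sup>+y. ennreal (g y * cmod (fourier u (c *\<^sub>R y))) \<partial>lborel)"
  proof -
    have "integrable lborel (\<lambda>y. of_real (g y) * e y * fourier u (c *\<^sub>R y))"
    proof (rule Bochner_Integration.integrable_bound)
      show "integrable lborel (\<lambda>y. g y * (\<integral>x. cmod (u x) \<partial>lborel))" using g by simp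
      show "AE y in lborel. norm (of_real (g y) * e y * fourier u (c *\<^sub>R y)) \<le> norm (g y * (\<integral>x. cmod (u x) \<partial>lborel))"
        using norm_fourier_le[OF u] g(2) by (auto simp: norm_mult e_def abs_mult intro!: mult_left_mono order_trans[OF norm_fourier_le[OF u]])
    qed measurable
    from integral_norm_bound_ennreal[OF this] show ?thesis
      unfolding I using g(2) by (simp add: norm_mult e_def)
  qed
  \<comment> \<open>Weighted arithmetic-geometric mean in place of Cauchy-Schwarz. The weight l =
    1/k^2 balances the two terms, as the transform has squared norm at most l^2 times that of
    g.\<close>
  also have "\<dots> \<le> (\<integral>\<^sup>+y. ennreal (l / 2) * ennreal ((g y)\<^sup>2) + ennreal (1 / (2 * l)) * ennreal ((cmod (fourier u (c *\<^sub>R y)))\<^sup>2) \<partial>lborel)"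
  proof (intro nn_integral_mono)
    fix y :: 'a
    let ?f = "cmod (fourier u (c *\<^sub>R y))"
    have "0 \<le> (l * g y - ?f)\<^sup>2 / (2 * l)" using l by simp
    also have "\<dots> = l / 2 * (g y)\<^sup>2 + 1 / (2 * l) * ?f\<^sup>2 - g y * ?f"
      using l by (simp add: power2_eq_square field_simps)
    finally have "g y * ?f \<le> l / 2 * (g y)\<^sup>2 + 1 / (2 * l) * ?f\<^sup>2" by simp
    then show "ennreal (g y * ?f) \<le> ennreal (l / 2) * ennreal ((g y)\<^sup>2) + ennreal (1 / (2 * l)) * ennreal (?f\<^sup>2)"
      using l by (simp flip: ennreal_mult ennreal_plus)
  qed
  also have "\<dots> = ennreal (l / 2) * ennreal ?B + ennreal (1 / (2 * l)) * (\<integral>\<^sup>+y. ennreal ((cmod (fourier u (c *\<^sub>R y)))\<^sup>2) \<partial>lborel)"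
    by (simp add: nn_integral_add nn_integral_cmult B)
  also have "\<dots> \<le> ennreal (l / 2) * ennreal ?B + ennreal (1 / (2 * l)) * ennreal (l\<^sup>2 * ?B)"
    by (intro add_left_mono mult_left_mono F) auto
  also have "\<dots> = ennreal (l / 2 * ?B + 1 / (2 * l) * (l\<^sup>2 * ?B))"
    using l B0 by (simp flip: ennreal_mult ennreal_plus)
  also have "l / 2 * ?B + 1 / (2 * l) * (l\<^sup>2 * ?B) = ?B / (of_int k)\<^sup>2"
    using l by (simp add: power2_eq_square field_simps) (simp add: l_def power2_eq_square)
  finally show ?thesis using B0 by (simp add: ennreal_le_iff)
qed

lemma quad_form_0:
  fixes g :: "'a::euclidean_space \<Rightarrow> real"
  shows "quad_form g 0 = of_real ((\<integral>x. g x \<partial>lborel)\<^sup>2)"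
  unfolding quad_form_def by (simp add: power2_eq_square)

section \<open>The Fejer kernel as approximate Dirac comb\<close>

text \<open>Written as a squared modulus, which makes nonnegativity immediate; the usual form with
  weights 1 - |k|/N appears on expanding the square, with each k occurring N - |k| times.\<close>

definition fejer :: "nat \<Rightarrow> real \<Rightarrow> real" where
  "fejer N t = (cmod (\<Sum>j<N. cis (2 * pi * real j * t)))\<^sup>2 / real N"

lemma fejer_nonneg: "0 \<le> fejer N t" by (simp add: fejer_def)

lemma fejer_le:
  assumes "N > 0" shows "fejer N t \<le> real N"
proof -
  have "cmod (\<Sum>j<N. cis (2 * pi * real j * t)) \<le> (\<Sum>j<N. cmod (cis (2 * pi * real j * t)))" by (rule norm_sum)
  then have "(cmod (\<Sum>j<N. cis (2 * pi * real j * t)))\<^sup>2 \<le> (real N)\<^sup>2" by (intro power_mono) auto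
  then show ?thesis using assms by (simp add: fejer_def field_simps power2_eq_square)
qed

text \<open>For j < N the phases 2 pi j \<open>frac t\<close> stay below pi/3, where the cosine is
  at least 1/2; this is the reason for the 6. The window is one-sided because the annuli start at an
  integer.\<close>

lemma fejer_ge:
  assumes N: "N > 0" and t: "frac t < 1 / (6 * real N)"
  shows "real N / 4 \<le> fejer N t"
proof -
  have "1 / 2 \<le> Re (cis (2 * pi * real j * t))" if j: "j < N" for j
  proof -
    have "cis (2 * pi * real j * t) = cis (2 * pi * real j * frac t)"
      using cis_mult_int[of "int j" "\<lfloor>t\<rfloor>" "frac t"] by (simp add: frac_def)
    moreover have "real j * frac t \<le> real N * (1 / (6 * real N))"
      using j t by (intro mult_mono) auto
    then have "real j * frac t \<le> 1 / 6" using N by simp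
    then have "2 * pi * real j * frac t \<le> pi / 3" using mult_left_mono[of "real j * frac t" "1/6" "2 * pi"] by (simp add: mult_ac)
    then have "cos (pi / 3) \<le> cos (2 * pi * real j * frac t)" by (intro cos_monotone_0_pi_le) auto
    ultimately show ?thesis by (simp add: cos_60)
  qed
  then have "(\<Sum>j<N. 1 / 2) \<le> (\<Sum>j<N. Re (cis (2 * pi * real j * t)))" by (intro sum_mono) auto
  then have "real N / 2 \<le> Re (\<Sum>j<N. cis (2 * pi * real j * t))" by simp
  also have "\<dots> \<le> cmod (\<Sum>j<N. cis (2 * pi * real j * t))" by (rule complex_Re_le_cmod)
  finally have "(real N / 2)\<^sup>2 \<le> (cmod (\<Sum>j<N. cis (2 * pi * real j * t)))\<^sup>2" by (intro power_mono) auto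
  then show ?thesis using N by (simp add: fejer_def field_simps power2_eq_square)
qed

lemma fejer_expand:
  "of_real (fejer N t) = (\<Sum>j<N. \<Sum>l<N. cis (2 * pi * of_int (int j - int l) * t)) / of_nat N"
proof -
  have "of_real ((cmod (\<Sum>j<N. cis (2 * pi * real j * t)))\<^sup>2) = (\<Sum>j<N. cis (2 * pi * real j * t)) * (\<Sum>l<N. cnj (cis (2 * pi * real l * t)))"
    by (simp only: complex_norm_square cnj_sum)
  also have "\<dots> = (\<Sum>j<N. \<Sum>l<N. cis (2 * pi * of_int (int j - int l) * t))"
    by (simp add: sum_product cis_cnj cis_mult algebra_simps)
  finally show ?thesis by (simp add: fejer_def)
qed

lemma borel_measurable_fejer [measurable]: "fejer N \<in> borel_measurable borel"
  unfolding fejer_def by measurable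

text \<open>Expanding the kernel gives the average over j of the row sums of
  \<open>quad_form g (int j - int l)\<close>. Within a row the differences are distinct, so a row
  costs the constant term once plus a convergent series, uniformly in N.\<close>

lemma nn_integral_fejer_le:
  fixes g :: "'a::euclidean_space \<Rightarrow> real"
  assumes g: "integrable lborel g" "\<And>x. 0 \<le> g x" and g2: "integrable lborel (\<lambda>x. (g x)\<^sup>2)"
    and d: "DIM('a) \<ge> 4" and N: "N > 0"
  shows "(\<integral>\<^sup>+y. \<integral>\<^sup>+x. ennreal (g x * g y * fejer N ((norm (x - y))\<^sup>2)) \<partial>lborel \<partial>lborel)
    \<le> ennreal ((\<integral>x. g x \<partial>lborel)\<^sup>2 + 10 * (\<integral>x. (g x)\<^sup>2 \<partial>lborel))"
proof -
  let ?A = "\<integral>x. g x \<partial>lborel" and ?B = "\<integral>x. (g x)\<^sup>2 \<partial>lborel"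
  have [measurable]: "g \<in> borel_measurable borel" using g by auto
  have AB: "?A \<ge> 0" "?B \<ge> 0" using g by auto
  let ?c = "\<lambda>j l x y. of_real (g x * g y) * cis (2 * pi * of_int (int j - int l) * (norm (x - y))\<^sup>2)"
  let ?K = "\<lambda>x y. g x * g y * fejer N ((norm (x - y))\<^sup>2)"
  have K0: "0 \<le> ?K x y" for x y using g fejer_nonneg by (intro mult_nonneg_nonneg) auto
  have c1: "integrable lborel (\<lambda>x. ?c j l x y)" for j l y
    using g by (intro integrable_mult_cis) auto
  have c1': "cmod (\<integral>x. ?c j l x y \<partial>lborel) \<le> g y * ?A" for j l y
    by (rule order_trans[OF integral_norm_bound]) (use g(2) in \<open>simp add: norm_mult abs_mult mult.commute\<close>)
  have c2: "integrable lborel (\<lambda>y. \<integral>x. ?c j l x y \<partial>lborel)" for j l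
  proof (rule Bochner_Integration.integrable_bound)
    show "integrable lborel (\<lambda>y. g y * ?A)" using g by simp
    show "AE y in lborel. norm (\<integral>x. ?c j l x y \<partial>lborel) \<le> norm (g y * ?A)"
      using c1' g(2) AB by (auto simp: abs_mult)
  qed measurable
  have k1: "integrable lborel (\<lambda>x. ?K x y)" for y
  proof (rule Bochner_Integration.integrable_bound)
    show "integrable lborel (\<lambda>x. g x * g y * real N)" using g by simp
    show "AE x in lborel. norm (?K x y) \<le> norm (g x * g y * real N)"
      using g(2) fejer_le[OF N] fejer_nonneg by (auto simp: abs_mult intro!: mult_left_mono)
  qed measurable
  have k2: "integrable lborel (\<lambda>y. \<integral>x. ?K x y \<partial>lborel)"
  proof (rule Bochner_Integration.integrable_bound)
    show "integrable lborel (\<lambda>y. g y * (real N * ?A))" using g by simp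
    have "(\<integral>x. ?K x y \<partial>lborel) \<le> (\<integral>x. g y * real N * g x \<partial>lborel)" for y
    proof (intro integral_mono k1)
      fix x
      have "g x * g y * fejer N ((norm (x - y))\<^sup>2) \<le> g x * g y * real N"
        using fejer_le[OF N] g(2) by (intro mult_left_mono) auto
      then show "?K x y \<le> g y * real N * g x" by (simp add: mult_ac)
    qed (use g in simp)
    then have up: "(\<integral>x. ?K x y \<partial>lborel) \<le> g y * (real N * ?A)" for y
      by (simp only: integral_mult_right_zero mult.assoc)
    have lo: "0 \<le> (\<integral>x. ?K x y \<partial>lborel)" for y using K0 by (intro Bochner_Integration.integral_nonneg) auto
    have "norm (\<integral>x. ?K x y \<partial>lborel) \<le> norm (g y * (real N * ?A))" for y
      unfolding real_norm_def abs_of_nonneg[OF lo] by (rule order_trans[OF up abs_ge_self])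
    then show "AE y in lborel. norm (\<integral>x. ?K x y \<partial>lborel) \<le> norm (g y * (real N * ?A))" by simp
  qed measurable
  have "complex_of_real (\<integral>y. \<integral>x. ?K x y \<partial>lborel \<partial>lborel) = (\<integral>y. \<integral>x. of_real (?K x y) \<partial>lborel \<partial>lborel)"
    by (simp only: integral_complex_of_real)
  also have "\<dots> = (\<integral>y. \<integral>x. (\<Sum>j<N. \<Sum>l<N. ?c j l x y) / of_nat N \<partial>lborel \<partial>lborel)"
    by (simp only: of_real_mult[of _ "fejer N _"] fejer_expand sum_distrib_left times_divide_eq_right)
  also have "\<dots> = (\<Sum>j<N. \<Sum>l<N. quad_form g (int j - int l)) / of_nat N"
    unfolding quad_form_def
    by (simp only: integral_divide_zero Bochner_Integration.integral_sum Bochner_Integration.integrable_sum c1 c2)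
  finally have eq: "complex_of_real (\<integral>y. \<integral>x. ?K x y \<partial>lborel \<partial>lborel) = (\<Sum>j<N. \<Sum>l<N. quad_form g (int j - int l)) / of_nat N" .
  have row: "(\<Sum>l<N. cmod (quad_form g (int j - int l))) \<le> ?A\<^sup>2 + 10 * ?B" if j: "j < N" for j
  proof -
    \<comment> \<open>A nonnegative majorant on all integers allows a row to be enlarged to the
      symmetric range. It uses 1/k^2 <= 2/(1 + k^2) for nonzero k; with the sum bound 5 this gives
      the factor 10.\<close>
    define b where "b k = (if k = 0 then ?A\<^sup>2 else 0) + 2 * ?B * (1 / (1 + (real_of_int k)\<^sup>2))" for k
    have "cmod (quad_form g k) \<le> b k" for k
    proof (cases "k = 0")
      case True
      have "cmod (quad_form g k) = ?A\<^sup>2" unfolding True quad_form_0 norm_of_real by simp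
      then show ?thesis using AB True by (simp add: b_def)
    next
      case False
      have k1: "1 \<le> (real_of_int k)\<^sup>2" using False by (simp flip: of_int_power) (metis int_one_le_iff_zero_less zero_less_power2)
      have "1 / K \<le> 2 * (1 / (1 + K))" if "1 \<le> K" for K :: real using that by (simp add: divide_simps)
      from this[OF k1] have "1 / (real_of_int k)\<^sup>2 \<le> 2 * (1 / (1 + (real_of_int k)\<^sup>2))" .
      then have "?B * (1 / (real_of_int k)\<^sup>2) \<le> ?B * (2 * (1 / (1 + (real_of_int k)\<^sup>2)))"
        using AB by (intro mult_left_mono) auto
      then show ?thesis using norm_quad_form_le[OF g g2 d False] False by (simp add: b_def mult.commute)
    qed
    moreover have b0: "0 \<le> b k" for k using AB by (simp add: b_def)
    ultimately have "(\<Sum>l<N. cmod (quad_form g (int j - int l))) \<le> (\<Sum>l<N. b (int j - int l))" by (intro sum_mono) auto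
    also have "\<dots> = (\<Sum>k\<in>(\<lambda>l. int j - int l) ` {..<N}. b k)" by (subst sum.reindex) (auto simp: inj_on_def)
    also have "\<dots> \<le> (\<Sum>k\<in>{-int N..int N}. b k)" using j b0 by (intro sum_mono2) auto
    also have "\<dots> = ?A\<^sup>2 + 2 * ?B * (\<Sum>k\<in>{-int N..int N}. 1 / (1 + (real_of_int k)\<^sup>2))"
      by (simp add: b_def sum.distrib sum_distrib_left)
    also have "\<dots> \<le> ?A\<^sup>2 + 2 * ?B * 5"
      using AB by (intro add_left_mono mult_left_mono sum_inverse_square_plus_one_le) auto
    finally show ?thesis by simp
  qed
  have "(\<integral>y. \<integral>x. ?K x y \<partial>lborel \<partial>lborel) \<le> cmod (complex_of_real (\<integral>y. \<integral>x. ?K x y \<partial>lborel \<partial>lborel))" by simp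
  also have "\<dots> \<le> (\<Sum>j<N. \<Sum>l<N. cmod (quad_form g (int j - int l))) / real N"
    unfolding eq norm_divide norm_of_nat by (intro divide_right_mono order_trans[OF norm_sum] sum_mono norm_sum) auto
  also have "\<dots> \<le> (\<Sum>j<N. ?A\<^sup>2 + 10 * ?B) / real N" by (intro divide_right_mono sum_mono row) auto
  also have "\<dots> = ?A\<^sup>2 + 10 * ?B" using N by simp
  finally have main: "(\<integral>y. \<integral>x. ?K x y \<partial>lborel \<partial>lborel) \<le> ?A\<^sup>2 + 10 * ?B" .
  have "(\<integral>\<^sup>+y. \<integral>\<^sup>+x. ennreal (?K x y) \<partial>lborel \<partial>lborel) = (\<integral>\<^sup>+y. ennreal (\<integral>x. ?K x y \<partial>lborel) \<partial>lborel)"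
    by (intro nn_integral_cong nn_integral_eq_integral k1) (use K0 in auto)
  also have "\<dots> = ennreal (\<integral>y. \<integral>x. ?K x y \<partial>lborel \<partial>lborel)"
    by (intro nn_integral_eq_integral k2) (use K0 in auto)
  also have "\<dots> \<le> ennreal (?A\<^sup>2 + 10 * ?B)" by (rule ennreal_leI[OF main])
  finally show ?thesis .
qed

text \<open>On the window the kernel is at least N/4. The bound is proportional to the window length
  1/(6N), so after division by that length it stays bounded as N grows.\<close>

lemma nn_integral_frac_le:
  fixes g :: "'a::euclidean_space \<Rightarrow> real"
  assumes g: "integrable lborel g" "\<And>x. 0 \<le> g x" and g2: "integrable lborel (\<lambda>x. (g x)\<^sup>2)"
    and d: "DIM('a) \<ge> 4" and N: "N > 0"
  shows "(\<integral>\<^sup>+y. \<integral>\<^sup>+x. ennreal (g x * g y) * indicator {t. frac t < 1 / (6 * real N)} ((norm (x - y))\<^sup>2) \<partial>lborel \<partial>lborel)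
    \<le> ennreal (4 / real N * ((\<integral>x. g x \<partial>lborel)\<^sup>2 + 10 * (\<integral>x. (g x)\<^sup>2 \<partial>lborel)))"
proof -
  have [measurable]: "g \<in> borel_measurable borel" using g by auto
  have "(\<integral>\<^sup>+y. \<integral>\<^sup>+x. ennreal (g x * g y) * indicator {t. frac t < 1 / (6 * real N)} ((norm (x - y))\<^sup>2) \<partial>lborel \<partial>lborel)
    \<le> (\<integral>\<^sup>+y. \<integral>\<^sup>+x. ennreal (4 / real N) * ennreal (g x * g y * fejer N ((norm (x - y))\<^sup>2)) \<partial>lborel \<partial>lborel)"
  proof (intro nn_integral_mono)
    fix x y :: 'a
    let ?t = "(norm (x - y))\<^sup>2"
    show "ennreal (g x * g y) * indicator {t. frac t < 1 / (6 * real N)} ?t \<le> ennreal (4 / real N) * ennreal (g x * g y * fejer N ?t)"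
    proof (cases "frac ?t < 1 / (6 * real N)")
      case True
      have "g x * g y * 1 \<le> g x * g y * (4 / real N * fejer N ?t)"
        using fejer_ge[OF N True] g N by (intro mult_left_mono) (auto simp: field_simps)
      then show ?thesis using True g N fejer_nonneg[of N ?t]
        by (simp add: mult_ac flip: ennreal_mult)
    qed simp
  qed
  also have "\<dots> = ennreal (4 / real N) * (\<integral>\<^sup>+y. \<integral>\<^sup>+x. ennreal (g x * g y * fejer N ((norm (x - y))\<^sup>2)) \<partial>lborel \<partial>lborel)"
    by (simp add: nn_integral_cmult)
  also have "\<dots> \<le> ennreal (4 / real N) * ennreal ((\<integral>x. g x \<partial>lborel)\<^sup>2 + 10 * (\<integral>x. (g x)\<^sup>2 \<partial>lborel))"
    by (intro mult_left_mono nn_integral_fejer_le assms) auto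
  also have "\<dots> = ennreal (4 / real N * ((\<integral>x. g x \<partial>lborel)\<^sup>2 + 10 * (\<integral>x. (g x)\<^sup>2 \<partial>lborel)))"
    by (rule ennreal_mult[symmetric]) auto
  finally show ?thesis .
qed

section \<open>Averaging over rotations\<close>

declare transpose_matrix_vector [simp del]

section \<open>Rotations and Haar measure\<close>

lemma SO_mult: "\<rho> \<in> SO_group \<Longrightarrow> \<sigma> \<in> SO_group \<Longrightarrow> \<rho> ** \<sigma> \<in> SO_group"
  by (simp add: SO_group_def rotation_matrix_def orthogonal_matrix_mul det_mul)

lemma SO_transpose: "\<rho> \<in> SO_group \<Longrightarrow> transpose \<rho> \<in> SO_group"
  by (simp add: SO_group_def rotation_matrix_def)

lemma SO_norm: "\<rho> \<in> SO_group \<Longrightarrow> norm (\<rho> *v x) = norm x"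
proof -
  assume "\<rho> \<in> SO_group"
  then have "orthogonal_transformation ((*v) \<rho>)"
    by (simp add: SO_group_def rotation_matrix_def orthogonal_transformation_matrix)
  then show ?thesis by (rule orthogonal_transformation_norm)
qed

lemma SO_transpose_mult: "\<rho> \<in> SO_group \<Longrightarrow> transpose \<rho> ** \<rho> = mat 1" "\<rho> \<in> SO_group \<Longrightarrow> \<rho> ** transpose \<rho> = mat 1"
  by (simp_all add: SO_group_def rotation_matrix_def orthogonal_matrix_def)

lemma borel_measurable_matrix_vector_mult [measurable (raw)]:
  fixes f :: "'a \<Rightarrow> real^'n^'n" and g :: "'a \<Rightarrow> real^'n"
  assumes "f \<in> borel_measurable M" "g \<in> borel_measurable M"
  shows "(\<lambda>x. f x *v g x) \<in> borel_measurable M"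
  by (rule borel_measurable_continuous_Pair[OF assms])
    (auto simp: matrix_vector_mult_def intro!: continuous_intros)

lemma borel_measurable_matrix_matrix_mult [measurable (raw)]:
  fixes f g :: "'a \<Rightarrow> real^'n^'n"
  assumes "f \<in> borel_measurable M" "g \<in> borel_measurable M"
  shows "(\<lambda>x. f x ** g x) \<in> borel_measurable M"
  by (rule borel_measurable_continuous_Pair[OF assms])
    (auto simp: matrix_matrix_mult_def intro!: continuous_intros)

lemma borel_measurable_transpose [measurable (raw)]:
  fixes f :: "'a \<Rightarrow> real^'n^'n"
  assumes "f \<in> borel_measurable M"
  shows "(\<lambda>x. transpose (f x)) \<in> borel_measurable M"
  by (rule borel_measurable_continuous_on[OF _ assms])
    (auto simp: transpose_def intro!: continuous_intros)

context
  fixes H :: "(real^'n^'n) measure"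
  assumes haar: "is_haar_SO H"
begin

lemma prob_space_haar: "prob_space H" using haar by (simp add: is_haar_SO_def)

lemma sets_haar: "sets H = sets (restrict_space borel SO_group)" using haar by (simp add: is_haar_SO_def)

lemma space_haar: "space H = SO_group"
  using sets_eq_imp_space_eq[OF sets_haar] by (simp add: space_restrict_space)

lemma measurable_haar: "(\<lambda>\<rho>. \<rho>) \<in> borel_measurable H"
  unfolding measurable_cong_sets[OF sets_haar refl] by (rule measurable_restrict_space1) simp

lemma borel_measurable_haar: "f \<in> borel_measurable borel \<Longrightarrow> f \<in> borel_measurable H"
  by (rule measurable_compose[OF measurable_haar])

lemma sigma_finite_haar: "sigma_finite_measure H"
  by (rule prob_space_imp_sigma_finite[OF prob_space_haar])

lemma nn_integral_haar_const: "(\<integral>\<^sup>+\<rho>. c \<partial>H) = c"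
  using prob_space.emeasure_space_1[OF prob_space_haar] by simp

lemma nn_integral_haar_left:
  assumes f[measurable]: "f \<in> borel_measurable borel" and \<sigma>: "\<sigma> \<in> SO_group"
  shows "(\<integral>\<^sup>+\<rho>. f (\<sigma> ** \<rho>) \<partial>H) = (\<integral>\<^sup>+\<rho>. f \<rho> \<partial>H)"
proof -
  note measurable_haar[measurable]
  have "(\<lambda>\<rho>. \<sigma> ** \<rho>) \<in> measurable H (restrict_space borel SO_group)"
    by (rule measurable_restrict_space2) (auto simp: space_haar SO_mult \<sigma>)
  then have m: "(\<lambda>\<rho>. \<sigma> ** \<rho>) \<in> measurable H H" by (simp add: measurable_cong_sets[OF refl sets_haar])
  have "(\<integral>\<^sup>+\<rho>. f \<rho> \<partial>H) = (\<integral>\<^sup>+\<rho>. f \<rho> \<partial>distr H H (\<lambda>\<rho>. \<sigma> ** \<rho>))"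
    using haar \<sigma> by (simp add: is_haar_SO_def)
  also have "\<dots> = (\<integral>\<^sup>+\<rho>. f (\<sigma> ** \<rho>) \<partial>H)"
    by (rule nn_integral_distr[OF m]) (simp add: borel_measurable_haar f)
  finally show ?thesis by simp
qed

text \<open>Integrate f (transpose \<tau> ** \<sigma>) over \<tau> and \<sigma> in both orders.\<close>
lemma nn_integral_haar_transpose:
  assumes f[measurable]: "f \<in> borel_measurable borel"
  shows "(\<integral>\<^sup>+\<rho>. f (transpose \<rho>) \<partial>H) = (\<integral>\<^sup>+\<rho>. f \<rho> \<partial>H)"
proof -
  note measurable_haar[measurable]
  interpret H: sigma_finite_measure H by (rule sigma_finite_haar)
  interpret HH: pair_sigma_finite H H ..
  have "(\<integral>\<^sup>+\<rho>. f \<rho> \<partial>H) = (\<integral>\<^sup>+\<tau>. \<integral>\<^sup>+\<rho>. f \<rho> \<partial>H \<partial>H)" by (simp only: nn_integral_haar_const)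
  also have "\<dots> = (\<integral>\<^sup>+\<tau>. \<integral>\<^sup>+\<sigma>. f (transpose \<tau> ** \<sigma>) \<partial>H \<partial>H)"
    by (intro nn_integral_cong nn_integral_haar_left[symmetric]) (auto simp: space_haar SO_transpose)
  also have "\<dots> = (\<integral>\<^sup>+\<sigma>. \<integral>\<^sup>+\<tau>. f (transpose \<tau> ** \<sigma>) \<partial>H \<partial>H)"
    by (rule HH.Fubini'[symmetric]) measurable
  also have "\<dots> = (\<integral>\<^sup>+\<sigma>. \<integral>\<^sup>+\<tau>. f (transpose (transpose \<sigma> ** \<tau>)) \<partial>H \<partial>H)"
    by (simp add: matrix_transpose_mul)
  also have "\<dots> = (\<integral>\<^sup>+\<sigma>. \<integral>\<^sup>+\<tau>. f (transpose \<tau>) \<partial>H \<partial>H)"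
    by (intro nn_integral_cong nn_integral_haar_left[of "\<lambda>\<rho>. f (transpose \<rho>)"]) (auto simp: space_haar SO_transpose)
  also have "\<dots> = (\<integral>\<^sup>+\<tau>. f (transpose \<tau>) \<partial>H)" by (simp only: nn_integral_haar_const)
  finally show ?thesis ..
qed

text \<open>In dimension at least two some rotation sigma takes z to z'. With the transpose on
  \<open>\<rho>\<close>, applying sigma to z amounts to multiplying \<open>\<rho>\<close> from the
  left by the transpose of sigma, which is the side on which invariance is given.\<close>

lemma nn_integral_haar_radial:
  fixes f :: "real^'n \<Rightarrow> ennreal"
  assumes f[measurable]: "f \<in> borel_measurable borel" and n: "CARD('n) \<ge> 2" and eq: "norm z = norm z'"
  shows "(\<integral>\<^sup>+\<rho>. f (transpose \<rho> *v z) \<partial>H) = (\<integral>\<^sup>+\<rho>. f (transpose \<rho> *v z') \<partial>H)"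
proof -
  obtain T where T: "orthogonal_transformation T" "det (matrix T) = 1" "T z = z'"
    using rotation_exists[OF n eq] by metis
  define \<sigma> where "\<sigma> = matrix T"
  have lin: "linear T" using T by (simp add: orthogonal_transformation_def)
  have \<sigma>: "\<sigma> \<in> SO_group" using T by (simp add: \<sigma>_def SO_group_def rotation_matrix_def orthogonal_transformation_matrix)
  have z': "z' = \<sigma> *v z" using T lin by (simp add: \<sigma>_def matrix_works)
  have "(\<integral>\<^sup>+\<rho>. f (transpose \<rho> *v z') \<partial>H) = (\<integral>\<^sup>+\<rho>. f (transpose (transpose \<sigma> ** \<rho>) *v z) \<partial>H)"
    by (simp add: z' matrix_transpose_mul matrix_vector_mul_assoc)
  also have "\<dots> = (\<integral>\<^sup>+\<rho>. f (transpose \<rho> *v z) \<partial>H)"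
    by (rule nn_integral_haar_left[of "\<lambda>\<rho>. f (transpose \<rho> *v z)"]) (use \<sigma> SO_transpose in auto)
  finally show ?thesis ..
qed

end

text \<open>Testing against a Gaussian, which is radial, identifies the constant in the uniqueness of
  translation invariant measures.\<close>
lemma nn_integral_lborel_rotation:
  fixes f :: "real^'n \<Rightarrow> ennreal"
  assumes [measurable]: "f \<in> borel_measurable borel" and \<rho>: "\<rho> \<in> SO_group"
  shows "(\<integral>\<^sup>+x. f (\<rho> *v x) \<partial>lborel) = (\<integral>\<^sup>+x. f x \<partial>lborel)"
proof -
  define w where "w x = ennreal (gauss 1 x)" for x :: "real^'n"
  define W where "W = (\<integral>\<^sup>+x. w x \<partial>lborel)"
  have [measurable]: "w \<in> borel_measurable borel" unfolding w_def by measurable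
  have W: "W \<noteq> 0" "W \<noteq> \<infinity>" unfolding W_def w_def by (subst nn_integral_gauss; simp)+
  have wr: "w (\<rho> *v x) = w x" for x using SO_norm[OF \<rho>] by (simp add: w_def gauss_def)
  have wn: "w (- x) = w x" for x by (simp add: w_def gauss_def)
  have wint: "(\<integral>\<^sup>+x. w (y + - (\<rho> *v x)) \<partial>lborel) = W" for y
  proof -
    have "w (y + - (\<rho> *v x)) = w (- (transpose \<rho> *v y) + x)" for x
    proof -
      have "y + - (\<rho> *v x) = - (\<rho> *v (- (transpose \<rho> *v y) + x))"
        using SO_transpose_mult[OF \<rho>] by (simp add: matrix_vector_mult_diff_distrib matrix_vector_mul_assoc)
      then show ?thesis by (simp only: wn wr)
    qed
    then show ?thesis unfolding W_def by (simp only:) (rule nn_integral_lborel_translate, measurable)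
  qed
  have "(\<integral>\<^sup>+x. f (\<rho> *v x) \<partial>lborel) * W = (\<integral>\<^sup>+y. w y * (\<integral>\<^sup>+x. f (\<rho> *v x) \<partial>lborel) \<partial>lborel)"
    by (simp add: W_def nn_integral_multc mult.commute)
  also have "\<dots> = (\<integral>\<^sup>+y. w y * (\<integral>\<^sup>+x. f (\<rho> *v x + y) \<partial>lborel) \<partial>lborel)"
  proof (intro nn_integral_cong)
    fix y
    have "(\<integral>\<^sup>+x. f (\<rho> *v (transpose \<rho> *v y + x)) \<partial>lborel) = (\<integral>\<^sup>+x. f (\<rho> *v x) \<partial>lborel)"
      by (rule nn_integral_lborel_translate[of "\<lambda>x. f (\<rho> *v x)"]) measurable
    then show "w y * (\<integral>\<^sup>+x. f (\<rho> *v x) \<partial>lborel) = w y * (\<integral>\<^sup>+x. f (\<rho> *v x + y) \<partial>lborel)"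
      using SO_transpose_mult[OF \<rho>] by (simp add: matrix_vector_right_distrib matrix_vector_mul_assoc add.commute)
  qed
  also have "\<dots> = (\<integral>\<^sup>+y. \<integral>\<^sup>+x. w y * f (\<rho> *v x + y) \<partial>lborel \<partial>lborel)" by (simp add: nn_integral_cmult)
  also have "\<dots> = (\<integral>\<^sup>+x. \<integral>\<^sup>+y. w y * f (\<rho> *v x + y) \<partial>lborel \<partial>lborel)" by (rule lborel_pair.Fubini') measurable
  also have "\<dots> = (\<integral>\<^sup>+x. \<integral>\<^sup>+y. w (y + - (\<rho> *v x)) * f y \<partial>lborel \<partial>lborel)"
  proof (rule nn_integral_cong)
    fix x
    have "(\<integral>\<^sup>+y. w ((\<rho> *v x + y) + - (\<rho> *v x)) * f (\<rho> *v x + y) \<partial>lborel) = (\<integral>\<^sup>+y. w (y + - (\<rho> *v x)) * f y \<partial>lborel)"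
      by (rule nn_integral_lborel_translate[of "\<lambda>y. w (y + - (\<rho> *v x)) * f y"]) measurable
    then show "(\<integral>\<^sup>+y. w y * f (\<rho> *v x + y) \<partial>lborel) = (\<integral>\<^sup>+y. w (y + - (\<rho> *v x)) * f y \<partial>lborel)" by simp
  qed
  also have "\<dots> = (\<integral>\<^sup>+y. \<integral>\<^sup>+x. w (y + - (\<rho> *v x)) * f y \<partial>lborel \<partial>lborel)" by (rule lborel_pair.Fubini') measurable
  also have "\<dots> = (\<integral>\<^sup>+y. f y \<partial>lborel) * W"
  proof -
    have "(\<integral>\<^sup>+x. w (y + - (\<rho> *v x)) * f y \<partial>lborel) = W * f y" for y
      unfolding wint[of y, symmetric] by (rule nn_integral_multc) measurable
    then show ?thesis by (simp add: nn_integral_cmult mult.commute)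
  qed
  finally have "(\<integral>\<^sup>+x. f (\<rho> *v x) \<partial>lborel) * W / W = (\<integral>\<^sup>+y. f y \<partial>lborel) * W / W" by (rule arg_cong)
  then show ?thesis using W by (simp add: ennreal_mult_divide_eq less_top)
qed

section \<open>Lower semicontinuity and autocorrelations\<close>

definition lsc :: "('a::topological_space \<Rightarrow> ennreal) \<Rightarrow> bool" where
  "lsc g \<longleftrightarrow> (\<forall>c. open {x. c < g x})"

lemma lsc_liminf:
  assumes "lsc g" "(X \<longlongrightarrow> x) F"
  shows "g x \<le> Liminf F (\<lambda>k. g (X k))"
  unfolding le_Liminf_iff
proof safe
  fix y assume "y < g x"
  then show "\<forall>\<^sub>F k in F. y < g (X k)"
    using topological_tendstoD[OF assms(2), of "{x. y < g x}"] assms(1) by (simp add: lsc_def)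
qed

lemma borel_measurable_lsc:
  assumes "lsc g" shows "g \<in> borel_measurable borel"
  by (rule borel_measurableI_greater) (use assms in \<open>simp add: lsc_def borel_open\<close>)

definition acorr :: "('a::euclidean_space \<Rightarrow> ennreal) \<Rightarrow> 'a \<Rightarrow> ennreal" where
  "acorr g z = (\<integral>\<^sup>+y. g y * g (y - z) \<partial>lborel)"

lemma borel_measurable_acorr [measurable]:
  assumes [measurable]: "g \<in> borel_measurable borel"
  shows "acorr g \<in> borel_measurable borel"
  unfolding acorr_def by measurable

text \<open>Fatou's lemma transfers lower semicontinuity from g to its autocorrelation; no
  finiteness of g is involved.\<close>

lemma lsc_acorr_liminf:
  fixes g :: "'a::euclidean_space \<Rightarrow> ennreal"
  assumes g: "lsc g" and X: "X \<longlonglongrightarrow> z"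
  shows "acorr g z \<le> liminf (\<lambda>k. acorr g (X k))"
proof -
  have [measurable]: "g \<in> borel_measurable borel" by (rule borel_measurable_lsc[OF g])
  \<comment> \<open>Absorbing the first factor into the measure leaves the limit inferior of a
    single function instead of that of a product.\<close>
  have eq: "acorr g w = (\<integral>\<^sup>+y. g (y - w) \<partial>density lborel g)" for w
    unfolding acorr_def by (rule nn_integral_density[symmetric]) measurable
  have "(\<integral>\<^sup>+y. g (y - z) \<partial>density lborel g) \<le> (\<integral>\<^sup>+y. liminf (\<lambda>k. g (y - X k)) \<partial>density lborel g)"
    by (intro nn_integral_mono lsc_liminf[OF g] tendsto_intros X)
  also have "\<dots> \<le> liminf (\<lambda>k. \<integral>\<^sup>+y. g (y - X k) \<partial>density lborel g)"
    by (rule nn_integral_liminf) measurable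
  finally show ?thesis by (simp only: eq)
qed

lemma borel_measurable_frac [measurable]: "(frac :: real \<Rightarrow> real) \<in> borel_measurable borel"
  unfolding frac_def by measurable

section \<open>Volumes of thin annuli and numbers of lattice points on spheres\<close>

definition annulus :: "real \<Rightarrow> real \<Rightarrow> 'a::euclidean_space set" where
  "annulus n \<delta> = {z. n \<le> (norm z)\<^sup>2 \<and> (norm z)\<^sup>2 < n + \<delta>}"

lemma sets_annulus [measurable]: "annulus n \<delta> \<in> sets borel"
  unfolding annulus_def by measurable

text \<open>From (n + \<open>\<delta>\<close>)^(d/2) >= (n + \<open>\<delta>\<close>) n^(d/2 - 1).
  The power of n left over is the one in the lattice point count, so the two cancel later.\<close>

lemma emeasure_annulus_ge:
  assumes n: "0 \<le> n" and \<delta>: "0 \<le> \<delta>" and d: "DIM('a) \<ge> 2"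
  shows "ennreal (unit_ball_vol (DIM('a)) * \<delta> * sqrt n ^ (DIM('a) - 2)) \<le> emeasure lborel (annulus n \<delta> :: 'a::euclidean_space set)"
proof -
  let ?V = "unit_ball_vol (DIM('a))" and ?d = "DIM('a)"
  have V: "?V \<ge> 0" by simp
  have eq: "annulus n \<delta> = ball 0 (sqrt (n + \<delta>)) - ball (0::'a) (sqrt n)"
  proof -
    have "(norm z)\<^sup>2 < t \<longleftrightarrow> norm z < sqrt t" for z :: 'a and t
      using real_sqrt_less_iff[of "(norm z)\<^sup>2" t] by simp
    then show ?thesis by (auto simp: annulus_def not_less[symmetric])
  qed
  have sub: "ball (0::'a) (sqrt n) \<subseteq> ball 0 (sqrt (n + \<delta>))" using n \<delta> by (intro subset_ball) simp
  have "emeasure lborel (annulus n \<delta> :: 'a set) = ennreal (?V * sqrt (n + \<delta>) ^ ?d) - ennreal (?V * sqrt n ^ ?d)"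
    unfolding eq using n \<delta> sub by (subst emeasure_Diff) (auto simp: emeasure_ball)
  also have "\<dots> = ennreal (?V * sqrt (n + \<delta>) ^ ?d - ?V * sqrt n ^ ?d)"
    using n V by (intro ennreal_minus) auto
  also have "\<dots> \<ge> ennreal (?V * \<delta> * sqrt n ^ (?d - 2))"
  proof (intro ennreal_leI)
    obtain e where e: "?d = e + 2" using d by (metis le_add_diff_inverse2)
    have "\<delta> * sqrt n ^ e = (n + \<delta>) * sqrt n ^ e - sqrt n ^ ?d" using n by (simp add: e power_add algebra_simps)
    also have "\<dots> \<le> (n + \<delta>) * sqrt (n + \<delta>) ^ e - sqrt n ^ ?d"
      using n \<delta> by (intro diff_right_mono mult_left_mono power_mono) auto
    also have "(n + \<delta>) * sqrt (n + \<delta>) ^ e = sqrt (n + \<delta>) ^ ?d" using n \<delta> by (simp add: e power_add)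
    finally have "?V * (\<delta> * sqrt n ^ e) \<le> ?V * (sqrt (n + \<delta>) ^ ?d - sqrt n ^ ?d)" using V by (intro mult_left_mono) auto
    then show "?V * \<delta> * sqrt n ^ (?d - 2) \<le> ?V * sqrt (n + \<delta>) ^ ?d - ?V * sqrt n ^ ?d"
      by (simp add: e algebra_simps)
  qed
  finally show ?thesis .
qed

lemma lattice_eq_image: "(int_lattice :: (real^'n) set) = (\<lambda>k. \<chi> i. of_int (k i)) ` UNIV"
proof -
  have "u = (\<chi> i. of_int (\<lfloor>u $ i\<rfloor>))" if "u \<in> int_lattice" for u :: "real^'n"
    using that by (auto simp: int_lattice_def vec_eq_iff)
  then have "u \<in> (\<lambda>k. \<chi> i. of_int (k i)) ` UNIV" if "u \<in> int_lattice" for u :: "real^'n"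
    using that by (intro image_eqI[of _ _ "\<lambda>i. \<lfloor>u $ i\<rfloor>"]) auto
  then show ?thesis by (auto simp: int_lattice_def)
qed

lemma inj_lattice: "inj (\<lambda>k :: 'n::finite \<Rightarrow> int. (\<chi> i. of_int (k i)) :: real^'n)"
  by (auto simp: inj_def vec_eq_iff fun_eq_iff)

lemma countable_lattice: "countable (int_lattice :: (real^'n) set)"
proof -
  have "countable (range (\<lambda>k :: int^'n. (\<chi> i. of_int (k $ i)) :: real^'n))" by simp
  moreover have "(int_lattice :: (real^'n) set) \<subseteq> range (\<lambda>k :: int^'n. \<chi> i. of_int (k $ i))"
  proof
    fix u :: "real^'n" assume "u \<in> int_lattice"
    then obtain k where "u = (\<chi> i. of_int (k i))" by (auto simp: lattice_eq_image)
    then have "u = (\<lambda>k :: int^'n. \<chi> i. of_int (k $ i)) (\<chi> i. k i)" by simp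
    then show "u \<in> range (\<lambda>k :: int^'n. \<chi> i. of_int (k $ i))" by blast
  qed
  ultimately show ?thesis by (rule countable_subset[rotated])
qed

lemma norm_lattice: "(norm ((\<chi> i. of_int (k i)) :: real^'n))\<^sup>2 = of_int (\<Sum>i\<in>UNIV. (k i)\<^sup>2)"
  unfolding power2_norm_eq_inner inner_vec_def by (simp add: power2_eq_square)

lemma lattice_norm_nat:
  assumes "u \<in> (int_lattice :: (real^'n) set)" "u \<noteq> 0"
  obtains n :: nat where "n \<ge> 1" "(norm u)\<^sup>2 = real n"
proof -
  obtain k where k: "u = (\<chi> i. of_int (k i))" using assms by (auto simp: lattice_eq_image)
  define n where "n = nat (\<Sum>i\<in>UNIV. (k i)\<^sup>2)"
  have "(norm u)\<^sup>2 = real n" unfolding k norm_lattice n_def by (simp add: sum_nonneg)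
  moreover have "(norm u)\<^sup>2 > 0" using assms by simp
  ultimately show ?thesis using that[of n] by simp
qed

definition lattice_sphere :: "nat \<Rightarrow> (real^'n) set" where
  "lattice_sphere n = {u \<in> int_lattice. (norm u)\<^sup>2 = real n}"

lemma card_lattice_sphere:
  assumes "CARD('n::finite) \<ge> 5"
  shows "\<exists>C>0. \<forall>n\<ge>1. finite (lattice_sphere n :: (real^'n) set) \<and>
     real (card (lattice_sphere n :: (real^'n) set)) \<le> C * sqrt (real n) ^ (CARD('n) - 2)"
proof -
  obtain C where C: "C > 0" "\<And>n. n \<ge> 1 \<Longrightarrow> real (card {u :: 'n \<Rightarrow> int. (\<Sum>i\<in>UNIV. (u i)\<^sup>2) = int n}) \<le> C * sqrt (real n) ^ (CARD('n) - 2)"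
    using card_sum_squares_le[OF assms] by blast
  have eq: "(lattice_sphere n :: (real^'n) set) = (\<lambda>k. \<chi> i. of_int (k i)) ` {k. (\<Sum>i\<in>UNIV. (k i)\<^sup>2) = int n}" for n
  proof -
    have "(norm ((\<chi> i. of_int (k i)) :: real^'n))\<^sup>2 = real n \<longleftrightarrow> (\<Sum>i\<in>UNIV. (k i)\<^sup>2) = int n" for k
      unfolding norm_lattice by (metis of_int_eq_iff of_int_of_nat_eq)
    then show ?thesis unfolding lattice_sphere_def lattice_eq_image by blast
  qed
  have fin: "finite {k :: 'n \<Rightarrow> int. (\<Sum>i\<in>UNIV. (k i)\<^sup>2) = int n}" for n
  proof (rule finite_subset)
    show "{k :: 'n \<Rightarrow> int. (\<Sum>i\<in>UNIV. (k i)\<^sup>2) = int n} \<subseteq> PiE UNIV (\<lambda>_. {-int n..int n})"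
    proof
      fix k :: "'n \<Rightarrow> int" assume k: "k \<in> {k. (\<Sum>i\<in>UNIV. (k i)\<^sup>2) = int n}"
      have "\<bar>k i\<bar> \<le> int n" for i
      proof -
        have "\<bar>k i\<bar> \<le> (k i)\<^sup>2" 
        proof (cases "k i = 0")
          case False
          then have "\<bar>k i\<bar> * 1 \<le> \<bar>k i\<bar> * \<bar>k i\<bar>" by (intro mult_left_mono) auto
          then show ?thesis by (simp add: power2_eq_square)
        qed simp
        also have "\<dots> \<le> (\<Sum>i\<in>UNIV. (k i)\<^sup>2)" by (rule member_le_sum) auto
        finally show ?thesis using k by simp
      qed
      then have "- int n \<le> k i \<and> k i \<le> int n" for i by (simp add: abs_le_iff minus_le_iff)
      then show "k \<in> PiE UNIV (\<lambda>_. {-int n..int n})" by auto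
    qed
  qed (intro finite_PiE, auto)
  show ?thesis unfolding eq
    using C fin by (intro exI[of _ C]) (auto simp: card_image[OF inj_on_subset[OF inj_lattice]])
qed

section \<open>Rotational averages of the autocorrelation\<close>

context
  fixes H :: "(real^'n^'n) measure" and g :: "real^'n \<Rightarrow> ennreal"
  assumes haar: "is_haar_SO H" and g: "lsc g" and n2: "CARD('n) \<ge> 2"
begin

text \<open>The transpose makes radiality a consequence of left invariance;
  \<open>rot_avg_eq\<close> returns to the untransposed average that occurs for
  periodizations.\<close>

definition "rot_avg z = (\<integral>\<^sup>+\<rho>. acorr g (transpose \<rho> *v z) \<partial>H)"

lemma g_measurable [measurable]: "g \<in> borel_measurable borel" by (rule borel_measurable_lsc[OF g])

lemma borel_measurable_rot_avg [measurable]: "rot_avg \<in> borel_measurable borel"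
proof -
  note measurable_haar[OF haar, measurable]
  interpret sigma_finite_measure H by (rule sigma_finite_haar[OF haar])
  show ?thesis unfolding rot_avg_def by measurable
qed

lemma rot_avg_eq: "rot_avg z = (\<integral>\<^sup>+\<rho>. acorr g (\<rho> *v z) \<partial>H)"
  unfolding rot_avg_def by (rule nn_integral_haar_transpose[OF haar, of "\<lambda>\<rho>. acorr g (\<rho> *v z)"]) measurable

lemma rot_avg_radial: "norm z = norm z' \<Longrightarrow> rot_avg z = rot_avg z'"
  unfolding rot_avg_def by (rule nn_integral_haar_radial[OF haar _ n2]) measurable

lemma rot_avg_liminf:
  assumes X: "X \<longlonglongrightarrow> z"
  shows "rot_avg z \<le> liminf (\<lambda>k. rot_avg (X k))"
proof -
  note measurable_haar[OF haar, measurable]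
  have "rot_avg z \<le> (\<integral>\<^sup>+\<rho>. liminf (\<lambda>k. acorr g (transpose \<rho> *v X k)) \<partial>H)"
    unfolding rot_avg_def
    by (intro nn_integral_mono lsc_acorr_liminf[OF g] isCont_tendsto_compose[OF matrix_vector_mult_linear_continuous_at] X)
  also have "\<dots> \<le> liminf (\<lambda>k. rot_avg (X k))"
    unfolding rot_avg_def by (rule nn_integral_liminf) measurable
  finally show ?thesis .
qed

text \<open>Points chosen in shrinking annuli need not approach u, but their norms approach that of
  u. As the average is radial, they may be moved to the ray through u, where they converge to u and
  semicontinuity applies.\<close>

lemma rot_avg_le_SUP:
  assumes u: "u \<noteq> 0" and \<delta>: "\<And>k. \<delta> k > 0" "\<delta> \<longlonglongrightarrow> 0"
  shows "rot_avg u \<le> (SUP k. INF z\<in>annulus ((norm u)\<^sup>2) (\<delta> k). rot_avg z)"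
proof (rule ccontr)
  assume "\<not> ?thesis"
  then obtain c where c: "(SUP k. INF z\<in>annulus ((norm u)\<^sup>2) (\<delta> k). rot_avg z) < c" "c < rot_avg u"
    using dense[of "SUP k. INF z\<in>annulus ((norm u)\<^sup>2) (\<delta> k). rot_avg z" "rot_avg u"] by (auto simp: not_le)
  have "\<exists>z\<in>annulus ((norm u)\<^sup>2) (\<delta> k). rot_avg z < c" for k
  proof -
    have "(INF z\<in>annulus ((norm u)\<^sup>2) (\<delta> k). rot_avg z) < c"
      using c(1) by (rule le_less_trans[OF SUP_upper, rotated]) simp
    then show ?thesis by (simp add: INF_less_iff)
  qed
  then obtain z where z: "\<And>k. z k \<in> annulus ((norm u)\<^sup>2) (\<delta> k)" "\<And>k. rot_avg (z k) < c" by metis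
  have "(\<lambda>k. (norm (z k))\<^sup>2) \<longlonglongrightarrow> (norm u)\<^sup>2"
  proof (rule tendsto_sandwich[where f = "\<lambda>k. (norm u)\<^sup>2" and h = "\<lambda>k. (norm u)\<^sup>2 + \<delta> k"])
    show "(\<lambda>k. (norm u)\<^sup>2 + \<delta> k) \<longlonglongrightarrow> (norm u)\<^sup>2" using tendsto_add[OF tendsto_const \<delta>(2)] by simp
    show "(\<lambda>k. (norm u)\<^sup>2) \<longlonglongrightarrow> (norm u)\<^sup>2" by simp
    have "(norm u)\<^sup>2 \<le> (norm (z k))\<^sup>2 \<and> (norm (z k))\<^sup>2 \<le> (norm u)\<^sup>2 + \<delta> k" for k
      using z(1)[of k] unfolding annulus_def by auto
    then show "\<forall>\<^sub>F k in sequentially. (norm u)\<^sup>2 \<le> (norm (z k))\<^sup>2"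
      "\<forall>\<^sub>F k in sequentially. (norm (z k))\<^sup>2 \<le> (norm u)\<^sup>2 + \<delta> k" by (simp_all only: eventually_True)
  qed
  then have "(\<lambda>k. sqrt ((norm (z k))\<^sup>2)) \<longlonglongrightarrow> sqrt ((norm u)\<^sup>2)" by (rule tendsto_real_sqrt)
  then have nz: "(\<lambda>k. norm (z k)) \<longlonglongrightarrow> norm u" by simp
  have "(\<lambda>k. (norm (z k) / norm u) *\<^sub>R u) \<longlonglongrightarrow> (norm u / norm u) *\<^sub>R u"
    using u by (intro tendsto_scaleR tendsto_divide nz tendsto_const) auto
  then have "(\<lambda>k. (norm (z k) / norm u) *\<^sub>R u) \<longlonglongrightarrow> u" using u by simp
  then have "rot_avg u \<le> liminf (\<lambda>k. rot_avg ((norm (z k) / norm u) *\<^sub>R u))" by (rule rot_avg_liminf)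
  also have "\<dots> = liminf (\<lambda>k. rot_avg (z k))"
    using u by (intro arg_cong[where f = liminf] ext rot_avg_radial) simp
  also have "\<dots> \<le> liminf (\<lambda>k. c)" using z(2) by (intro Liminf_mono always_eventually) (auto intro: less_imp_le)
  also have "\<dots> = c" by (simp add: Liminf_const)
  finally show False using c(2) by simp
qed

lemma rot_avg_zero: "rot_avg 0 = acorr g 0"
  by (simp only: rot_avg_def matrix_vector_mult_0_right nn_integral_haar_const[OF haar])

text \<open>Against a radial weight each rotation can be undone by a change of variables, so the
  average over rotations disappears; y = x - z then gives the double integral.\<close>

lemma nn_integral_rot_avg_frac:
  "(\<integral>\<^sup>+z. indicator {t. frac t < e} ((norm z)\<^sup>2) * rot_avg z \<partial>lborel)
    = (\<integral>\<^sup>+y. \<integral>\<^sup>+x. g x * g y * indicator {t. frac t < e} ((norm (x - y))\<^sup>2) \<partial>lborel \<partial>lborel)"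
proof -
  note measurable_haar[OF haar, measurable]
  interpret H: sigma_finite_measure H by (rule sigma_finite_haar[OF haar])
  interpret P: pair_sigma_finite "lborel :: (real^'n) measure" H ..
  let ?i = "\<lambda>z :: real^'n. indicator {t. frac t < e} ((norm z)\<^sup>2) :: ennreal"
  have "(\<integral>\<^sup>+z. ?i z * rot_avg z \<partial>lborel) = (\<integral>\<^sup>+z. \<integral>\<^sup>+\<rho>. ?i z * acorr g (transpose \<rho> *v z) \<partial>H \<partial>lborel)"
    unfolding rot_avg_def by (intro nn_integral_cong nn_integral_cmult[symmetric]) measurable
  also have "\<dots> = (\<integral>\<^sup>+\<rho>. \<integral>\<^sup>+z. ?i z * acorr g (transpose \<rho> *v z) \<partial>lborel \<partial>H)"
    by (rule P.Fubini'[symmetric]) measurable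
  also have "\<dots> = (\<integral>\<^sup>+\<rho>. \<integral>\<^sup>+z. ?i z * acorr g z \<partial>lborel \<partial>H)"
  proof (rule nn_integral_cong)
    fix \<rho> assume "\<rho> \<in> space H"
    then have \<rho>: "transpose \<rho> \<in> SO_group" by (simp add: space_haar[OF haar] SO_transpose)
    have "(\<integral>\<^sup>+z. ?i (transpose \<rho> *v z) * acorr g (transpose \<rho> *v z) \<partial>lborel) = (\<integral>\<^sup>+z. ?i z * acorr g z \<partial>lborel)"
      by (rule nn_integral_lborel_rotation[of "\<lambda>z. ?i z * acorr g z", OF _ \<rho>]) measurable
    then show "(\<integral>\<^sup>+z. ?i z * acorr g (transpose \<rho> *v z) \<partial>lborel) = (\<integral>\<^sup>+z. ?i z * acorr g z \<partial>lborel)"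
      by (simp only: SO_norm[OF \<rho>])
  qed
  also have "\<dots> = (\<integral>\<^sup>+z. ?i z * acorr g z \<partial>lborel)" by (rule nn_integral_haar_const[OF haar])
  also have "\<dots> = (\<integral>\<^sup>+z. \<integral>\<^sup>+x. ?i z * (g x * g (x - z)) \<partial>lborel \<partial>lborel)"
    unfolding acorr_def by (intro nn_integral_cong nn_integral_cmult[symmetric]) measurable
  also have "\<dots> = (\<integral>\<^sup>+x. \<integral>\<^sup>+z. ?i z * (g x * g (x - z)) \<partial>lborel \<partial>lborel)"
    by (rule lborel_pair.Fubini') measurable
  also have "\<dots> = (\<integral>\<^sup>+x. \<integral>\<^sup>+y. g x * g y * ?i (x - y) \<partial>lborel \<partial>lborel)"
  proof (rule nn_integral_cong)
    fix x
    have "(\<integral>\<^sup>+z. ?i z * (g x * g (x - z)) \<partial>lborel) = (\<integral>\<^sup>+z. ?i (x + z) * (g x * g (x - (x + z))) \<partial>lborel)"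
      by (rule nn_integral_lborel_translate[symmetric]) measurable
    also have "\<dots> = (\<integral>\<^sup>+z. ?i (x + - z) * (g x * g (x - (x + - z))) \<partial>lborel)"
      by (rule nn_integral_lborel_uminus[symmetric]) measurable
    finally show "(\<integral>\<^sup>+z. ?i z * (g x * g (x - z)) \<partial>lborel) = (\<integral>\<^sup>+y. g x * g y * ?i (x - y) \<partial>lborel)"
      by (simp add: mult_ac)
  qed
  also have "\<dots> = (\<integral>\<^sup>+y. \<integral>\<^sup>+x. g x * g y * ?i (x - y) \<partial>lborel \<partial>lborel)"
    by (rule lborel_pair.Fubini') measurable
  finally show ?thesis .
qed

end

text \<open>A lower semicontinuous majorant may be infinite on a null set; this passes from the
  real-valued estimate to such functions by altering g there.\<close>

lemma nn_integral_frac_ennreal_le: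
  fixes g :: "'a::euclidean_space \<Rightarrow> ennreal"
  assumes [measurable]: "g \<in> borel_measurable borel" and A: "(\<integral>\<^sup>+x. g x \<partial>lborel) < \<infinity>" and B: "(\<integral>\<^sup>+x. (g x)\<^sup>2 \<partial>lborel) < \<infinity>"
    and d: "DIM('a) \<ge> 4" and N: "N > 0"
  shows "(\<integral>\<^sup>+y. \<integral>\<^sup>+x. g x * g y * indicator {t. frac t < 1 / (6 * real N)} ((norm (x - y))\<^sup>2) \<partial>lborel \<partial>lborel)
    \<le> ennreal (4 / real N) * ((\<integral>\<^sup>+x. g x \<partial>lborel)\<^sup>2 + 10 * (\<integral>\<^sup>+x. (g x)\<^sup>2 \<partial>lborel))"
proof -
  define r where "r x = enn2real (g x)" for x
  have [measurable]: "r \<in> borel_measurable borel" unfolding r_def by measurable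
  have r0: "0 \<le> r x" for x by (simp add: r_def)
  have "AE x in lborel. g x \<noteq> \<infinity>" using A by (intro nn_integral_PInf_AE) auto
  then have gr: "AE x in lborel. g x = ennreal (r x)" by (rule AE_mp) (auto simp: r_def less_top)
  have A': "(\<integral>\<^sup>+x. g x \<partial>lborel) = (\<integral>\<^sup>+x. ennreal (r x) \<partial>lborel)" using gr by (rule nn_integral_cong_AE)
  have B': "(\<integral>\<^sup>+x. (g x)\<^sup>2 \<partial>lborel) = (\<integral>\<^sup>+x. ennreal ((r x)\<^sup>2) \<partial>lborel)"
    using gr by (intro nn_integral_cong_AE) (auto elim!: AE_mp simp: ennreal_power r0)
  have ri: "integrable lborel r" using A r0 by (intro integrableI_nonneg) (auto simp: A')
  have r2: "integrable lborel (\<lambda>x. (r x)\<^sup>2)" using B by (intro integrableI_nonneg) (auto simp: B')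
  have A2: "(\<integral>\<^sup>+x. g x \<partial>lborel) = ennreal (\<integral>x. r x \<partial>lborel)" unfolding A' using r0 by (intro nn_integral_eq_integral ri) auto
  have B2: "(\<integral>\<^sup>+x. (g x)\<^sup>2 \<partial>lborel) = ennreal (\<integral>x. (r x)\<^sup>2 \<partial>lborel)" unfolding B' by (intro nn_integral_eq_integral r2) auto
  let ?i = "\<lambda>x y :: 'a. indicator {t. frac t < 1 / (6 * real N)} ((norm (x - y))\<^sup>2) :: ennreal"
  have "(\<integral>\<^sup>+y. \<integral>\<^sup>+x. g x * g y * ?i x y \<partial>lborel \<partial>lborel) = (\<integral>\<^sup>+y. \<integral>\<^sup>+x. ennreal (r x * r y) * ?i x y \<partial>lborel \<partial>lborel)"
  proof (rule nn_integral_cong_AE)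
    show "AE y in lborel. (\<integral>\<^sup>+x. g x * g y * ?i x y \<partial>lborel) = (\<integral>\<^sup>+x. ennreal (r x * r y) * ?i x y \<partial>lborel)"
      using gr
    proof (rule AE_mp, intro AE_I2 impI)
      fix y assume y: "g y = ennreal (r y)"
      show "(\<integral>\<^sup>+x. g x * g y * ?i x y \<partial>lborel) = (\<integral>\<^sup>+x. ennreal (r x * r y) * ?i x y \<partial>lborel)"
      proof (rule nn_integral_cong_AE)
        show "AE x in lborel. g x * g y * ?i x y = ennreal (r x * r y) * ?i x y"
          using gr by (rule AE_mp) (auto simp: y ennreal_mult r0)
      qed
    qed
  qed
  also have "\<dots> \<le> ennreal (4 / real N * ((\<integral>x. r x \<partial>lborel)\<^sup>2 + 10 * (\<integral>x. (r x)\<^sup>2 \<partial>lborel)))"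
    by (rule nn_integral_frac_le[OF ri r0 r2 d N])
  also have "\<dots> = ennreal (4 / real N) * (ennreal ((\<integral>x. r x \<partial>lborel)\<^sup>2) + ennreal (10 * (\<integral>x. (r x)\<^sup>2 \<partial>lborel)))"
    by (subst ennreal_mult) (auto simp: ennreal_plus)
  also have "ennreal ((\<integral>x. r x \<partial>lborel)\<^sup>2) = (\<integral>\<^sup>+x. g x \<partial>lborel)\<^sup>2"
    unfolding A2 using r0 by (subst ennreal_power) (auto intro: Bochner_Integration.integral_nonneg)
  also have "ennreal (10 * (\<integral>x. (r x)\<^sup>2 \<partial>lborel)) = 10 * (\<integral>\<^sup>+x. (g x)\<^sup>2 \<partial>lborel)"
    unfolding B2 by (subst ennreal_mult) auto
  finally show ?thesis .
qed

text \<open>By lower semicontinuity the value at a lattice point is bounded by averages over thin annuli,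
  whose volumes compensate the number of lattice points on a sphere.\<close>
lemma rot_avg_lattice_le:
  fixes H :: "(real^'n^'n) measure" and g :: "real^'n \<Rightarrow> ennreal"
  assumes haar: "is_haar_SO H" and g: "lsc g" and n5: "CARD('n) \<ge> 5"
    and A: "(\<integral>\<^sup>+x. g x \<partial>lborel) < \<infinity>" and B: "(\<integral>\<^sup>+x. (g x)\<^sup>2 \<partial>lborel) < \<infinity>"
    and C: "C > 0" "\<And>n. n \<ge> 1 \<Longrightarrow> finite (lattice_sphere n :: (real^'n) set)"
      "\<And>n. n \<ge> 1 \<Longrightarrow> real (card (lattice_sphere n :: (real^'n) set)) \<le> C * sqrt (real n) ^ (CARD('n) - 2)"
  shows "(\<integral>\<^sup>+u. rot_avg H g u \<partial>count_space (int_lattice - {0}))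
    \<le> ennreal (24 * C / unit_ball_vol (CARD('n))) * ((\<integral>\<^sup>+x. g x \<partial>lborel)\<^sup>2 + 10 * (\<integral>\<^sup>+x. (g x)\<^sup>2 \<partial>lborel))"
proof -
  have n2: "CARD('n) \<ge> 2" using n5 by simp
  have gm[measurable]: "g \<in> borel_measurable borel" by (rule borel_measurable_lsc[OF g])
  note borel_measurable_rot_avg[OF haar g n2, measurable]
  let ?\<Psi> = "rot_avg H g"
  let ?L = "int_lattice - {0} :: (real^'n) set"
  let ?V = "unit_ball_vol (CARD('n))"
  let ?X = "(\<integral>\<^sup>+x. g x \<partial>lborel)\<^sup>2 + 10 * (\<integral>\<^sup>+x. (g x)\<^sup>2 \<partial>lborel)"
  have V: "?V > 0" by simp
  have cL: "countable ?L" using countable_lattice by (rule countable_subset[rotated]) auto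
  \<comment> \<open>The window of the Fejer kernel of order k + 1. It is at most 1, so annuli
    attached to different integers are disjoint.\<close>
  define \<delta> where "\<delta> k = 1 / (6 * real (Suc k))" for k
  define P where "P u k = (annulus ((norm u)\<^sup>2) (\<delta> k) :: (real^'n) set)" for u :: "real^'n" and k
  \<comment> \<open>The infimum is below the value at every point of the annulus, hence times the
    volume below the integral; it increases with k because the annuli shrink, which permits monotone
    convergence at the end.\<close>
  define m where "m k u = (INF z\<in>P u k. ?\<Psi> z)" for k u
  have \<delta>0: "\<delta> k > 0" for k by (simp add: \<delta>_def)
  have \<delta>1: "\<delta> k \<le> 1" for k by (simp add: \<delta>_def)
  have \<delta>lim: "\<delta> \<longlonglongrightarrow> 0"
  proof -
    have "(\<lambda>k. (1/6) / real (Suc k)) \<longlonglongrightarrow> 0" by (rule LIMSEQ_Suc) (rule lim_const_over_n)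
    then show ?thesis by (simp add: \<delta>_def[abs_def])
  qed
  have \<delta>dec: "\<delta> (Suc k) \<le> \<delta> k" for k unfolding \<delta>_def by (intro divide_left_mono) auto
  have [measurable]: "P u k \<in> sets borel" for u k by (simp add: P_def)
  have inc: "incseq m"
  proof (rule incseq_SucI)
    fix k
    have "P u (Suc k) \<subseteq> P u k" for u using \<delta>dec[of k] by (auto simp: P_def annulus_def)
    then show "m k \<le> m (Suc k)" unfolding m_def le_fun_def by (intro allI INF_superset_mono) auto
  qed
  have step: "(\<integral>\<^sup>+u. m k u \<partial>count_space ?L) \<le> ennreal (24 * C / ?V) * ?X" for k
  proof -
    define v where "v u = ?V * \<delta> k * sqrt ((norm u)\<^sup>2) ^ (CARD('n) - 2)" for u :: "real^'n"
    have v: "v u > 0" if "u \<in> ?L" for u using that V \<delta>0 by (simp add: v_def)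
    have mv: "m k u \<le> (\<integral>\<^sup>+z. ennreal (1 / v u) * indicator (P u k) z * ?\<Psi> z \<partial>lborel)" if u: "u \<in> ?L" for u
    proof -
      have "m k u = ennreal (1 / v u) * (m k u * ennreal (v u))"
        using v[OF u] by (simp add: mult.left_commute flip: ennreal_mult)
      also have "m k u * ennreal (v u) \<le> m k u * emeasure lborel (P u k)"
        unfolding v_def P_def using emeasure_annulus_ge[of "(norm u)\<^sup>2" "\<delta> k", where 'a = "real^'n"] n2 \<delta>0[of k]
        by (intro mult_left_mono) auto
      also have "\<dots> = (\<integral>\<^sup>+z. m k u * indicator (P u k) z \<partial>lborel)" by (simp add: nn_integral_cmult_indicator)
      also have "\<dots> \<le> (\<integral>\<^sup>+z. indicator (P u k) z * ?\<Psi> z \<partial>lborel)"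
        by (intro nn_integral_mono) (auto simp: m_def intro: INF_lower split: split_indicator)
      finally show ?thesis
        by (simp add: nn_integral_cmult mult.assoc mult_left_mono)
    qed
    \<comment> \<open>The floor of |z|^2 determines the only sphere whose annuli contain z. The
      number of its lattice points is cancelled by the power of n in \<open>v\<close>, leaving a
      multiple of the window indicator that does not depend on n.\<close>
    have pt: "(\<integral>\<^sup>+u. ennreal (1 / v u) * indicator (P u k) z \<partial>count_space ?L)
       \<le> ennreal (C / (?V * \<delta> k)) * indicator {t. frac t < \<delta> k} ((norm z)\<^sup>2)" for z
    proof (cases "\<exists>u\<in>?L. z \<in> P u k")
      case False
      then have "(\<integral>\<^sup>+u. ennreal (1 / v u) * indicator (P u k) z \<partial>count_space ?L) = (\<integral>\<^sup>+u. 0 \<partial>count_space ?L)"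
        by (intro nn_integral_cong) auto
      then show ?thesis by simp
    next
      case True
      then obtain u0 where u0: "u0 \<in> ?L" "z \<in> P u0 k" by blast
      obtain n where n: "n \<ge> 1" "(norm u0)\<^sup>2 = real n" using lattice_norm_nat[of u0] u0 by auto
      let ?S = "lattice_sphere n :: (real^'n) set"
      have zn: "real n \<le> (norm z)\<^sup>2" "(norm z)\<^sup>2 < real n + \<delta> k" using u0 n by (auto simp: P_def annulus_def)
      have fl: "\<lfloor>(norm z)\<^sup>2\<rfloor> = int n" using zn \<delta>1[of k] by (intro floor_unique) auto
      then have fr: "frac ((norm z)\<^sup>2) < \<delta> k" using zn by (simp add: frac_def)
      have S: "u \<in> ?S" if u: "u \<in> ?L" "z \<in> P u k" for u
      proof -
        obtain n' where n': "n' \<ge> 1" "(norm u)\<^sup>2 = real n'" using lattice_norm_nat[of u] u by auto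
        have "real n' \<le> (norm z)\<^sup>2" "(norm z)\<^sup>2 < real n' + \<delta> k" using u n' by (auto simp: P_def annulus_def)
        then have "\<lfloor>(norm z)\<^sup>2\<rfloor> = int n'" using \<delta>1[of k] by (intro floor_unique) auto
        then have "n' = n" using fl by simp
        then show ?thesis using u n' by (simp add: lattice_sphere_def)
      qed
      have "(\<integral>\<^sup>+u. ennreal (1 / v u) * indicator (P u k) z \<partial>count_space ?L) = (\<Sum>u\<in>?S. ennreal (1 / v u) * indicator (P u k) z)"
      proof (rule nn_integral_count_space')
        show "finite ?S" by (rule C(2)[OF n(1)])
        show "?S \<subseteq> ?L" using n by (auto simp: lattice_sphere_def)
        show "ennreal (1 / v u) * indicator (P u k) z = 0" if "u \<in> ?L" "u \<notin> ?S" for u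
          using S[OF that(1)] that(2) by (auto split: split_indicator)
      qed
      also have "\<dots> \<le> (\<Sum>u\<in>?S. ennreal (1 / (?V * \<delta> k * sqrt (real n) ^ (CARD('n) - 2))))"
        by (intro sum_mono) (auto simp: v_def lattice_sphere_def split: split_indicator)
      also have "\<dots> = ennreal (real (card ?S)) * ennreal (1 / (?V * \<delta> k * sqrt (real n) ^ (CARD('n) - 2)))"
        by (simp add: ennreal_of_nat_eq_real_of_nat)
      also have "\<dots> = ennreal (real (card ?S) * (1 / (?V * \<delta> k * sqrt (real n) ^ (CARD('n) - 2))))"
        using V \<delta>0[of k] by (intro ennreal_mult[symmetric]) auto
      also have "\<dots> \<le> ennreal ((C * sqrt (real n) ^ (CARD('n) - 2)) * (1 / (?V * \<delta> k * sqrt (real n) ^ (CARD('n) - 2))))"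
        using V \<delta>0[of k] by (intro ennreal_leI mult_right_mono C(3)[OF n(1)]) auto
      also have "(C * sqrt (real n) ^ (CARD('n) - 2)) * (1 / (?V * \<delta> k * sqrt (real n) ^ (CARD('n) - 2))) = C / (?V * \<delta> k)"
        using n by simp
      finally show ?thesis using fr by simp
    qed
    have "(\<integral>\<^sup>+u. m k u \<partial>count_space ?L) \<le> (\<integral>\<^sup>+u. \<integral>\<^sup>+z. ennreal (1 / v u) * indicator (P u k) z * ?\<Psi> z \<partial>lborel \<partial>count_space ?L)"
      by (rule nn_integral_mono) (use mv in simp)
    also have "\<dots> = (\<integral>\<^sup>+z. \<integral>\<^sup>+u. ennreal (1 / v u) * indicator (P u k) z * ?\<Psi> z \<partial>count_space ?L \<partial>lborel)"
      by (rule nn_integral_count_space_nn_integral[OF cL, symmetric]) measurable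
    also have "\<dots> = (\<integral>\<^sup>+z. (\<integral>\<^sup>+u. ennreal (1 / v u) * indicator (P u k) z \<partial>count_space ?L) * ?\<Psi> z \<partial>lborel)"
      by (intro nn_integral_cong nn_integral_multc) auto
    also have "\<dots> \<le> (\<integral>\<^sup>+z. ennreal (C / (?V * \<delta> k)) * (indicator {t. frac t < \<delta> k} ((norm z)\<^sup>2) * ?\<Psi> z) \<partial>lborel)"
      by (rule nn_integral_mono) (use mult_right_mono[OF pt] in \<open>simp add: mult.assoc\<close>)
    also have "\<dots> = ennreal (C / (?V * \<delta> k)) * (\<integral>\<^sup>+z. indicator {t. frac t < \<delta> k} ((norm z)\<^sup>2) * ?\<Psi> z \<partial>lborel)"
      by (rule nn_integral_cmult) measurable
    also have "\<dots> \<le> ennreal (C / (?V * \<delta> k)) * (ennreal (4 / real (Suc k)) * ?X)"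
      unfolding nn_integral_rot_avg_frac[OF haar g n2] \<delta>_def
      using nn_integral_frac_ennreal_le[OF gm A B, of "Suc k"] n5 by (intro mult_left_mono) auto
    also have "\<dots> = ennreal (C / (?V * \<delta> k) * (4 / real (Suc k))) * ?X"
      using C V \<delta>0[of k] by (subst ennreal_mult) (auto simp: mult.assoc)
    \<comment> \<open>The factor 6 (k + 1) from 1/\<open>\<delta> k\<close> cancels the 4/(k + 1)
      from the Fejer bound, so the estimate is uniform in k.\<close>
    also have "C / (?V * \<delta> k) * (4 / real (Suc k)) = 24 * C / ?V"
    proof -
      have "C / (V * (1 / (6 * s))) * (4 / s) = 24 * C / V" if "s > 0" "V > 0" for s V :: real
        using that by (simp add: field_simps)
      then show ?thesis using V by (simp only: \<delta>_def)
    qed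
    finally show ?thesis .
  qed
  have "(\<integral>\<^sup>+u. ?\<Psi> u \<partial>count_space ?L) \<le> (\<integral>\<^sup>+u. (SUP k. m k u) \<partial>count_space ?L)"
    unfolding m_def P_def
    by (rule nn_integral_mono) (use rot_avg_le_SUP[OF haar g n2 _ \<delta>0 \<delta>lim] in auto)
  also have "\<dots> = (SUP k. \<integral>\<^sup>+u. m k u \<partial>count_space ?L)"
    by (rule nn_integral_monotone_convergence_SUP[OF inc]) simp
  also have "\<dots> \<le> ennreal (24 * C / ?V) * ?X" by (rule SUP_least) (rule step)
  finally show ?thesis .
qed

text \<open>The origin is treated separately: its term is the autocorrelation at 0, the integral of
  g^2. All other lattice points come from the annulus estimate.\<close>

lemma haar_lattice_bound:
  assumes n5: "CARD('n::finite) \<ge> 5"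
  shows "\<exists>C>0. \<forall>(H :: (real^'n^'n) measure) (g :: real^'n \<Rightarrow> ennreal). is_haar_SO H \<longrightarrow> lsc g \<longrightarrow>
     (\<integral>\<^sup>+x. g x \<partial>lborel) < \<infinity> \<longrightarrow> (\<integral>\<^sup>+x. (g x)\<^sup>2 \<partial>lborel) < \<infinity> \<longrightarrow>
     (\<integral>\<^sup>+\<rho>. \<integral>\<^sup>+u. acorr g (\<rho> *v u) \<partial>count_space int_lattice \<partial>H)
       \<le> ennreal C * ((\<integral>\<^sup>+x. g x \<partial>lborel)\<^sup>2 + (\<integral>\<^sup>+x. (g x)\<^sup>2 \<partial>lborel))"
proof -
  obtain C where C: "C > 0" "\<And>n. n \<ge> 1 \<Longrightarrow> finite (lattice_sphere n :: (real^'n) set)"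
      "\<And>n. n \<ge> 1 \<Longrightarrow> real (card (lattice_sphere n :: (real^'n) set)) \<le> C * sqrt (real n) ^ (CARD('n) - 2)"
    using card_lattice_sphere[OF n5] by blast
  define K where "K = 24 * C / unit_ball_vol (CARD('n))"
  have K: "K > 0" using C by (simp add: K_def)
  have n2: "CARD('n) \<ge> 2" using n5 by simp
  have "(\<integral>\<^sup>+\<rho>. \<integral>\<^sup>+u. acorr g (\<rho> *v u) \<partial>count_space int_lattice \<partial>H)
       \<le> ennreal (1 + 10 * K) * ((\<integral>\<^sup>+x. g x \<partial>lborel)\<^sup>2 + (\<integral>\<^sup>+x. (g x)\<^sup>2 \<partial>lborel))"
    if haar: "is_haar_SO H" and g: "lsc g" and A: "(\<integral>\<^sup>+x. g x \<partial>lborel) < \<infinity>" and B: "(\<integral>\<^sup>+x. (g x)\<^sup>2 \<partial>lborel) < \<infinity>"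
    for H :: "(real^'n^'n) measure" and g :: "real^'n \<Rightarrow> ennreal"
  proof -
    note measurable_haar[OF haar, measurable]
    have [measurable]: "g \<in> borel_measurable borel" by (rule borel_measurable_lsc[OF g])
    let ?A = "(\<integral>\<^sup>+x. g x \<partial>lborel)\<^sup>2" and ?B = "\<integral>\<^sup>+x. (g x)\<^sup>2 \<partial>lborel"
    have "(\<integral>\<^sup>+\<rho>. \<integral>\<^sup>+u. acorr g (\<rho> *v u) \<partial>count_space int_lattice \<partial>H) = (\<integral>\<^sup>+u. rot_avg H g u \<partial>count_space int_lattice)"
      unfolding rot_avg_eq[OF haar g n2]
      by (rule nn_integral_count_space_nn_integral[OF countable_lattice]) measurable
    also have "\<dots> = (\<integral>\<^sup>+u. rot_avg H g u \<partial>count_space {0}) + (\<integral>\<^sup>+u. rot_avg H g u \<partial>count_space (int_lattice - {0}))"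
    proof -
      have z: "0 \<in> (int_lattice :: (real^'n) set)" by (simp add: int_lattice_def)
      have "(\<integral>\<^sup>+u. rot_avg H g u \<partial>count_space int_lattice) = (\<integral>\<^sup>+u. rot_avg H g u * indicator {0} u + rot_avg H g u * indicator (int_lattice - {0}) u \<partial>count_space UNIV)"
        by (subst nn_integral_count_space_indicator) (auto intro!: nn_integral_cong simp: z split: split_indicator)
      also have "\<dots> = (\<integral>\<^sup>+u. rot_avg H g u * indicator {0} u \<partial>count_space UNIV) + (\<integral>\<^sup>+u. rot_avg H g u * indicator (int_lattice - {0}) u \<partial>count_space UNIV)"
        by (rule nn_integral_add) auto
      finally show ?thesis
        by (subst (2 3) nn_integral_count_space_indicator) simp_all
    qed
    also have "(\<integral>\<^sup>+u. rot_avg H g u \<partial>count_space {0}) = ?B"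
      by (simp add: nn_integral_count_space_finite rot_avg_zero[OF haar g n2] acorr_def power2_eq_square)
    also have "?B + (\<integral>\<^sup>+u. rot_avg H g u \<partial>count_space (int_lattice - {0})) \<le> ?B + ennreal K * (?A + 10 * ?B)"
      unfolding K_def by (intro add_left_mono rot_avg_lattice_le haar g n5 A B C)
    also have "\<dots> \<le> ennreal 1 * (?A + ?B) + ennreal K * (10 * (?A + ?B))"
      by (intro add_mono mult_left_mono) (auto simp: distrib_left intro: add_increasing add_mono mult_right_mono[of 1 10 "?A", simplified])
    also have "\<dots> = ennreal (1 + 10 * K) * (?A + ?B)"
      using K by (subst ennreal_plus) (auto simp: distrib_right ennreal_mult mult_ac)
    finally show ?thesis .
  qed
  moreover have "1 + 10 * K > 0" using K by simp
  ultimately show ?thesis by blast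
qed

section \<open>Periodizations\<close>

lemma lattice_add: "\<mu> \<in> int_lattice \<Longrightarrow> \<nu> \<in> int_lattice \<Longrightarrow> \<mu> + \<nu> \<in> int_lattice"
  by (simp add: int_lattice_def)

lemma lattice_diff: "\<mu> \<in> int_lattice \<Longrightarrow> \<nu> \<in> int_lattice \<Longrightarrow> \<mu> - \<nu> \<in> int_lattice"
  by (simp add: int_lattice_def)

lemma unit_cube_eq: "(unit_cube :: (real^'n) set) = cbox 0 (\<chi> i. 1)"
  by (auto simp: unit_cube_def mem_box_cart)

lemma sets_unit_cube [measurable]: "(unit_cube :: (real^'n) set) \<in> sets borel"
  by (simp add: unit_cube_eq)

text \<open>The cube is closed, so a coordinate can admit two integer shifts. Counting two for each
  coordinate holds at every point and avoids null sets, at the price of the factor 2^d.\<close>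

lemma lattice_translates_of_cube:
  fixes x :: "real^'n"
  shows "(\<integral>\<^sup>+\<mu>. indicator unit_cube (x + \<mu>) \<partial>count_space int_lattice) \<le> ennreal (2 ^ CARD('n))"
proof -
  let ?S = "{\<mu> \<in> int_lattice. x + \<mu> \<in> unit_cube}"
  let ?B = "\<lambda>i. {\<lceil>- (x $ i)\<rceil>, \<lceil>- (x $ i)\<rceil> + 1}"
  have sub: "?S \<subseteq> (\<lambda>k. \<chi> i. of_int (k i)) ` PiE UNIV ?B"
  proof
    fix \<mu> assume \<mu>: "\<mu> \<in> ?S"
    then obtain k where k: "\<mu> = (\<chi> i. of_int (k i))" by (auto simp: lattice_eq_image)
    have "k i \<in> ?B i" for i
    proof -
      have "0 \<le> x $ i + of_int (k i)" "x $ i + of_int (k i) \<le> 1" using \<mu> k by (auto simp: unit_cube_def)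
      then have "\<lceil>- (x $ i)\<rceil> \<le> k i" "k i \<le> \<lceil>- (x $ i)\<rceil> + 1" by linarith+
      then show ?thesis by auto
    qed
    then show "\<mu> \<in> (\<lambda>k. \<chi> i. of_int (k i)) ` PiE UNIV ?B" unfolding k by auto
  qed
  have fin: "finite (PiE (UNIV :: 'n set) ?B)" by (intro finite_PiE) auto
  have finS: "finite ?S" by (rule finite_subset[OF sub]) (use fin in auto)
  have "card ?S \<le> card (PiE (UNIV :: 'n set) ?B)"
    by (rule order_trans[OF card_mono[OF _ sub] card_image_le]) (use fin in auto)
  also have "\<dots> = 2 ^ CARD('n)" by (subst card_PiE) (simp_all add: card_insert_if flip: numeral_2_eq_2)
  finally have c: "card ?S \<le> 2 ^ CARD('n)" .
  have "(\<integral>\<^sup>+\<mu>. indicator unit_cube (x + \<mu>) \<partial>count_space int_lattice) = (\<Sum>\<mu>\<in>?S. indicator unit_cube (x + \<mu>))"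
    by (rule nn_integral_count_space'[OF finS]) auto
  also have "\<dots> = (\<Sum>\<mu>\<in>?S. 1)" by (intro sum.cong) auto
  also have "\<dots> = ennreal (real (card ?S))" by (simp add: ennreal_of_nat_eq_real_of_nat)
  also have "\<dots> \<le> ennreal (2 ^ CARD('n))" 
  proof (rule ennreal_leI)
    have "real (card ?S) \<le> real (2 ^ CARD('n))" using c by (rule of_nat_mono)
    then show "real (card ?S) \<le> 2 ^ CARD('n)" by simp
  qed
  finally show ?thesis .
qed

lemma borel_measurable_nn_integral_count_space:
  fixes f :: "'i \<Rightarrow> 'a \<Rightarrow> ennreal"
  assumes I: "countable I" and f: "\<And>i. i \<in> I \<Longrightarrow> f i \<in> borel_measurable M"
  shows "(\<lambda>x. \<integral>\<^sup>+i. f i x \<partial>count_space I) \<in> borel_measurable M"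
proof (cases "finite I")
  case True
  then show ?thesis using f by (simp add: nn_integral_count_space_finite)
next
  case False
  have "(\<integral>\<^sup>+i. f i x \<partial>count_space I) = (\<Sum>n. f (from_nat_into I n) x)" for x
    using nn_integral_bij_count_space[OF bij_betw_from_nat_into[OF I False], of "\<lambda>i. f i x"]
    by (simp add: nn_integral_count_space_nat)
  moreover have "from_nat_into I n \<in> I" for n using False by (intro from_nat_into) auto
  ultimately show ?thesis using f by (simp add: borel_measurable_suminf_order)
qed

lemma nn_integral_lattice_shift:
  fixes F :: "real^'n \<Rightarrow> ennreal"
  assumes "\<mu> \<in> int_lattice"
  shows "(\<integral>\<^sup>+\<nu>. F \<nu> \<partial>count_space int_lattice) = (\<integral>\<^sup>+u. F (\<mu> + u) \<partial>count_space int_lattice)"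
proof -
  have "bij_betw (\<lambda>u. \<mu> + u) int_lattice int_lattice"
    by (rule bij_betw_byWitness[where f' = "\<lambda>\<nu>. \<nu> - \<mu>"]) (use assms lattice_add lattice_diff in auto)
  from nn_integral_bij_count_space[OF this] show ?thesis by simp
qed

text \<open>Writing the second lattice index as \<open>\<mu>\<close> + u and translating x by
  \<open>\<mu>\<close> leaves \<open>\<mu>\<close> only in the cube indicator, whose sum over the
  lattice is at most 2^d. What remains for each u is an autocorrelation, and rotation invariance
  moves \<open>\<rho>\<close> onto u.\<close>

lemma periodization_square_le:
  fixes g :: "real^'n \<Rightarrow> ennreal"
  assumes [measurable]: "g \<in> borel_measurable borel" and \<rho>: "\<rho> \<in> SO_group"
  shows "(\<integral>\<^sup>+x. indicator unit_cube x * (\<integral>\<^sup>+\<nu>. g (\<rho> *v (x - \<nu>)) \<partial>count_space int_lattice)\<^sup>2 \<partial>lborel)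
    \<le> ennreal (2 ^ CARD('n)) * (\<integral>\<^sup>+u. acorr g (\<rho> *v u) \<partial>count_space int_lattice)"
proof -
  let ?L = "int_lattice :: (real^'n) set"
  let ?Q = "indicator unit_cube :: real^'n \<Rightarrow> ennreal"
  define h where "h x = g (\<rho> *v x)" for x
  have [measurable]: "h \<in> borel_measurable borel" unfolding h_def by measurable
  note cL = countable_lattice[where 'n = 'n]
  have "?Q x * (\<integral>\<^sup>+\<nu>. h (x - \<nu>) \<partial>count_space ?L)\<^sup>2 = (\<integral>\<^sup>+\<mu>. \<integral>\<^sup>+u. ?Q x * (h (x - \<mu>) * h (x - \<mu> - u)) \<partial>count_space ?L \<partial>count_space ?L)" for x
  proof -
    let ?I = "\<integral>\<^sup>+\<nu>. h (x - \<nu>) \<partial>count_space ?L"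
    have "(\<integral>\<^sup>+\<mu>. \<integral>\<^sup>+u. ?Q x * (h (x - \<mu>) * h (x - \<mu> - u)) \<partial>count_space ?L \<partial>count_space ?L)
       = (\<integral>\<^sup>+\<mu>. ?Q x * (h (x - \<mu>) * ?I) \<partial>count_space ?L)"
    proof (rule nn_integral_cong)
      fix \<mu> assume "\<mu> \<in> space (count_space ?L)"
      then have "?I = (\<integral>\<^sup>+u. h (x - \<mu> - u) \<partial>count_space ?L)"
        using nn_integral_lattice_shift[of \<mu> "\<lambda>\<nu>. h (x - \<nu>)"] by (simp add: diff_diff_eq)
      then show "(\<integral>\<^sup>+u. ?Q x * (h (x - \<mu>) * h (x - \<mu> - u)) \<partial>count_space ?L) = ?Q x * (h (x - \<mu>) * ?I)"
        by (simp add: nn_integral_cmult)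
    qed
    also have "\<dots> = ?Q x * (?I * ?I)" by (simp add: nn_integral_cmult nn_integral_multc)
    finally show ?thesis by (simp add: power2_eq_square)
  qed
  then have "(\<integral>\<^sup>+x. ?Q x * (\<integral>\<^sup>+\<nu>. g (\<rho> *v (x - \<nu>)) \<partial>count_space ?L)\<^sup>2 \<partial>lborel)
    = (\<integral>\<^sup>+x. \<integral>\<^sup>+\<mu>. \<integral>\<^sup>+u. ?Q x * (h (x - \<mu>) * h (x - \<mu> - u)) \<partial>count_space ?L \<partial>count_space ?L \<partial>lborel)"
    by (simp add: h_def)
  also have "\<dots> = (\<integral>\<^sup>+\<mu>. \<integral>\<^sup>+x. \<integral>\<^sup>+u. ?Q x * (h (x - \<mu>) * h (x - \<mu> - u)) \<partial>count_space ?L \<partial>lborel \<partial>count_space ?L)"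
    by (rule nn_integral_count_space_nn_integral[OF cL]) (rule borel_measurable_nn_integral_count_space[OF cL], measurable)
  also have "\<dots> = (\<integral>\<^sup>+\<mu>. \<integral>\<^sup>+u. \<integral>\<^sup>+x. ?Q x * (h (x - \<mu>) * h (x - \<mu> - u)) \<partial>lborel \<partial>count_space ?L \<partial>count_space ?L)"
    by (rule nn_integral_cong, rule nn_integral_count_space_nn_integral[OF cL]) measurable
  also have "\<dots> = (\<integral>\<^sup>+\<mu>. \<integral>\<^sup>+u. \<integral>\<^sup>+x. ?Q (x + \<mu>) * (h x * h (x - u)) \<partial>lborel \<partial>count_space ?L \<partial>count_space ?L)"
  proof (rule nn_integral_cong, rule nn_integral_cong)
    fix \<mu> u :: "real^'n"
    have "(\<integral>\<^sup>+x. ?Q (\<mu> + x) * (h (\<mu> + x - \<mu>) * h (\<mu> + x - \<mu> - u)) \<partial>lborel) = (\<integral>\<^sup>+x. ?Q x * (h (x - \<mu>) * h (x - \<mu> - u)) \<partial>lborel)"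
      by (rule nn_integral_lborel_translate[of "\<lambda>x. ?Q x * (h (x - \<mu>) * h (x - \<mu> - u))" \<mu>]) measurable
    then show "(\<integral>\<^sup>+x. ?Q x * (h (x - \<mu>) * h (x - \<mu> - u)) \<partial>lborel) = (\<integral>\<^sup>+x. ?Q (x + \<mu>) * (h x * h (x - u)) \<partial>lborel)"
      by (simp add: add.commute)
  qed
  also have "\<dots> = (\<integral>\<^sup>+u. \<integral>\<^sup>+\<mu>. \<integral>\<^sup>+x. ?Q (x + \<mu>) * (h x * h (x - u)) \<partial>lborel \<partial>count_space ?L \<partial>count_space ?L)"
    by (rule nn_integral_count_space_nn_integral[OF cL]) simp
  also have "\<dots> = (\<integral>\<^sup>+u. \<integral>\<^sup>+x. \<integral>\<^sup>+\<mu>. ?Q (x + \<mu>) * (h x * h (x - u)) \<partial>count_space ?L \<partial>lborel \<partial>count_space ?L)"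
    by (rule nn_integral_cong, rule nn_integral_count_space_nn_integral[OF cL, symmetric]) measurable
  also have "\<dots> = (\<integral>\<^sup>+u. \<integral>\<^sup>+x. (\<integral>\<^sup>+\<mu>. ?Q (x + \<mu>) \<partial>count_space ?L) * (h x * h (x - u)) \<partial>lborel \<partial>count_space ?L)"
    by (rule nn_integral_cong, rule nn_integral_cong, rule nn_integral_multc) simp
  also have "\<dots> \<le> (\<integral>\<^sup>+u. \<integral>\<^sup>+x. ennreal (2 ^ CARD('n)) * (h x * h (x - u)) \<partial>lborel \<partial>count_space ?L)"
    by (rule nn_integral_mono, rule nn_integral_mono, rule mult_right_mono, rule lattice_translates_of_cube) simp
  also have "\<dots> = ennreal (2 ^ CARD('n)) * (\<integral>\<^sup>+u. \<integral>\<^sup>+x. h x * h (x - u) \<partial>lborel \<partial>count_space ?L)"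
    by (simp add: nn_integral_cmult)
  also have "(\<integral>\<^sup>+u. \<integral>\<^sup>+x. h x * h (x - u) \<partial>lborel \<partial>count_space ?L) = (\<integral>\<^sup>+u. acorr g (\<rho> *v u) \<partial>count_space ?L)"
  proof (rule nn_integral_cong)
    fix u
    show "(\<integral>\<^sup>+x. h x * h (x - u) \<partial>lborel) = acorr g (\<rho> *v u)"
      using nn_integral_lborel_rotation[OF _ \<rho>, of "\<lambda>y. g y * g (y - \<rho> *v u)"]
      by (simp add: h_def acorr_def matrix_vector_mult_diff_distrib)
  qed
  finally show ?thesis .
qed

section \<open>Lower semicontinuous majorants\<close>

lemma ennreal_le_suminf: "t n \<le> (\<Sum>n. t n)" for t :: "nat \<Rightarrow> ennreal"
  using sum_le_suminf[of t "{n}"] by simp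

lemma suminf_indicator_dyadic:
  fixes c :: "nat \<Rightarrow> ennreal"
  shows "(\<Sum>n. c n * indicator {x. P x \<and> idx x = n} x) = (if P x then c (idx x) else 0)"
proof -
  have "(\<Sum>n. c n * indicator {x. P x \<and> idx x = n} x) = (\<Sum>n\<in>{idx x}. c n * indicator {x. P x \<and> idx x = n} x)"
    by (rule suminf_finite) (simp_all add: indicator_def)
  then show ?thesis by (simp add: indicator_def)
qed

text \<open>The dyadic level sets of f are replaced by
  slightly larger open sets.\<close>
lemma lsc_majorant:
  fixes f :: "'a::euclidean_space \<Rightarrow> real"
  assumes f[measurable]: "f \<in> borel_measurable lebesgue" and f0: "\<And>x. 0 \<le> f x" and e: "e > 0"
  obtains g where "lsc g" "\<And>x. ennreal (f x) \<le> g x"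
    "(\<integral>\<^sup>+x. g x \<partial>lborel) \<le> 2 * (\<integral>\<^sup>+x. ennreal (f x) \<partial>lebesgue) + ennreal e"
    "(\<integral>\<^sup>+x. (g x)\<^sup>2 \<partial>lborel) \<le> 4 * (\<integral>\<^sup>+x. ennreal ((f x)\<^sup>2) \<partial>lebesgue) + ennreal e"
proof -
  \<comment> \<open>For f x > 0, \<open>c (idx x)\<close> is the least power of two that is at least
    f x. Encoding the exponent as a natural number lets the levels be summed as a series.\<close>
  define idx where "idx x = int_encode \<lceil>log 2 (f x)\<rceil>" for x
  define c :: "nat \<Rightarrow> real" where "c n = 2 powr (of_int (int_decode n))" for n
  define E where "E n = {x. f x > 0 \<and> idx x = n}" for n
  \<comment> \<open>The excess measure allowed at level n: small enough that, multiplied by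
    \<open>c n\<close> or by its square, it is at most e / 2^(n+1). One family of open sets thus
    serves both norms.\<close>
  define \<epsilon> where "\<epsilon> n = e * (1/2) ^ Suc n / (c n + (c n)\<^sup>2)" for n
  have c0: "c n > 0" for n by (simp add: c_def)
  have cc: "c n + (c n)\<^sup>2 > 0" for n using c0[of n] by (simp add: add_pos_pos)
  have \<epsilon>0: "\<epsilon> n > 0" for n unfolding \<epsilon>_def using e cc[of n] by (intro divide_pos_pos mult_pos_pos) simp_all
  have c\<epsilon>: "c n * \<epsilon> n \<le> e * (1/2) ^ Suc n" "(c n)\<^sup>2 * \<epsilon> n \<le> e * (1/2) ^ Suc n" for n
  proof -
    let ?E = "e * (1/2) ^ Suc n" and ?D = "c n + (c n)\<^sup>2"
    have E: "?E \<ge> 0" using e by simp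
    have *: "x * (y / z) = y * (x / z)" for x y z :: real by simp
    have 1: "c n / ?D \<le> 1" "(c n)\<^sup>2 / ?D \<le> 1"
      using cc[of n] c0[of n] by (simp_all add: divide_le_eq_1_pos)
    show "c n * \<epsilon> n \<le> ?E"
      unfolding \<epsilon>_def *[of "c n"] by (rule mult_left_le[OF 1(1) E])
    show "(c n)\<^sup>2 * \<epsilon> n \<le> ?E"
      unfolding \<epsilon>_def *[of "(c n)\<^sup>2"] by (rule mult_left_le[OF 1(2) E])
  qed
  have fc: "f x \<le> c (idx x)" "c (idx x) \<le> 2 * f x" if "f x > 0" for x
  proof -
    have 1: "log 2 (f x) \<le> of_int \<lceil>log 2 (f x)\<rceil>" "of_int \<lceil>log 2 (f x)\<rceil> \<le> log 2 (f x) + 1" by linarith+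
    have "2 powr log 2 (f x) \<le> c (idx x)" unfolding c_def idx_def by (simp add: 1)
    then show "f x \<le> c (idx x)" using that by simp
    have "c (idx x) \<le> 2 powr (log 2 (f x) + 1)" unfolding c_def idx_def using 1 by (simp del: powr_add)
    also have "\<dots> = 2 * f x" using that by (simp add: powr_add)
    finally show "c (idx x) \<le> 2 * f x" .
  qed
  have E_sets: "E n \<in> sets lebesgue" for n
  proof -
    have "E n = {x \<in> space lebesgue. f x > 0 \<and> \<lceil>log 2 (f x)\<rceil> = int_decode n}"
      unfolding E_def idx_def by (auto simp: int_encode_inverse)
    also have "\<dots> \<in> sets lebesgue" by measurable
    finally show ?thesis .
  qed
  have "\<exists>U. open U \<and> E n \<subseteq> U \<and> emeasure lborel U \<le> emeasure lebesgue (E n) + ennreal (\<epsilon> n)" for n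
  proof -
    obtain T where T: "open T" "E n \<subseteq> T" "T - E n \<in> lmeasurable" "emeasure lebesgue (T - E n) < ennreal (\<epsilon> n)"
      using sets_lebesgue_outer_open[OF E_sets \<epsilon>0] by blast
    have "emeasure lborel T = emeasure lebesgue (E n \<union> (T - E n))" using T by (simp add: Un_absorb1)
    also have "\<dots> \<le> emeasure lebesgue (E n) + emeasure lebesgue (T - E n)"
      by (rule emeasure_subadditive) (use E_sets T in auto)
    also have "\<dots> \<le> emeasure lebesgue (E n) + ennreal (\<epsilon> n)" using T by (intro add_left_mono) auto
    finally show ?thesis using T by blast
  qed
  then obtain U where U: "\<And>n. open (U n)" "\<And>n. E n \<subseteq> U n" "\<And>n. emeasure lborel (U n) \<le> emeasure lebesgue (E n) + ennreal (\<epsilon> n)"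
    by metis
  define a where "a n x = ennreal (c n) * indicator (U n) x" for n x
  \<comment> \<open>A supremum rather than a sum: it keeps superlevel sets open, and its square is
    bounded by the sum of the squared levels without cross terms.\<close>
  define g where "g x = (SUP n. a n x)" for x
  have [measurable]: "U n \<in> sets borel" for n using U by auto
  have g_lsc: "lsc g"
    unfolding lsc_def
  proof
    fix t
    have "{x. t < g x} = (\<Union>n. if t < ennreal (c n) then U n else {})"
      unfolding g_def a_def by (auto simp: less_SUP_iff split: split_indicator if_splits)
    also have "open \<dots>" using U by (intro open_UN) auto
    finally show "open {x. t < g x}" .
  qed
  have g_ge: "ennreal (f x) \<le> g x" for x
  proof (cases "f x > 0")
    case True
    then have "x \<in> U (idx x)" using U(2)[of "idx x"] by (auto simp: E_def)
    then have "ennreal (f x) \<le> a (idx x) x" using fc[OF True] by (simp add: a_def ennreal_leI)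
    also have "\<dots> \<le> g x" unfolding g_def by (rule SUP_upper) simp
    finally show ?thesis .
  next
    case False
    then have "f x = 0" using f0[of x] by simp
    then show ?thesis by simp
  qed
  \<comment> \<open>Applied once with the levels \<open>c n\<close> for the first norm and once with
    their squares for the second.\<close>
  have sum_bound: "(\<integral>\<^sup>+x. (\<Sum>n. ennreal (b n) * indicator (U n) x) \<partial>lborel) \<le> (\<integral>\<^sup>+x. F x \<partial>lebesgue) + ennreal e"
    if b: "\<And>n. 0 \<le> b n" "\<And>n. b n * \<epsilon> n \<le> e * (1/2) ^ Suc n" and F: "\<And>x. f x > 0 \<Longrightarrow> ennreal (b (idx x)) \<le> F x" for b F
  proof -
    have "(\<integral>\<^sup>+x. (\<Sum>n. ennreal (b n) * indicator (U n) x) \<partial>lborel) = (\<Sum>n. ennreal (b n) * emeasure lborel (U n))"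
      by (subst nn_integral_suminf) (auto simp: nn_integral_cmult_indicator)
    also have "\<dots> \<le> (\<Sum>n. ennreal (b n) * emeasure lebesgue (E n) + ennreal (e * (1/2) ^ Suc n))"
    proof (intro suminf_le allI)
      fix n
      have "ennreal (b n) * emeasure lborel (U n) \<le> ennreal (b n) * (emeasure lebesgue (E n) + ennreal (\<epsilon> n))"
        by (intro mult_left_mono U) auto
      also have "\<dots> = ennreal (b n) * emeasure lebesgue (E n) + ennreal (b n * \<epsilon> n)"
        using b(1)[of n] \<epsilon>0[of n] by (simp add: distrib_left ennreal_mult)
      also have "\<dots> \<le> ennreal (b n) * emeasure lebesgue (E n) + ennreal (e * (1/2) ^ Suc n)"
        using b(2)[of n] by (intro add_left_mono ennreal_leI)
      finally show "ennreal (b n) * emeasure lborel (U n) \<le> ennreal (b n) * emeasure lebesgue (E n) + ennreal (e * (1/2) ^ Suc n)" .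
    qed auto
    also have "\<dots> = (\<Sum>n. ennreal (b n) * emeasure lebesgue (E n)) + (\<Sum>n. ennreal (e * (1/2) ^ Suc n))"
      by (rule suminf_add[symmetric]) auto
    also have "(\<Sum>n. ennreal (e * (1/2) ^ Suc n)) = ennreal e"
    proof -
      have "(\<lambda>n. e * (1/2) ^ Suc n) sums (e * 1)" by (intro sums_mult power_half_series)
      then show ?thesis using e by (intro sums_unique[symmetric]) (simp only: sums_ennreal mult_1_right, simp)
    qed
    also have "(\<Sum>n. ennreal (b n) * emeasure lebesgue (E n)) = (\<integral>\<^sup>+x. (\<Sum>n. ennreal (b n) * indicator (E n) x) \<partial>lebesgue)"
      by (subst nn_integral_suminf) (use E_sets in \<open>auto simp: nn_integral_cmult_indicator\<close>)
    also have "\<dots> \<le> (\<integral>\<^sup>+x. F x \<partial>lebesgue)"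
      unfolding E_def suminf_indicator_dyadic[of "\<lambda>n. ennreal (b n)"] by (intro nn_integral_mono) (use F in auto)
    finally show ?thesis by (simp add: add_right_mono)
  qed
  have ag: "a n x \<le> (\<Sum>n. ennreal (c n) * indicator (U n) x)" for n x
    unfolding a_def by (rule ennreal_le_suminf)
  have "(\<integral>\<^sup>+x. g x \<partial>lborel) \<le> (\<integral>\<^sup>+x. (\<Sum>n. ennreal (c n) * indicator (U n) x) \<partial>lborel)"
    unfolding g_def by (intro nn_integral_mono SUP_least ag)
  also have "\<dots> \<le> (\<integral>\<^sup>+x. 2 * ennreal (f x) \<partial>lebesgue) + ennreal e"
  proof (rule sum_bound)
    fix x assume "f x > 0"
    then have "ennreal (c (idx x)) \<le> ennreal (2 * f x)" by (intro ennreal_leI fc)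
    then show "ennreal (c (idx x)) \<le> 2 * ennreal (f x)" by (simp add: ennreal_mult f0)
  qed (use c0 c\<epsilon> in \<open>auto intro: less_imp_le\<close>)
  also have "(\<integral>\<^sup>+x. 2 * ennreal (f x) \<partial>lebesgue) = 2 * (\<integral>\<^sup>+x. ennreal (f x) \<partial>lebesgue)" by (rule nn_integral_cmult) measurable
  finally have g1: "(\<integral>\<^sup>+x. g x \<partial>lborel) \<le> 2 * (\<integral>\<^sup>+x. ennreal (f x) \<partial>lebesgue) + ennreal e" .
  have g2: "(\<integral>\<^sup>+x. (g x)\<^sup>2 \<partial>lborel) \<le> 4 * (\<integral>\<^sup>+x. ennreal ((f x)\<^sup>2) \<partial>lebesgue) + ennreal e"
  proof -
    have a2: "(a n x)\<^sup>2 \<le> (\<Sum>n. ennreal ((c n)\<^sup>2) * indicator (U n) x)" for n x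
    proof -
      have "(a n x)\<^sup>2 = ennreal ((c n)\<^sup>2) * indicator (U n) x"
        using c0[of n] by (auto simp: a_def ennreal_power split: split_indicator)
      then show ?thesis by (simp only:) (rule ennreal_le_suminf)
    qed
    have "(g x)\<^sup>2 \<le> (\<Sum>n. ennreal ((c n)\<^sup>2) * indicator (U n) x)" for x
    proof -
      have "a n x * a m x \<le> (\<Sum>n. ennreal ((c n)\<^sup>2) * indicator (U n) x)" for n m
      proof (cases "a n x \<le> a m x")
        case True
        then have "a n x * a m x \<le> (a m x)\<^sup>2" by (simp add: power2_eq_square mult_right_mono)
        then show ?thesis by (rule order_trans[OF _ a2])
      next
        case False
        then have "a n x * a m x \<le> (a n x)\<^sup>2" by (simp add: power2_eq_square mult_left_mono)
        then show ?thesis by (rule order_trans[OF _ a2])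
      qed
      then have "(SUP m. SUP n. a n x * a m x) \<le> (\<Sum>n. ennreal ((c n)\<^sup>2) * indicator (U n) x)"
        by (intro SUP_least)
      moreover have "(g x)\<^sup>2 = (SUP m. SUP n. a n x * a m x)"
        by (simp only: g_def power2_eq_square SUP_mult_left_ennreal SUP_mult_right_ennreal)
      ultimately show ?thesis by simp
    qed
    then have "(\<integral>\<^sup>+x. (g x)\<^sup>2 \<partial>lborel) \<le> (\<integral>\<^sup>+x. (\<Sum>n. ennreal ((c n)\<^sup>2) * indicator (U n) x) \<partial>lborel)"
      by (intro nn_integral_mono)
    also have "\<dots> \<le> (\<integral>\<^sup>+x. 4 * ennreal ((f x)\<^sup>2) \<partial>lebesgue) + ennreal e"
    proof (rule sum_bound)
      fix x assume "f x > 0"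
      then have "(c (idx x))\<^sup>2 \<le> (2 * f x)\<^sup>2" using c0[of "idx x"] by (intro power_mono fc) auto
      then have "ennreal ((c (idx x))\<^sup>2) \<le> ennreal (4 * (f x)\<^sup>2)" by (intro ennreal_leI) simp
      then show "ennreal ((c (idx x))\<^sup>2) \<le> 4 * ennreal ((f x)\<^sup>2)" by (simp add: ennreal_mult)
    qed (use c\<epsilon> in auto)
    also have "(\<integral>\<^sup>+x. 4 * ennreal ((f x)\<^sup>2) \<partial>lebesgue) = 4 * (\<integral>\<^sup>+x. ennreal ((f x)\<^sup>2) \<partial>lebesgue)" by (rule nn_integral_cmult) measurable
    finally show ?thesis .
  qed
  show ?thesis by (rule that[OF g_lsc g_ge g1 g2])
qed

section \<open>Measurability and size of the periodization\<close>

text \<open>As f is only Lebesgue measurable, composition requires that the rigid motion pull null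
  sets back to null sets; invariance of the measure under translations and rotations gives
  this.\<close>

lemma measurable_rotated_translate:
  fixes f :: "real^'n \<Rightarrow> complex"
  assumes f: "f \<in> borel_measurable lebesgue" and \<rho>: "\<rho> \<in> SO_group"
  shows "(\<lambda>x. f (\<rho> *v (x - \<nu>))) \<in> borel_measurable lebesgue"
proof -
  let ?T = "\<lambda>x. \<rho> *v (x - \<nu>)"
  have T[measurable]: "?T \<in> measurable lborel lborel" by measurable
  have T': "?T \<in> measurable lebesgue lborel" by (rule measurable_completion[OF T])
  have "null_sets lborel \<subseteq> null_sets (distr lebesgue lborel ?T)"
  proof
    fix N :: "(real^'n) set" assume N: "N \<in> null_sets lborel"
    then have [measurable]: "N \<in> sets borel" by auto
    have "emeasure (distr lebesgue lborel ?T) N = emeasure (distr lborel lborel ?T) N"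
      by (simp add: distr_completion)
    also have "\<dots> = (\<integral>\<^sup>+x. indicator N x \<partial>distr lborel lborel ?T)" by (rule nn_integral_indicator[symmetric]) simp
    also have "\<dots> = (\<integral>\<^sup>+x. indicator N (\<rho> *v (x - \<nu>)) \<partial>lborel)" by (rule nn_integral_distr) measurable
    also have "\<dots> = (\<integral>\<^sup>+x. indicator N (\<rho> *v x) \<partial>lborel)"
      using nn_integral_lborel_translate[of "\<lambda>x. indicator N (\<rho> *v x)" "- \<nu>"] by simp
    also have "\<dots> = (\<integral>\<^sup>+x. indicator N x \<partial>lborel)" by (rule nn_integral_lborel_rotation[OF _ \<rho>]) measurable
    also have "\<dots> = 0" using N by auto
    finally show "N \<in> null_sets (distr lebesgue lborel ?T)" by (auto simp: null_sets_def)
  qed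
  from completion.measurable_completion2[OF T' this]
  have "?T \<in> measurable lebesgue lebesgue" .
  from measurable_compose[OF this f] show ?thesis .
qed

lemma infinite_lattice: "infinite (int_lattice :: (real^'n) set)"
proof -
  have "infinite (range (\<lambda>n :: nat. (\<chi> i. of_nat n) :: real^'n))"
    by (rule range_inj_infinite) (auto simp: inj_def vec_eq_iff)
  moreover have "range (\<lambda>n :: nat. (\<chi> i. of_nat n) :: real^'n) \<subseteq> int_lattice" by (auto simp: int_lattice_def)
  ultimately show ?thesis using infinite_super by blast
qed

text \<open>Summability and absolute summability agree for complex families, and
  \<open>infsum\<close> is 0 where they fail. The function is therefore an ordinary series, set to 0
  on the measurable set where the series of moduli diverges.\<close>

lemma borel_measurable_periodization:
  fixes f :: "real^'n \<Rightarrow> complex"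
  assumes f: "f \<in> borel_measurable lebesgue" and \<rho>: "\<rho> \<in> SO_group"
  shows "periodization f \<rho> \<in> borel_measurable lebesgue"
proof -
  define e where "e = from_nat_into (int_lattice :: (real^'n) set)"
  have e: "bij_betw e UNIV int_lattice"
    unfolding e_def by (rule bij_betw_from_nat_into[OF countable_lattice infinite_lattice])
  define F where "F n x = f (\<rho> *v (x - e n))" for n x
  have [measurable]: "F n \<in> borel_measurable lebesgue" for n
    unfolding F_def by (rule measurable_rotated_translate[OF f \<rho>])
  have "periodization f \<rho> x = (if (\<Sum>n. ennreal (cmod (F n x))) \<noteq> top then (\<Sum>n. F n x) else 0)" for x
  proof -
    have p: "periodization f \<rho> x = infsum (\<lambda>n. F n x) UNIV"
      unfolding periodization_def F_def by (rule infsum_reindex_bij_betw[OF e, symmetric])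
    show ?thesis
    proof (cases "(\<Sum>n. ennreal (cmod (F n x))) \<noteq> top")
      case True
      then have s: "summable (\<lambda>n. cmod (F n x))" by (intro summable_suminf_not_top) auto
      have "((\<lambda>n. F n x) has_sum (\<Sum>n. F n x)) UNIV"
        by (rule norm_summable_imp_has_sum[OF s summable_sums[OF summable_norm_cancel[OF s]]])
      then show ?thesis using True p by (simp add: infsumI)
    next
      case False
      have "\<not> (\<lambda>n. F n x) summable_on UNIV"
      proof
        assume "(\<lambda>n. F n x) summable_on UNIV"
        then have "summable (\<lambda>n. cmod (F n x))"
          unfolding summable_on_iff_abs_summable_on_complex by (rule summable_on_imp_summable)
        then have "(\<Sum>n. ennreal (cmod (F n x))) \<noteq> top" by (rule ennreal_suminf_neq_top) simp
        then show False using False by simp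
      qed
      then show ?thesis using False p by (simp add: infsum_not_exists)
    qed
  qed
  then have "periodization f \<rho> = (\<lambda>x. if (\<Sum>n. ennreal (cmod (F n x))) \<noteq> top then (\<Sum>n. F n x) else 0)" by blast
  also have "\<dots> \<in> borel_measurable lebesgue" by measurable
  finally show ?thesis .
qed

text \<open>Where the family is not summable the left side is 0 by convention, and where the
  majorant diverges the right side is infinite; otherwise finite partial sums are compared.\<close>

lemma norm_periodization_le:
  fixes f :: "real^'n \<Rightarrow> complex"
  assumes fg: "\<And>x. ennreal (cmod (f x)) \<le> g x"
  shows "ennreal (cmod (periodization f \<rho> x)) \<le> (\<integral>\<^sup>+\<nu>. g (\<rho> *v (x - \<nu>)) \<partial>count_space int_lattice)"
proof (cases "(\<integral>\<^sup>+\<nu>. g (\<rho> *v (x - \<nu>)) \<partial>count_space int_lattice) = top \<or> \<not> (\<lambda>\<nu>. f (\<rho> *v (x - \<nu>))) summable_on int_lattice")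
  case True
  then show ?thesis by (auto simp: periodization_def infsum_not_exists)
next
  case False
  let ?f = "\<lambda>\<nu>. f (\<rho> *v (x - \<nu>))"
  obtain r where r: "r \<ge> 0" "(\<integral>\<^sup>+\<nu>. g (\<rho> *v (x - \<nu>)) \<partial>count_space int_lattice) = ennreal r"
    using False by (cases "\<integral>\<^sup>+\<nu>. g (\<rho> *v (x - \<nu>)) \<partial>count_space int_lattice") auto
  have s: "(\<lambda>\<nu>. cmod (?f \<nu>)) summable_on int_lattice" using False by (simp add: summable_on_iff_abs_summable_on_complex)
  have "cmod (periodization f \<rho> x) \<le> infsum (\<lambda>\<nu>. cmod (?f \<nu>)) int_lattice"
    unfolding periodization_def by (rule norm_infsum_bound[OF s])
  also have "\<dots> \<le> r"
  proof (rule infsum_le_finite_sums[OF s])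
    fix A :: "(real^'n) set" assume A: "finite A" "A \<subseteq> int_lattice"
    have "ennreal (\<Sum>\<nu>\<in>A. cmod (?f \<nu>)) = (\<Sum>\<nu>\<in>A. ennreal (cmod (?f \<nu>)))" by simp
    also have "\<dots> = (\<integral>\<^sup>+\<nu>. ennreal (cmod (?f \<nu>)) * indicator A \<nu> \<partial>count_space int_lattice)"
      using A by (subst nn_integral_count_space'[of A]) auto
    also have "\<dots> \<le> (\<integral>\<^sup>+\<nu>. g (\<rho> *v (x - \<nu>)) \<partial>count_space int_lattice)"
      by (intro nn_integral_mono) (auto simp: fg split: split_indicator)
    finally show "(\<Sum>\<nu>\<in>A. cmod (?f \<nu>)) \<le> r" using r by simp
  qed
  finally show ?thesis using r by (simp add: ennreal_leI)
qed

theorem theorem1: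
  assumes "CARD('n::finite) \<ge> 5"
  shows "\<exists>C::real. \<forall>(H :: (real^'n^'n) measure) (f :: real^'n \<Rightarrow> complex).
     is_haar_SO H \<and> integrable lebesgue f \<and> integrable lebesgue (\<lambda>x. (cmod (f x))\<^sup>2) \<longrightarrow>
       (AE \<rho> in H. periodization f \<rho> \<in> borel_measurable (lebesgue_on unit_cube) \<and>
                    integrable (lebesgue_on unit_cube) (\<lambda>x. (cmod (periodization f \<rho> x))\<^sup>2)) \<and>
       (\<integral>\<^sup>+ \<rho>. (\<integral>\<^sup>+ x. ennreal ((cmod (periodization f \<rho> x))\<^sup>2) \<partial>(lebesgue_on unit_cube)) \<partial>H)
         \<le> ennreal (C * (sqrt (\<integral>x. (cmod (f x))\<^sup>2 \<partial>lebesgue) + (\<integral>x. cmod (f x) \<partial>lebesgue))\<^sup>2)"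
proof -
  obtain C where C: "C > 0" and bound: "\<And>(H :: (real^'n^'n) measure) (g :: real^'n \<Rightarrow> ennreal). is_haar_SO H \<Longrightarrow> lsc g \<Longrightarrow>
     (\<integral>\<^sup>+x. g x \<partial>lborel) < \<infinity> \<Longrightarrow> (\<integral>\<^sup>+x. (g x)\<^sup>2 \<partial>lborel) < \<infinity> \<Longrightarrow>
     (\<integral>\<^sup>+\<rho>. \<integral>\<^sup>+u. acorr g (\<rho> *v u) \<partial>count_space int_lattice \<partial>H)
       \<le> ennreal C * ((\<integral>\<^sup>+x. g x \<partial>lborel)\<^sup>2 + (\<integral>\<^sup>+x. (g x)\<^sup>2 \<partial>lborel))"
    using haar_lattice_bound[OF assms] by blast
  \<comment> \<open>The factor 2^d is the overlap of cube translates from the unfolding.\<close>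
  define K where "K = 2 ^ CARD('n) * C"
  have K: "K > 0" using C by (simp add: K_def)
  show ?thesis (is "\<exists>C. \<forall>H f. ?R H f \<longrightarrow> ?Q C H f")
  proof (intro exI[of _ "4 * K"] allI impI)
    fix H :: "(real^'n^'n) measure" and f :: "real^'n \<Rightarrow> complex"
    assume "is_haar_SO H \<and> integrable lebesgue f \<and> integrable lebesgue (\<lambda>x. (cmod (f x))\<^sup>2)"
    then have haar: "is_haar_SO H" and f1: "integrable lebesgue f" and f2: "integrable lebesgue (\<lambda>x. (cmod (f x))\<^sup>2)" by auto
    note measurable_haar[OF haar, measurable]
    have fm: "f \<in> borel_measurable lebesgue" using f1 by auto
    define a where "a = (\<integral>x. cmod (f x) \<partial>lebesgue)"
    define b where "b = (\<integral>x. (cmod (f x))\<^sup>2 \<partial>lebesgue)"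
    have ab: "a \<ge> 0" "b \<ge> 0" by (simp_all add: a_def b_def)
    have A: "(\<integral>\<^sup>+x. ennreal (cmod (f x)) \<partial>lebesgue) = ennreal a"
      unfolding a_def using f1 by (intro nn_integral_eq_integral) auto
    have B: "(\<integral>\<^sup>+x. ennreal ((cmod (f x))\<^sup>2) \<partial>lebesgue) = ennreal b"
      unfolding b_def using f2 by (intro nn_integral_eq_integral) auto
    let ?p = "\<lambda>\<rho>. \<integral>\<^sup>+x. ennreal ((cmod (periodization f \<rho> x))\<^sup>2) \<partial>(lebesgue_on unit_cube)"
    have cube: "unit_cube \<inter> space lebesgue \<in> sets lebesgue" by simp
    \<comment> \<open>Measurability of \<open>?p\<close> in \<open>\<rho>\<close> is not
      established, and without it a finite nonnegative integral does not yield almost everywhere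
      finiteness. The measurable majorant G provides both the integral bound and the almost
      everywhere statement.\<close>
    have main: "\<exists>G. G \<in> borel_measurable H \<and> (\<forall>\<rho>\<in>SO_group. ?p \<rho> \<le> G \<rho>) \<and> (\<integral>\<^sup>+\<rho>. G \<rho> \<partial>H) \<le> ennreal (K * ((2 * a + e)\<^sup>2 + (4 * b + e)))"
      if e: "e > 0" for e
    proof -
      have "(\<lambda>x. cmod (f x)) \<in> borel_measurable lebesgue" using fm by measurable
      from lsc_majorant[OF this _ e] obtain g where g: "lsc g" and fg: "\<And>x. ennreal (cmod (f x)) \<le> g x"
        and g1: "(\<integral>\<^sup>+x. g x \<partial>lborel) \<le> 2 * ennreal a + ennreal e"
        and g2: "(\<integral>\<^sup>+x. (g x)\<^sup>2 \<partial>lborel) \<le> 4 * ennreal b + ennreal e"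
        unfolding A B by auto
      have gm[measurable]: "g \<in> borel_measurable borel" by (rule borel_measurable_lsc[OF g])
      have e1: "2 * ennreal a + ennreal e = ennreal (2 * a + e)" using ab e by (simp add: ennreal_mult ennreal_plus)
      have e2: "4 * ennreal b + ennreal e = ennreal (4 * b + e)" using ab e by (simp add: ennreal_mult ennreal_plus)
      have fin: "(\<integral>\<^sup>+x. g x \<partial>lborel) < \<infinity>" "(\<integral>\<^sup>+x. (g x)\<^sup>2 \<partial>lborel) < \<infinity>"
        using g1 g2 unfolding e1 e2 by (simp_all add: le_less_trans[OF _ ennreal_less_top])
      define G where "G \<rho> = ennreal (2 ^ CARD('n)) * (\<integral>\<^sup>+u. acorr g (\<rho> *v u) \<partial>count_space int_lattice)" for \<rho> :: "real^'n^'n"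
      have Gm: "(\<lambda>\<rho> :: real^'n^'n. \<integral>\<^sup>+u. acorr g (\<rho> *v u) \<partial>count_space int_lattice) \<in> borel_measurable H"
        by (rule borel_measurable_nn_integral_count_space[OF countable_lattice]) measurable
      have "?p \<rho> \<le> G \<rho>" if \<rho>: "\<rho> \<in> SO_group" for \<rho>
      proof -
        let ?S = "\<lambda>x. \<integral>\<^sup>+\<nu>. g (\<rho> *v (x - \<nu>)) \<partial>count_space int_lattice"
        have Sm: "?S \<in> borel_measurable borel"
          by (rule borel_measurable_nn_integral_count_space[OF countable_lattice]) measurable
        have "?p \<rho> = (\<integral>\<^sup>+x. ennreal ((cmod (periodization f \<rho> x))\<^sup>2) * indicator unit_cube x \<partial>lebesgue)"
          by (rule nn_integral_restrict_space[OF cube])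
        also have "\<dots> \<le> (\<integral>\<^sup>+x. indicator unit_cube x * (?S x)\<^sup>2 \<partial>lebesgue)"
        proof (rule nn_integral_mono)
          fix x
          have "ennreal ((cmod (periodization f \<rho> x))\<^sup>2) = (ennreal (cmod (periodization f \<rho> x)))\<^sup>2" by (simp add: ennreal_power)
          also have "\<dots> \<le> (?S x)\<^sup>2" by (intro power_mono norm_periodization_le fg) auto
          finally show "ennreal ((cmod (periodization f \<rho> x))\<^sup>2) * indicator unit_cube x \<le> indicator unit_cube x * (?S x)\<^sup>2"
            by (auto split: split_indicator)
        qed
        also have "\<dots> = (\<integral>\<^sup>+x. indicator unit_cube x * (?S x)\<^sup>2 \<partial>lborel)" by (rule nn_integral_completion)
        also have "\<dots> \<le> G \<rho>" unfolding G_def by (rule periodization_square_le[OF gm \<rho>])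
        finally show ?thesis .
      qed
      moreover have "G \<in> borel_measurable H" unfolding G_def using Gm by measurable
      moreover have "(\<integral>\<^sup>+\<rho>. G \<rho> \<partial>H) \<le> ennreal (K * ((2 * a + e)\<^sup>2 + (4 * b + e)))"
      proof -
        have "(\<integral>\<^sup>+\<rho>. G \<rho> \<partial>H) = ennreal (2 ^ CARD('n)) * (\<integral>\<^sup>+\<rho>. \<integral>\<^sup>+u. acorr g (\<rho> *v u) \<partial>count_space int_lattice \<partial>H)"
          unfolding G_def by (rule nn_integral_cmult[OF Gm])
        also have "\<dots> \<le> ennreal (2 ^ CARD('n)) * (ennreal C * ((\<integral>\<^sup>+x. g x \<partial>lborel)\<^sup>2 + (\<integral>\<^sup>+x. (g x)\<^sup>2 \<partial>lborel)))"
          by (intro mult_left_mono bound haar g fin) auto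
        also have "\<dots> \<le> ennreal (2 ^ CARD('n)) * (ennreal C * ((ennreal (2 * a + e))\<^sup>2 + ennreal (4 * b + e)))"
          using g1 g2 unfolding e1 e2 by (intro mult_left_mono add_mono power_mono) auto
        also have "\<dots> = ennreal (K * ((2 * a + e)\<^sup>2 + (4 * b + e)))"
          using C ab e by (simp add: K_def ennreal_power mult.assoc flip: ennreal_mult ennreal_plus)
        finally show ?thesis .
      qed
      ultimately show ?thesis by blast
    qed
    have sp: "space H = SO_group" by (rule space_haar[OF haar])
    have "(\<integral>\<^sup>+\<rho>. ?p \<rho> \<partial>H) \<le> ennreal (K * ((2 * a + e)\<^sup>2 + (4 * b + e)))" if e: "e > 0" for e
    proof -
      obtain G where G: "\<And>\<rho>. \<rho> \<in> SO_group \<Longrightarrow> ?p \<rho> \<le> G \<rho>" "(\<integral>\<^sup>+\<rho>. G \<rho> \<partial>H) \<le> ennreal (K * ((2 * a + e)\<^sup>2 + (4 * b + e)))"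
        using main[OF e] by blast
      have "(\<integral>\<^sup>+\<rho>. ?p \<rho> \<partial>H) \<le> (\<integral>\<^sup>+\<rho>. G \<rho> \<partial>H)" by (rule nn_integral_mono) (simp add: sp G)
      then show ?thesis using G(2) by (rule order_trans)
    qed
    then have lim: "(\<integral>\<^sup>+\<rho>. ?p \<rho> \<partial>H) \<le> ennreal (K * ((2 * a + 1 / real (Suc k))\<^sup>2 + (4 * b + 1 / real (Suc k))))" for k by simp
    \<comment> \<open>The additive error of the open sets is removed by letting e tend to 0, as the
      final bound has no additive constant. The dyadic rounding survives as the factor 4.\<close>
    have "(\<lambda>k. 1 / real (Suc k)) \<longlonglongrightarrow> 0" by (rule LIMSEQ_Suc) (rule lim_const_over_n)
    then have "(\<lambda>k. ennreal (K * ((2 * a + 1 / real (Suc k))\<^sup>2 + (4 * b + 1 / real (Suc k))))) \<longlonglongrightarrow> ennreal (K * ((2 * a + 0)\<^sup>2 + (4 * b + 0)))"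
      by (intro tendsto_ennrealI tendsto_intros)
    then have "(\<integral>\<^sup>+\<rho>. ?p \<rho> \<partial>H) \<le> ennreal (K * ((2 * a + 0)\<^sup>2 + (4 * b + 0)))"
      by (rule LIMSEQ_le_const) (use lim in blast)
    also have "\<dots> \<le> ennreal (4 * K * (sqrt b + a)\<^sup>2)"
    proof (rule ennreal_leI)
      have "0 \<le> sqrt b * a" using ab by simp
      then have "a\<^sup>2 + b \<le> (sqrt b + a)\<^sup>2" using ab by (simp add: power2_sum)
      then have "4 * K * (a\<^sup>2 + b) \<le> 4 * K * (sqrt b + a)\<^sup>2" using K by (intro mult_left_mono) auto
      then show "K * ((2 * a + 0)\<^sup>2 + (4 * b + 0)) \<le> 4 * K * (sqrt b + a)\<^sup>2" by (simp add: algebra_simps power_mult_distrib)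
    qed
    finally have ineq: "(\<integral>\<^sup>+\<rho>. ?p \<rho> \<partial>H) \<le> ennreal (4 * K * (sqrt b + a)\<^sup>2)" .
    have "AE \<rho> in H. periodization f \<rho> \<in> borel_measurable (lebesgue_on unit_cube) \<and>
                    integrable (lebesgue_on unit_cube) (\<lambda>x. (cmod (periodization f \<rho> x))\<^sup>2)"
    proof -
      obtain G where Gm: "G \<in> borel_measurable H" and G: "\<And>\<rho>. \<rho> \<in> SO_group \<Longrightarrow> ?p \<rho> \<le> G \<rho>"
        and Gi: "(\<integral>\<^sup>+\<rho>. G \<rho> \<partial>H) \<le> ennreal (K * ((2 * a + 1)\<^sup>2 + (4 * b + 1)))"
        using main[of 1] by auto
      have "(\<integral>\<^sup>+\<rho>. G \<rho> \<partial>H) \<noteq> \<infinity>" using Gi by (auto simp: top_unique)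
      then have "AE \<rho> in H. G \<rho> \<noteq> \<infinity>" by (rule nn_integral_PInf_AE[OF Gm])
      then show ?thesis
      proof (rule AE_mp, intro AE_I2 impI conjI)
        fix \<rho> assume "\<rho> \<in> space H" and fin: "G \<rho> \<noteq> \<infinity>"
        then have \<rho>: "\<rho> \<in> SO_group" by (simp add: sp)
        show m: "periodization f \<rho> \<in> borel_measurable (lebesgue_on unit_cube)"
          by (rule measurable_restrict_space1[OF borel_measurable_periodization[OF fm \<rho>]])
        have "?p \<rho> < \<infinity>" using G[OF \<rho>] fin by (simp add: less_top le_less_trans)
        then show "integrable (lebesgue_on unit_cube) (\<lambda>x. (cmod (periodization f \<rho> x))\<^sup>2)"
          using m by (intro integrableI_nonneg) auto
      qed
    qed
    then show "?Q (4 * K) H f"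
      using ineq unfolding a_def b_def by (rule conjI)
  qed
qed

end
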